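(* If there is a measurable cardinal and $x\in H(\omega_1)$, then no wellordering of $\mathcal{P}(\omega)$ is $\Sigma_1(x)$-definable.
   Context: We work in ZFC. $H(\omega_1)$ is the set of all hereditarily countable sets. A set $X$ is $\Sigma_1(y)$-definable if there is a $\Sigma_1$-formula $\varphi(v_0,v_1)$ (in the Lévy hierarchy, in the language of set theory) with $X=\{x\mid\varphi(x,y)\}$. A wellordering is identified with the corresponding set of ordered pairs. *)

theory Defs
  imports Main
begin

text \<open>
  ZFC is taken as a first-order theory: a result established "in ZFC" is one that holds in
  every structure \<open>('a, E)\<close> satisfying the ZFC axioms, where the type \<open>'a\<close> is the universe of
  sets and \<open>E x y\<close> reads "\<open>x\<close> is an element of \<open>y\<close>".  Every set-theoretic notion
  below is interpreted inside such a structure, so all quantifiers over sets, functions,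
  subsets and families range over \<open>'a\<close>.  In particular Separation and Replacement are assumed
  only for first-order formulas with parameters, not for arbitrary HOL predicates.
\<close>

datatype fm =
    Mem nat nat
  | Eq nat nat
  | Neg fm
  | And fm fm
  | Ex nat fm

fun sat :: "('a \<Rightarrow> 'a \<Rightarrow> bool) \<Rightarrow> (nat \<Rightarrow> 'a) \<Rightarrow> fm \<Rightarrow> bool" where
  "sat E e (Mem i j) \<longleftrightarrow> E (e i) (e j)"
| "sat E e (Eq i j) \<longleftrightarrow> e i = e j"
| "sat E e (Neg \<phi>) \<longleftrightarrow> \<not> sat E e \<phi>"
| "sat E e (And \<phi> \<psi>) \<longleftrightarrow> sat E e \<phi> \<and> sat E e \<psi>"
| "sat E e (Ex i \<phi>) \<longleftrightarrow> (\<exists>a. sat E (e(i := a)) \<phi>)"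

fun fv :: "fm \<Rightarrow> nat set" where
  "fv (Mem i j) = {i, j}"
| "fv (Eq i j) = {i, j}"
| "fv (Neg \<phi>) = fv \<phi>"
| "fv (And \<phi> \<psi>) = fv \<phi> \<union> fv \<psi>"
| "fv (Ex i \<phi>) = fv \<phi> - {i}"

text \<open>
  The bottom of the Levy hierarchy.  The bounded universal quantifier is the negation of a
  bounded existential one.  The condition \<open>i \<noteq> j\<close> is the usual proviso that the bounding set
  is not the quantified variable itself.
\<close>

inductive Delta0 :: "fm \<Rightarrow> bool" where
  "Delta0 (Mem i j)"
| "Delta0 (Eq i j)"
| "Delta0 \<phi> \<Longrightarrow> Delta0 (Neg \<phi>)"
| "Delta0 \<phi> \<Longrightarrow> Delta0 \<psi> \<Longrightarrow> Delta0 (And \<phi> \<psi>)"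
| "Delta0 \<phi> \<Longrightarrow> i \<noteq> j \<Longrightarrow> Delta0 (Ex i (And (Mem i j) \<phi>))"

text \<open>A (possibly empty) block of existential quantifiers in front of a \<open>\<Delta>\<^sub>0\<close>-formula.\<close>

inductive Sigma1 :: "fm \<Rightarrow> bool" where
  "Delta0 \<phi> \<Longrightarrow> Sigma1 \<phi>"
| "Sigma1 \<phi> \<Longrightarrow> Sigma1 (Ex i \<phi>)"

context
  fixes E :: "'a \<Rightarrow> 'a \<Rightarrow> bool"  (infix "\<epsilon>" 50)
begin

definition is_empty :: "'a \<Rightarrow> bool" where
  "is_empty a \<longleftrightarrow> (\<forall>x. \<not> x \<epsilon> a)"

definition subset_of :: "'a \<Rightarrow> 'a \<Rightarrow> bool" where
  "subset_of a b \<longleftrightarrow> (\<forall>x. x \<epsilon> a \<longrightarrow> x \<epsilon> b)"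

definition is_Pow :: "'a \<Rightarrow> 'a \<Rightarrow> bool" where
  "is_Pow a p \<longleftrightarrow> (\<forall>x. x \<epsilon> p \<longleftrightarrow> subset_of x a)"

definition is_succ :: "'a \<Rightarrow> 'a \<Rightarrow> bool" where
  "is_succ a s \<longleftrightarrow> (\<forall>x. x \<epsilon> s \<longleftrightarrow> x \<epsilon> a \<or> x = a)"

definition is_inductive :: "'a \<Rightarrow> bool" where
  "is_inductive w \<longleftrightarrow>
     (\<exists>z. is_empty z \<and> z \<epsilon> w) \<and> (\<forall>x. x \<epsilon> w \<longrightarrow> (\<exists>s. is_succ x s \<and> s \<epsilon> w))"

definition is_omega :: "'a \<Rightarrow> bool" where
  "is_omega w \<longleftrightarrow> is_inductive w \<and> (\<forall>v. is_inductive v \<longrightarrow> subset_of w v)"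

definition is_upair :: "'a \<Rightarrow> 'a \<Rightarrow> 'a \<Rightarrow> bool" where
  "is_upair a b p \<longleftrightarrow> (\<forall>x. x \<epsilon> p \<longleftrightarrow> x = a \<or> x = b)"

definition is_pair :: "'a \<Rightarrow> 'a \<Rightarrow> 'a \<Rightarrow> bool" where
  "is_pair a b p \<longleftrightarrow> (\<exists>s t. is_upair a a s \<and> is_upair a b t \<and> is_upair s t p)"

definition related :: "'a \<Rightarrow> 'a \<Rightarrow> 'a \<Rightarrow> bool" where
  "related r a b \<longleftrightarrow> (\<exists>p. is_pair a b p \<and> p \<epsilon> r)"

definition relation_between :: "'a \<Rightarrow> 'a \<Rightarrow> 'a \<Rightarrow> bool" where
  "relation_between r a b \<longleftrightarrow> (\<forall>p. p \<epsilon> r \<longrightarrow> (\<exists>x y. x \<epsilon> a \<and> y \<epsilon> b \<and> is_pair x y p))"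

definition is_injection :: "'a \<Rightarrow> 'a \<Rightarrow> 'a \<Rightarrow> bool" where
  "is_injection f a b \<longleftrightarrow>
     relation_between f a b \<and>
     (\<forall>x. x \<epsilon> a \<longrightarrow> (\<exists>!y. related f x y)) \<and>
     (\<forall>x x' y. related f x y \<and> related f x' y \<longrightarrow> x = x')"

definition card_le :: "'a \<Rightarrow> 'a \<Rightarrow> bool" where
  "card_le a b \<longleftrightarrow> (\<exists>f. is_injection f a b)"

definition card_less :: "'a \<Rightarrow> 'a \<Rightarrow> bool" where
  "card_less a b \<longleftrightarrow> card_le a b \<and> \<not> card_le b a"

definition countable_set :: "'a \<Rightarrow> bool" where
  "countable_set a \<longleftrightarrow> (\<exists>w. is_omega w \<and> card_le a w)"

definition Extensionality_axiom :: bool where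
  "Extensionality_axiom \<longleftrightarrow> (\<forall>a b. (\<forall>x. x \<epsilon> a \<longleftrightarrow> x \<epsilon> b) \<longrightarrow> a = b)"

definition Foundation_axiom :: bool where
  "Foundation_axiom \<longleftrightarrow>
     (\<forall>a. (\<exists>x. x \<epsilon> a) \<longrightarrow> (\<exists>x. x \<epsilon> a \<and> \<not> (\<exists>y. y \<epsilon> x \<and> y \<epsilon> a)))"

definition Pairing_axiom :: bool where
  "Pairing_axiom \<longleftrightarrow> (\<forall>a b. \<exists>p. is_upair a b p)"

definition Union_axiom :: bool where
  "Union_axiom \<longleftrightarrow> (\<forall>a. \<exists>u. \<forall>x. x \<epsilon> u \<longleftrightarrow> (\<exists>y. y \<epsilon> a \<and> x \<epsilon> y))"

definition Power_Set_axiom :: bool where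
  "Power_Set_axiom \<longleftrightarrow> (\<forall>a. \<exists>p. is_Pow a p)"

definition Infinity_axiom :: bool where
  "Infinity_axiom \<longleftrightarrow> (\<exists>w. is_inductive w)"

text \<open>
  In the two schemas the assignment \<open>e\<close> supplies the parameters; the formula's designated
  variables are number 0 (Separation) and numbers 0 and 1 (Replacement).
\<close>

definition Separation_schema :: bool where
  "Separation_schema \<longleftrightarrow>
     (\<forall>\<phi> e a. \<exists>b. \<forall>x. x \<epsilon> b \<longleftrightarrow> x \<epsilon> a \<and> sat E (e(0 := x)) \<phi>)"

definition Replacement_schema :: bool where
  "Replacement_schema \<longleftrightarrow>
     (\<forall>\<phi> e a.
        (\<forall>x y z. x \<epsilon> a \<and> sat E (e(0 := x, 1 := y)) \<phi> \<and> sat E (e(0 := x, 1 := z)) \<phi> \<longrightarrow> y = z) \<longrightarrow>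
        (\<exists>b. \<forall>y. y \<epsilon> b \<longleftrightarrow> (\<exists>x. x \<epsilon> a \<and> sat E (e(0 := x, 1 := y)) \<phi>)))"

definition Choice_axiom :: bool where
  "Choice_axiom \<longleftrightarrow>
     (\<forall>a. (\<forall>x. x \<epsilon> a \<longrightarrow> \<not> is_empty x) \<and>
          (\<forall>x y. x \<epsilon> a \<and> y \<epsilon> a \<and> x \<noteq> y \<longrightarrow> \<not> (\<exists>z. z \<epsilon> x \<and> z \<epsilon> y)) \<longrightarrow>
          (\<exists>c. \<forall>x. x \<epsilon> a \<longrightarrow> (\<exists>!z. z \<epsilon> x \<and> z \<epsilon> c)))"

definition ZFC :: bool where
  "ZFC \<longleftrightarrow>
     Extensionality_axiom \<and> Foundation_axiom \<and> Pairing_axiom \<and> Union_axiom \<and>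
     Power_Set_axiom \<and> Infinity_axiom \<and> Separation_schema \<and> Replacement_schema \<and>
     Choice_axiom"

definition transitive_set :: "'a \<Rightarrow> bool" where
  "transitive_set t \<longleftrightarrow> (\<forall>x. x \<epsilon> t \<longrightarrow> subset_of x t)"

definition is_transitive_closure :: "'a \<Rightarrow> 'a \<Rightarrow> bool" where
  "is_transitive_closure x t \<longleftrightarrow>
     transitive_set t \<and> subset_of x t \<and>
     (\<forall>s. transitive_set s \<and> subset_of x s \<longrightarrow> subset_of t s)"

text \<open>Membership in \<open>H(\<omega>\<^sub>1)\<close>.\<close>

definition hereditarily_countable :: "'a \<Rightarrow> bool" where
  "hereditarily_countable x \<longleftrightarrow> (\<exists>t. is_transitive_closure x t \<and> countable_set t)"

text \<open>Ordinals are transitive sets of transitive sets; cardinals are initial ordinals.\<close>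

definition is_ordinal :: "'a \<Rightarrow> bool" where
  "is_ordinal a \<longleftrightarrow> transitive_set a \<and> (\<forall>x. x \<epsilon> a \<longrightarrow> transitive_set x)"

definition is_cardinal :: "'a \<Rightarrow> bool" where
  "is_cardinal k \<longleftrightarrow> is_ordinal k \<and> (\<forall>a. a \<epsilon> k \<longrightarrow> card_less a k)"

definition is_ultrafilter :: "'a \<Rightarrow> 'a \<Rightarrow> bool" where
  "is_ultrafilter u k \<longleftrightarrow>
     (\<forall>a. a \<epsilon> u \<longrightarrow> subset_of a k) \<and>
     k \<epsilon> u \<and>
     (\<forall>a. a \<epsilon> u \<longrightarrow> \<not> is_empty a) \<and>
     (\<forall>a b. a \<epsilon> u \<and> subset_of a b \<and> subset_of b k \<longrightarrow> b \<epsilon> u) \<and>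
     (\<forall>a b c. a \<epsilon> u \<and> b \<epsilon> u \<and> (\<forall>x. x \<epsilon> c \<longleftrightarrow> x \<epsilon> a \<and> x \<epsilon> b) \<longrightarrow> c \<epsilon> u) \<and>
     (\<forall>a c. subset_of a k \<and> (\<forall>x. x \<epsilon> c \<longleftrightarrow> x \<epsilon> k \<and> \<not> x \<epsilon> a) \<longrightarrow> a \<epsilon> u \<or> c \<epsilon> u)"

definition nonprincipal :: "'a \<Rightarrow> bool" where
  "nonprincipal u \<longleftrightarrow> \<not> (\<exists>a s. is_upair a a s \<and> s \<epsilon> u)"

text \<open>The empty family is excluded, since \<open>\<Inter>\<close> of it is not a set.\<close>

definition complete_filter :: "'a \<Rightarrow> 'a \<Rightarrow> bool" where
  "complete_filter u k \<longleftrightarrow>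
     (\<forall>F c. subset_of F u \<and> \<not> is_empty F \<and> card_less F k \<and>
            (\<forall>x. x \<epsilon> c \<longleftrightarrow> (\<forall>a. a \<epsilon> F \<longrightarrow> x \<epsilon> a)) \<longrightarrow> c \<epsilon> u)"

definition measurable_cardinal :: "'a \<Rightarrow> bool" where
  "measurable_cardinal k \<longleftrightarrow>
     is_cardinal k \<and> \<not> countable_set k \<and>
     (\<exists>u. is_ultrafilter u k \<and> nonprincipal u \<and> complete_filter u k)"

definition linear_wellfounded :: "'a \<Rightarrow> 'a \<Rightarrow> bool" where
  "linear_wellfounded r a \<longleftrightarrow>
     relation_between r a a \<and>
     (\<forall>x y z. related r x y \<and> related r y z \<longrightarrow> related r x z) \<and>
     (\<forall>x y. x \<epsilon> a \<and> y \<epsilon> a \<and> x \<noteq> y \<longrightarrow> related r x y \<or> related r y x) \<and>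
     (\<forall>s. subset_of s a \<and> \<not> is_empty s \<longrightarrow>
          (\<exists>m. m \<epsilon> s \<and> (\<forall>x. x \<epsilon> s \<and> x \<noteq> m \<longrightarrow> related r m x)))"

definition strict_wellordering :: "'a \<Rightarrow> 'a \<Rightarrow> bool" where
  "strict_wellordering r a \<longleftrightarrow>
     linear_wellfounded r a \<and> (\<forall>x. x \<epsilon> a \<longrightarrow> \<not> related r x x)"

definition reflexive_wellordering :: "'a \<Rightarrow> 'a \<Rightarrow> bool" where
  "reflexive_wellordering r a \<longleftrightarrow>
     linear_wellfounded r a \<and> (\<forall>x. x \<epsilon> a \<longrightarrow> related r x x) \<and>
     (\<forall>x y. related r x y \<and> related r y x \<longrightarrow> x = y)"

text \<open>Both conventions for wellorderings, \<open><\<close> and \<open>\<le>\<close>, are admitted.\<close>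

definition is_wellordering :: "'a \<Rightarrow> 'a \<Rightarrow> bool" where
  "is_wellordering r a \<longleftrightarrow> strict_wellordering r a \<or> reflexive_wellordering r a"

text \<open>
  \<open>X = {x | \<phi>(x, y)}\<close> for a \<open>\<Sigma>\<^sub>1\<close>-formula \<open>\<phi>(v\<^sub>0, v\<^sub>1)\<close>; the values of the assignment at
  variables other than 0 and 1 are irrelevant.
\<close>

definition Sigma1_definable :: "'a \<Rightarrow> 'a \<Rightarrow> bool" where
  "Sigma1_definable y X \<longleftrightarrow>
     (\<exists>\<phi>. Sigma1 \<phi> \<and> fv \<phi> \<subseteq> {0, 1} \<and>
          (\<forall>x. x \<epsilon> X \<longleftrightarrow> sat E (\<lambda>i. if i = 0 then x else y) \<phi>))"

end

end

theory Submission imports Defs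
begin

text \<open>
  By Lowenheim--Skolem and Mostowski collapse a \<open>\<Sigma>\<^sub>1(x)\<close>-definable relation on reals, with \<open>x\<close>
  hereditarily countable, holds iff some real codes a wellfounded structure witnessing it, i.e. it
  is \<open>\<Sigma>\<^sup>1\<^sub>2\<close> in a real. Given such a wellordering, let \<open>A\<close> be the set of the reals that are least
  among their finite variants; it is again \<open>\<Sigma>\<^sup>1\<^sub>2\<close>, meets every class modulo finite changes, and has
  no two members that differ in exactly one bit, so it does not have the Baire property.

  A measurable cardinal \<open>K\<close> contradicts this by Martin's argument. Consider the Banach--Mazur game
  in which one player builds \<open>a\<close> together with a witness for \<open>a \<in> A\<close>, certifying wellfoundedness by
  an embedding \<open>f\<close> into \<open>K\<close>. It is closed, hence determined. If this player wins, playing two copies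
  of the winning strategy against each other yields two members of \<open>A\<close> differing in one bit. If the
  opponent wins, the measure on \<open>K\<close> makes the replies independent of \<open>f\<close>, only countably many dense
  sets matter, and a real generic for them and all its finite variants lie outside \<open>A\<close>.

  All of this takes place inside a model of ZFC whose natural numbers may be nonstandard, so every
  set has to be obtained from a first-order formula with parameters.
\<close>

section \<open>Definable classes with parameters\<close>

text \<open>The game needs a payoff whose only clause that is not closed is a wellfoundedness;
  playing ordinals then removes it. This dictates the coding: all requirements on a coded structure
  are universal with locally constant instances, and the countably many codes needed for one real
  share a single sequence \<open>y\<close> and a single linear order \<open>L\<close>. What remains
  to be certified is that \<open>L\<close> is wellfounded.

  If the opponent wins, the order of choices matters. The opponent sees the ordinals
  \<open>f\<close>, but for almost all \<open>f\<close> the reply depends only on the string played,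
  the finite part of \<open>y\<close> and the order pattern of \<open>f\<close>, which the finite
  part of \<open>L\<close> records. The generic real is built from these decided replies before any
  \<open>y\<close> and \<open>L\<close> are known. If a variant of it had a witness, the strings of
  a play could be fixed next, and \<open>f\<close> last, by recursion along \<open>L\<close>, each
  value avoiding countably many null sets. For this recursion the finite products of the measure
  have to be iterated along the coded order and not along the numbers.\<close>

lemma finite_fv: "finite (fv \<phi>)"
  by (induction \<phi>) auto

lemma sat_fv_cong: "(\<And>i. i \<in> fv \<phi> \<Longrightarrow> e i = e' i) \<Longrightarrow> sat E e \<phi> = sat E e' \<phi>"
proof (induction \<phi> arbitrary: e e')
  case (Ex i \<phi>)
  have "sat E (e(i := a)) \<phi> = sat E (e'(i := a)) \<phi>" for a
    by (rule Ex.IH) (use Ex.prems in auto)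
  then show ?case by simp
next
  case (Neg \<phi>)
  then show ?case by (metis fv.simps(3) sat.simps(3))
next
  case (And \<phi> \<psi>)
  then show ?case by (metis UnCI fv.simps(4) sat.simps(4))
qed auto

text \<open>Capture is avoided semantically: under a quantifier the bound variable is sent to some
  \<open>j\<close> outside the image of the free variables.\<close>

lemma sat_rename: "\<exists>\<phi>'. \<forall>e. sat E e \<phi>' = sat E (\<lambda>i. e (\<sigma> i)) \<phi>"
proof (induction \<phi> arbitrary: \<sigma>)
  case (Mem i j)
  show ?case by (rule exI[of _ "Mem (\<sigma> i) (\<sigma> j)"]) simp
next
  case (Eq i j)
  show ?case by (rule exI[of _ "Eq (\<sigma> i) (\<sigma> j)"]) simp
next
  case (Neg \<phi>)
  then obtain \<phi>' where "\<forall>e. sat E e \<phi>' = sat E (\<lambda>i. e (\<sigma> i)) \<phi>" by blast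
  then show ?case by (intro exI[of _ "Neg \<phi>'"]) simp
next
  case (And \<phi> \<psi>)
  from And.IH(1)[of \<sigma>] obtain \<phi>' where "\<forall>e. sat E e \<phi>' = sat E (\<lambda>i. e (\<sigma> i)) \<phi>" by blast
  moreover from And.IH(2)[of \<sigma>] obtain \<psi>' where "\<forall>e. sat E e \<psi>' = sat E (\<lambda>i. e (\<sigma> i)) \<psi>" by blast
  ultimately show ?case by (intro exI[of _ "And \<phi>' \<psi>'"]) simp
next
  case (Ex i \<phi>)
  obtain j where j: "j \<notin> \<sigma> ` fv \<phi>"
    using ex_new_if_finite[OF infinite_UNIV_nat finite_imageI[OF finite_fv]] by blast
  obtain \<phi>' where \<phi>': "\<forall>e. sat E e \<phi>' = sat E (\<lambda>k. e ((\<sigma>(i := j)) k)) \<phi>"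
    using Ex.IH[of "\<sigma>(i := j)"] by blast
  have "sat E (e(j := a)) \<phi>' = sat E ((\<lambda>k. e (\<sigma> k))(i := a)) \<phi>" for e a
    unfolding \<phi>'[rule_format] by (rule sat_fv_cong) (use j in auto)
  then show ?case by (intro exI[of _ "Ex j \<phi>'"]) simp
qed

text \<open>Interleaving leaves infinitely many slots for the variables (even) and for the
  parameters (odd), so neither side has to know how many the other uses.\<close>

definition merge :: "(nat \<Rightarrow> 'a) \<Rightarrow> (nat \<Rightarrow> 'a) \<Rightarrow> nat \<Rightarrow> 'a" where
  "merge e c i = (if even i then e (i div 2) else c (i div 2))"

locale zfc =
  fixes E :: "'a \<Rightarrow> 'a \<Rightarrow> bool"  (infix "\<epsilon>" 50)
  assumes ZFC: "ZFC E"
begin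

text \<open>A shallow embedding: \<open>P\<close> is an external predicate, and its formula is never
  written down but obtained from the closure rules collected in \<open>dfn\<close>. Parameters are
  arbitrary elements of the model, so constants introduced by a choice operator are
  admissible.\<close>

definition definable :: "((nat \<Rightarrow> 'a) \<Rightarrow> bool) \<Rightarrow> bool" where
  "definable P \<longleftrightarrow> (\<exists>\<phi> c. \<forall>e. P e = sat E (merge e c) \<phi>)"

text \<open>Quantifiers and set abstractions bind variable 0 and shift the others, as with de Bruijn indices.\<close>

definition dterm :: "((nat \<Rightarrow> 'a) \<Rightarrow> 'a) \<Rightarrow> bool" where
  "dterm t \<longleftrightarrow> definable (\<lambda>e. e 0 = t (\<lambda>i. e (Suc i)))"

named_theorems dfn

lemma definable_rename:
  assumes "definable P" shows "definable (\<lambda>e. P (\<lambda>i. e (\<sigma> i)))"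
proof -
  obtain \<phi> c where P: "\<And>e. P e = sat E (merge e c) \<phi>" using assms unfolding definable_def by blast
  define \<sigma>' where "\<sigma>' i = (if even i then 2 * \<sigma> (i div 2) else i)" for i
  obtain \<phi>' where \<phi>': "\<And>e. sat E e \<phi>' = sat E (\<lambda>i. e (\<sigma>' i)) \<phi>" using sat_rename[of E \<sigma>' \<phi>] by blast
  have "(\<lambda>i. merge e c (\<sigma>' i)) = merge (\<lambda>i. e (\<sigma> i)) c" for e
    by (auto simp: merge_def \<sigma>'_def fun_eq_iff)
  then show ?thesis unfolding definable_def P by (metis \<phi>')
qed

lemma definable_not [dfn]: "definable P \<Longrightarrow> definable (\<lambda>e. \<not> P e)"
  unfolding definable_def by (metis sat.simps(3))

lemma definable_conj [dfn]:
  assumes "definable P" "definable Q" shows "definable (\<lambda>e. P e \<and> Q e)"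
proof -
  obtain \<phi> c where P: "\<And>e. P e = sat E (merge e c) \<phi>" using assms(1) unfolding definable_def by blast
  obtain \<psi> d where Q: "\<And>e. Q e = sat E (merge e d) \<psi>" using assms(2) unfolding definable_def by blast
  \<comment> \<open>The two parameter assignments are merged once more: those of the first conjunct
    go to the slots \<open>4k + 1\<close>, those of the second to \<open>4k + 3\<close>.\<close>
  define \<sigma> where "\<sigma> i = (if even i then i else 4 * (i div 2) + 1)" for i :: nat
  define \<tau> where "\<tau> i = (if even i then i else 4 * (i div 2) + 3)" for i :: nat
  obtain \<phi>' where \<phi>': "\<And>e. sat E e \<phi>' = sat E (\<lambda>i. e (\<sigma> i)) \<phi>" using sat_rename[of E \<sigma> \<phi>] by blast
  obtain \<psi>' where \<psi>': "\<And>e. sat E e \<psi>' = sat E (\<lambda>i. e (\<tau> i)) \<psi>" using sat_rename[of E \<tau> \<psi>] by blast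
  have "merge e (merge c d) (\<sigma> i) = merge e c i" for e i
  proof (cases "even i")
    case False
    then obtain k where "i = 2 * k + 1" by (elim oddE)
    moreover have "(4 * k + 1) div 2 = 2 * k" "odd (4 * k + 1)" by presburger+
    ultimately show ?thesis by (simp add: merge_def \<sigma>_def)
  qed (simp add: merge_def \<sigma>_def)
  moreover have "merge e (merge c d) (\<tau> i) = merge e d i" for e i
  proof (cases "even i")
    case False
    then obtain k where "i = 2 * k + 1" by (elim oddE)
    moreover have "(4 * k + 3) div 2 = 2 * k + 1" "odd (4 * k + 3)" by presburger+
    ultimately show ?thesis by (simp add: merge_def \<tau>_def)
  qed (simp add: merge_def \<tau>_def)
  ultimately have "(P e \<and> Q e) = sat E (merge e (merge c d)) (And \<phi>' \<psi>')" for e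
    unfolding P Q by (simp add: \<phi>' \<psi>')
  then show ?thesis unfolding definable_def by blast
qed

lemma definable_ex [dfn]:
  assumes "definable (\<lambda>e. P (\<lambda>i. e (Suc i)) (e 0))" shows "definable (\<lambda>e. \<exists>y. P e y)"
proof -
  obtain \<phi> c where P: "\<And>e. P (\<lambda>i. e (Suc i)) (e 0) = sat E (merge e c) \<phi>"
    using assms unfolding definable_def by blast
  \<comment> \<open>The bound variable takes the odd slot 1. The parameters move up by one odd slot
    to make room, the other variables down by one even slot; the entry \<open>c 0\<close> that
    \<open>c'\<close> puts into slot 1 gets overwritten.\<close>
  define \<sigma> where "\<sigma> i = (if i = 0 then 1 else if even i then i - 2 else i + 2)" for i :: nat
  obtain \<phi>' where \<phi>': "\<And>e. sat E e \<phi>' = sat E (\<lambda>i. e (\<sigma> i)) \<phi>" using sat_rename[of E \<sigma> \<phi>] by blast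
  define c' where "c' = case_nat (c 0) c"
  have "((merge e c')(1 := y)) (\<sigma> i) = merge (case_nat y e) c i" for e y i
  proof (cases "even i \<and> i \<noteq> 0")
    case True
    then obtain j where "i = 2 * Suc j" by (metis evenE not0_implies_Suc mult_0_right)
    then show ?thesis by (simp add: merge_def \<sigma>_def)
  qed (auto simp: merge_def \<sigma>_def c'_def)
  then have "P e y = sat E ((merge e c')(1 := y)) \<phi>'" for e y
    using P[of "case_nat y e"] by (simp add: \<phi>')
  then have "(\<exists>y. P e y) = sat E (merge e c') (Ex 1 \<phi>')" for e by simp
  then show ?thesis unfolding definable_def by blast
qed

lemma definable_disj [dfn]: "definable P \<Longrightarrow> definable Q \<Longrightarrow> definable (\<lambda>e. P e \<or> Q e)"
  using definable_not[OF definable_conj[OF definable_not definable_not], of P Q] by simp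

lemma definable_imp [dfn]: "definable P \<Longrightarrow> definable Q \<Longrightarrow> definable (\<lambda>e. P e \<longrightarrow> Q e)"
  using definable_disj[OF definable_not, of P Q] by (simp only: imp_conv_disj)

lemma definable_iff [dfn]: "definable P \<Longrightarrow> definable Q \<Longrightarrow> definable (\<lambda>e. P e = Q e)"
  using definable_conj[OF definable_imp definable_imp, of P Q Q P] by (simp only: iff_conv_conj_imp)

lemma definable_all [dfn]:
  "definable (\<lambda>e. P (\<lambda>i. e (Suc i)) (e 0)) \<Longrightarrow> definable (\<lambda>e. \<forall>y. P e y)"
  using definable_not[OF definable_ex[OF definable_not], of P] by simp

lemma definable_const [dfn]: "definable (\<lambda>e. P)"
proof -
  have "(\<lambda>e. P) = (\<lambda>e :: nat \<Rightarrow> 'a. sat E (merge e e) (if P then Eq 0 0 else Neg (Eq 0 0)))" by auto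
  then show ?thesis unfolding definable_def
    by (intro exI[of _ "if P then Eq 0 0 else Neg (Eq 0 0)"] exI[of _ undefined]) auto
qed

lemma dterm_var [dfn]: "dterm (\<lambda>e. e n)"
  unfolding dterm_def definable_def
  by (rule exI[of _ "Eq 0 (2 * Suc n)"]) (simp add: merge_def)

lemma dterm_const [dfn]: "dterm (\<lambda>e. c)"
  unfolding dterm_def definable_def
  by (rule exI[of _ "Eq 0 1"], rule exI[of _ "\<lambda>_. c"]) (simp add: merge_def)

lemma dterm_shift: "dterm t \<Longrightarrow> dterm (\<lambda>e. t (\<lambda>i. e (\<sigma> i)))"
  unfolding dterm_def by (drule definable_rename[where \<sigma> = "case_nat 0 (\<lambda>i. Suc (\<sigma> i))"]) simp

lemma definable_dterm_eq: "dterm t \<Longrightarrow> definable (\<lambda>e. e n = t (\<lambda>i. e (\<sigma> i)))"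
  unfolding dterm_def by (drule definable_rename[where \<sigma> = "case_nat n \<sigma>"]) simp

text \<open>Formulas have no function symbols, so substituting a term means
  \<open>\<exists>y. y = t e \<and> Q y\<close>. This and its variants for several arguments let
  every defined notion enter later definability proofs.\<close>

lemma definable_comp1:
  assumes "definable (\<lambda>e. Q (e 0))" "dterm t" shows "definable (\<lambda>e. Q (t e))"
proof -
  have "definable (\<lambda>e. \<exists>y. y = t e \<and> Q y)"
    by (intro definable_ex definable_conj definable_dterm_eq assms)
  then show ?thesis by simp
qed

lemma definable_comp2:
  assumes "definable (\<lambda>e. Q (e 0) (e 1))" "dterm t" "dterm u" shows "definable (\<lambda>e. Q (t e) (u e))"
proof -
  have "definable (\<lambda>e. \<exists>y. y = t e \<and> (\<exists>z. z = u e \<and> Q y z))"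
    using definable_rename[OF assms(1), of "case_nat 1 (case_nat 0 id)"]
    by (intro definable_ex definable_conj definable_dterm_eq assms(2,3)) simp
  then show ?thesis by simp
qed

lemma definable_comp3:
  assumes "definable (\<lambda>e. Q (e 0) (e 1) (e 2))" "dterm t" "dterm u" "dterm v"
  shows "definable (\<lambda>e. Q (t e) (u e) (v e))"
proof -
  \<comment> \<open>Nested quantifiers list the arguments in reverse, hence the renaming by
    \<open>2 - i\<close>; truncated subtraction makes the remaining indices harmless.\<close>
  have "definable (\<lambda>e. \<exists>x. x = t e \<and> (\<exists>y. y = u e \<and> (\<exists>z. z = v e \<and> Q x y z)))"
    using definable_rename[OF assms(1), of "\<lambda>i. 2 - i"]
    by (intro definable_ex definable_conj definable_dterm_eq assms(2-)) (simp add: numeral_2_eq_2)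
  then show ?thesis by simp
qed

lemma definable_comp4:
  assumes "definable (\<lambda>e. Q (e 0) (e 1) (e 2) (e 3))" "dterm t" "dterm u" "dterm v" "dterm w"
  shows "definable (\<lambda>e. Q (t e) (u e) (v e) (w e))"
proof -
  have "definable (\<lambda>e. \<exists>x. x = t e \<and> (\<exists>y. y = u e \<and> (\<exists>z. z = v e \<and> (\<exists>w'. w' = w e \<and> Q x y z w'))))"
    using definable_rename[OF assms(1), of "\<lambda>i. 3 - i"]
    by (intro definable_ex definable_conj definable_dterm_eq assms(2-)) (simp add: numeral_2_eq_2 numeral_3_eq_3)
  then show ?thesis by simp
qed

lemma dterm_comp1:
  assumes "dterm (\<lambda>e. F (e 0))" "dterm t" shows "dterm (\<lambda>e. F (t e))"
  unfolding dterm_def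
  by (rule definable_comp2[of "\<lambda>x y. x = F y", OF _ dterm_var dterm_shift[OF assms(2)]])
     (use assms(1) in \<open>simp add: dterm_def\<close>)

lemma dterm_comp2:
  assumes "dterm (\<lambda>e. F (e 0) (e 1))" "dterm t" "dterm u" shows "dterm (\<lambda>e. F (t e) (u e))"
  unfolding dterm_def
  by (rule definable_comp3[of "\<lambda>x y z. x = F y z", OF _ dterm_var dterm_shift[OF assms(2)] dterm_shift[OF assms(3)]])
     (use assms(1) in \<open>simp add: dterm_def numeral_2_eq_2\<close>)

lemma definable_mem [dfn]: "dterm t \<Longrightarrow> dterm u \<Longrightarrow> definable (\<lambda>e. t e \<epsilon> u e)"
  by (rule definable_comp2)
     (auto simp: definable_def merge_def intro!: exI[of _ "Mem 0 2"])

lemma definable_eq [dfn]: "dterm t \<Longrightarrow> dterm u \<Longrightarrow> definable (\<lambda>e. t e = u e)"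
  by (rule definable_comp2)
     (auto simp: definable_def merge_def intro!: exI[of _ "Eq 0 2"])

text \<open>The formula is fixed outside the model, so recursion on it produces an actual formula
  and no truth predicate inside the model is involved.\<close>

lemma definable_sat [dfn]: "(\<And>i. dterm (t i)) \<Longrightarrow> definable (\<lambda>e. sat E (\<lambda>i. t i e) \<phi>)"
proof (induction \<phi> arbitrary: t)
  case (Ex j \<phi>)
  define t' where "t' i = (if i = j then (\<lambda>e. e 0) else (\<lambda>e. t i (\<lambda>i. e (Suc i))))" for i
  have "definable (\<lambda>e. sat E (\<lambda>i. t' i e) \<phi>)"
    by (rule Ex.IH) (auto simp: t'_def dterm_var dterm_shift Ex.prems)
  moreover have "(\<lambda>i. t i (\<lambda>i. e (Suc i)))(j := e 0) = (\<lambda>i. t' i e)" for e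
    by (auto simp: t'_def)
  ultimately show ?case unfolding sat.simps
    by (intro definable_ex) simp
qed (auto intro!: dfn)

text \<open>Finiteness here is external, which makes the quantifier an actual finite
  conjunction.\<close>

lemma definable_finite_ball:
  "finite S \<Longrightarrow> (\<And>s. s \<in> S \<Longrightarrow> definable (P s)) \<Longrightarrow> definable (\<lambda>e. \<forall>s\<in>S. P s e)"
  by (induction S rule: finite_induct) (auto intro!: dfn)

lemma definable_ex1 [dfn]:
  assumes "definable (\<lambda>e. P (\<lambda>i. e (Suc i)) (e 0))" shows "definable (\<lambda>e. \<exists>!y. P e y)"
proof -
  have "definable (\<lambda>e. \<exists>y. P e y \<and> (\<forall>z. P e z \<longrightarrow> z = y))"
    using definable_rename[OF assms, of "case_nat 0 (\<lambda>i. Suc (Suc i))"]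
    by (intro definable_ex definable_conj definable_all definable_imp definable_eq dterm_var assms) simp
  then show ?thesis unfolding Ex1_def .
qed

subsection \<open>Basic set operations\<close>

lemma ext: "(\<And>x. x \<epsilon> a \<longleftrightarrow> x \<epsilon> b) \<Longrightarrow> a = b"
  using ZFC unfolding ZFC_def Extensionality_axiom_def by blast

lemma separation:
  assumes "definable (\<lambda>e. P (e 0))" shows "\<exists>b. \<forall>x. x \<epsilon> b \<longleftrightarrow> x \<epsilon> a \<and> P x"
proof -
  obtain \<phi> c where P: "\<And>e. P (e 0) = sat E (merge e c) \<phi>" using assms unfolding definable_def by blast
  have *: "(merge c c)(0 := x) = merge (c(0 := x)) c" for x
    by (auto simp: merge_def fun_eq_iff elim!: evenE)
  have "\<exists>b. \<forall>x. x \<epsilon> b \<longleftrightarrow> x \<epsilon> a \<and> sat E ((merge c c)(0 := x)) \<phi>"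
    using ZFC unfolding ZFC_def Separation_schema_def by blast
  then show ?thesis unfolding * P[symmetric] by simp
qed

lemma replacement:
  assumes "definable (\<lambda>e. P (e 0) (e 1))" "\<And>x y z. x \<epsilon> a \<Longrightarrow> P x y \<Longrightarrow> P x z \<Longrightarrow> y = z"
  shows "\<exists>b. \<forall>y. y \<epsilon> b \<longleftrightarrow> (\<exists>x. x \<epsilon> a \<and> P x y)"
proof -
  obtain \<phi> c where P: "\<And>e. P (e 0) (e 1) = sat E (merge e c) \<phi>" using assms unfolding definable_def by blast
  \<comment> \<open>The schema has its designated variables in slots 0 and 1, while merging puts the
    second variable into slot 2 and a parameter into slot 1; these two slots are exchanged.\<close>
  define \<sigma> where "\<sigma> i = (if i = 0 then 0 else if i = 2 then 1 else if i = 1 then 2 else i)" for i :: nat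
  obtain \<phi>' where \<phi>': "\<And>e. sat E e \<phi>' = sat E (\<lambda>i. e (\<sigma> i)) \<phi>" using sat_rename[of E \<sigma> \<phi>] by blast
  define d where "d = (merge c c)(2 := c 0)"
  have "(\<lambda>i. (d(0 := x, 1 := y)) (\<sigma> i)) = merge (c(0 := x, 1 := y)) c" for x y
    by (auto simp: merge_def d_def \<sigma>_def fun_eq_iff elim!: evenE oddE)
  then have *: "sat E (d(0 := x, 1 := y)) \<phi>' = P x y" for x y
    using P[of "c(0 := x, 1 := y)"] by (simp add: \<phi>')
  have "(\<forall>x y z. x \<epsilon> a \<and> sat E (d(0 := x, 1 := y)) \<phi>' \<and> sat E (d(0 := x, 1 := z)) \<phi>' \<longrightarrow> y = z) \<longrightarrow>
        (\<exists>b. \<forall>y. y \<epsilon> b \<longleftrightarrow> (\<exists>x. x \<epsilon> a \<and> sat E (d(0 := x, 1 := y)) \<phi>'))"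
    using ZFC unfolding ZFC_def Replacement_schema_def by blast
  then show ?thesis unfolding * using assms(2) by blast
qed

definition emp :: 'a where "emp = (THE z. \<forall>x. \<not> x \<epsilon> z)"

lemma not_mem_emp [simp]: "\<not> x \<epsilon> emp"
proof -
  obtain z where z: "\<forall>x. \<not> x \<epsilon> z"
    using separation[of "\<lambda>_. False"] by (auto intro: dfn)
  have "emp = z" unfolding emp_def by (rule the_equality) (auto intro: ext simp: z)
  with z show ?thesis by simp
qed

lemma eq_emp_iff: "a = emp \<longleftrightarrow> (\<forall>x. \<not> x \<epsilon> a)"
  using ext[of a emp] by auto

text \<open>Junk values are the empty set, so that the operators below stay definable.\<close>

definition the1 :: "('a \<Rightarrow> bool) \<Rightarrow> 'a" where
  "the1 P = (if \<exists>!y. P y then (THE y. P y) else emp)"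

lemma the1_equality: "P y \<Longrightarrow> (\<And>z. P z \<Longrightarrow> z = y) \<Longrightarrow> the1 P = y"
  unfolding the1_def by (subst if_P, blast, rule the_equality)

lemma dterm_the1 [dfn]:
  assumes "definable (\<lambda>e. P (\<lambda>i. e (Suc i)) (e 0))" shows "dterm (\<lambda>e. the1 (P e))"
proof -
  have *: "x = the1 Q \<longleftrightarrow> (\<exists>!y. Q y) \<and> Q x \<or> \<not> (\<exists>!y. Q y) \<and> x = emp" for x Q
  proof (cases "\<exists>!y. Q y")
    case True
    then obtain y where "Q y" "\<And>z. Q z \<Longrightarrow> z = y" by blast
    with True show ?thesis using the1_equality[of Q y] by blast
  qed (simp add: the1_def)
  have "definable (\<lambda>e. P (\<lambda>i. e (Suc (Suc i))) (e 0))"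
    using definable_rename[OF assms, of "case_nat 0 (\<lambda>i. Suc (Suc i))"] by simp
  then show ?thesis unfolding dterm_def * by (intro dfn assms) auto
qed

lemma dterm_if [dfn]:
  assumes "definable b" "dterm t" "dterm u" shows "dterm (\<lambda>e. if b e then t e else u e)"
proof -
  have *: "(x = (if c then y else z)) = (c \<and> x = y \<or> \<not> c \<and> x = z)" for c and x y z :: 'a by auto
  show ?thesis unfolding dterm_def * 
    by (intro dfn definable_rename[OF assms(1)] definable_dterm_eq assms(2,3))
qed

definition setc :: "('a \<Rightarrow> bool) \<Rightarrow> 'a" where
  "setc P = the1 (\<lambda>b. \<forall>x. x \<epsilon> b \<longleftrightarrow> P x)"

lemma mem_setc: "\<exists>b. \<forall>x. P x \<longrightarrow> x \<epsilon> b \<Longrightarrow> definable (\<lambda>e. P (e 0)) \<Longrightarrow> x \<epsilon> setc P \<longleftrightarrow> P x"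
proof -
  assume "\<exists>b. \<forall>x. P x \<longrightarrow> x \<epsilon> b" and P: "definable (\<lambda>e. P (e 0))"
  then obtain b where "\<forall>x. P x \<longrightarrow> x \<epsilon> b" by blast
  with separation[OF P, of b] obtain c where c: "\<forall>x. x \<epsilon> c \<longleftrightarrow> P x" by blast
  then have "setc P = c" unfolding setc_def by (intro the1_equality) (auto intro: ext)
  with c show ?thesis by simp
qed

lemma dterm_setc [dfn]:
  assumes "definable (\<lambda>e. P (\<lambda>i. e (Suc i)) (e 0))" shows "dterm (\<lambda>e. setc (P e))"
  unfolding setc_def
  using definable_rename[OF assms, of "case_nat 0 (\<lambda>i. Suc (Suc i))"] by (intro dfn) simp

definition sep :: "'a \<Rightarrow> ('a \<Rightarrow> bool) \<Rightarrow> 'a" where "sep a P = setc (\<lambda>x. x \<epsilon> a \<and> P x)"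

lemma mem_sep: "definable (\<lambda>e. P (e 0)) \<Longrightarrow> x \<epsilon> sep a P \<longleftrightarrow> x \<epsilon> a \<and> P x"
  unfolding sep_def by (rule mem_setc) (blast, auto intro!: dfn)

lemma dterm_sep [dfn]:
  assumes "dterm t" "definable (\<lambda>e. P (\<lambda>i. e (Suc i)) (e 0))" shows "dterm (\<lambda>e. sep (t e) (P e))"
  unfolding sep_def by (intro dfn dterm_shift[OF assms(1)] assms(2))

notation emp ("\<emptyset>")

abbreviation sub (infix "\<sqsubseteq>" 50) where "a \<sqsubseteq> b \<equiv> subset_of E a b"

lemma subI: "(\<And>x. x \<epsilon> a \<Longrightarrow> x \<epsilon> b) \<Longrightarrow> a \<sqsubseteq> b"
  unfolding subset_of_def by blast

lemma subD: "a \<sqsubseteq> b \<Longrightarrow> x \<epsilon> a \<Longrightarrow> x \<epsilon> b"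
  unfolding subset_of_def by blast

lemma sub_refl [simp]: "a \<sqsubseteq> a" and sub_trans: "a \<sqsubseteq> b \<Longrightarrow> b \<sqsubseteq> c \<Longrightarrow> a \<sqsubseteq> c"
  unfolding subset_of_def by blast+

lemma sub_antisym: "a \<sqsubseteq> b \<Longrightarrow> b \<sqsubseteq> a \<Longrightarrow> a = b"
  unfolding subset_of_def using ext by blast

lemma definable_sub [dfn]: "dterm t \<Longrightarrow> dterm u \<Longrightarrow> definable (\<lambda>e. t e \<sqsubseteq> u e)"
  by (rule definable_comp2) (unfold subset_of_def, intro dfn)

definition upr :: "'a \<Rightarrow> 'a \<Rightarrow> 'a" where "upr a b = setc (\<lambda>x. x = a \<or> x = b)"

lemma dterm_upr [dfn]: "dterm t \<Longrightarrow> dterm u \<Longrightarrow> dterm (\<lambda>e. upr (t e) (u e))"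
  by (rule dterm_comp2) (unfold upr_def, intro dfn)

lemma mem_upr [simp]: "x \<epsilon> upr a b \<longleftrightarrow> x = a \<or> x = b"
proof -
  have "\<exists>p. is_upair E a b p" using ZFC unfolding ZFC_def Pairing_axiom_def by blast
  then show ?thesis unfolding upr_def by (intro mem_setc) (unfold is_upair_def, blast, intro dfn)
qed

lemma is_upair_iff: "is_upair E a b p \<longleftrightarrow> p = upr a b"
  unfolding is_upair_def by (metis ext mem_upr)

definition opair :: "'a \<Rightarrow> 'a \<Rightarrow> 'a" ("\<langle>_,/ _\<rangle>") where "\<langle>a, b\<rangle> = upr (upr a a) (upr a b)"

lemma dterm_opair [dfn]: "dterm t \<Longrightarrow> dterm u \<Longrightarrow> dterm (\<lambda>e. \<langle>t e, u e\<rangle>)"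
  by (rule dterm_comp2) (unfold opair_def, intro dfn)

lemma is_pair_iff: "is_pair E a b p \<longleftrightarrow> p = \<langle>a, b\<rangle>"
  unfolding is_pair_def is_upair_iff opair_def by blast

lemma upr_eq_iff: "upr a b = upr c d \<longleftrightarrow> a = c \<and> b = d \<or> a = d \<and> b = c"
proof
  assume eq: "upr a b = upr c d"
  have "x = a \<or> x = b \<longleftrightarrow> x = c \<or> x = d" for x
    using mem_upr[of x a b] mem_upr[of x c d] eq by simp
  then show "a = c \<and> b = d \<or> a = d \<and> b = c" by metis
qed (auto intro: ext)

lemma opair_eq_iff [simp]: "\<langle>a, b\<rangle> = \<langle>c, d\<rangle> \<longleftrightarrow> a = c \<and> b = d"
  unfolding opair_def upr_eq_iff by blast

definition uni :: "'a \<Rightarrow> 'a" where "uni a = setc (\<lambda>x. \<exists>y. y \<epsilon> a \<and> x \<epsilon> y)"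

lemma dterm_uni [dfn]: "dterm t \<Longrightarrow> dterm (\<lambda>e. uni (t e))"
  by (rule dterm_comp1) (unfold uni_def, intro dfn)

lemma mem_uni [simp]: "x \<epsilon> uni a \<longleftrightarrow> (\<exists>y. y \<epsilon> a \<and> x \<epsilon> y)"
proof -
  have "\<exists>u. \<forall>x. x \<epsilon> u \<longleftrightarrow> (\<exists>y. y \<epsilon> a \<and> x \<epsilon> y)"
    using ZFC unfolding ZFC_def Union_axiom_def by blast
  then show ?thesis unfolding uni_def by (intro mem_setc) (blast, intro dfn)
qed

definition un :: "'a \<Rightarrow> 'a \<Rightarrow> 'a" (infixl "\<squnion>" 65) where "a \<squnion> b = uni (upr a b)"

lemma dterm_un [dfn]: "dterm t \<Longrightarrow> dterm u \<Longrightarrow> dterm (\<lambda>e. t e \<squnion> u e)"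
  by (rule dterm_comp2) (unfold un_def, intro dfn)

lemma mem_un [simp]: "x \<epsilon> a \<squnion> b \<longleftrightarrow> x \<epsilon> a \<or> x \<epsilon> b"
  unfolding un_def by auto

definition int :: "'a \<Rightarrow> 'a \<Rightarrow> 'a" (infixl "\<sqinter>" 70) where "a \<sqinter> b = sep a (\<lambda>x. x \<epsilon> b)"

lemma dterm_int [dfn]: "dterm t \<Longrightarrow> dterm u \<Longrightarrow> dterm (\<lambda>e. t e \<sqinter> u e)"
  by (rule dterm_comp2) (unfold int_def, intro dfn)

lemma mem_int [simp]: "x \<epsilon> a \<sqinter> b \<longleftrightarrow> x \<epsilon> a \<and> x \<epsilon> b"
  unfolding int_def by (subst mem_sep) (intro dfn, simp)

definition diff :: "'a \<Rightarrow> 'a \<Rightarrow> 'a" (infixl "\<ominus>" 65) where "a \<ominus> b = sep a (\<lambda>x. \<not> x \<epsilon> b)"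

lemma dterm_diff [dfn]: "dterm t \<Longrightarrow> dterm u \<Longrightarrow> dterm (\<lambda>e. t e \<ominus> u e)"
  by (rule dterm_comp2) (unfold diff_def, intro dfn)

lemma mem_diff [simp]: "x \<epsilon> a \<ominus> b \<longleftrightarrow> x \<epsilon> a \<and> \<not> x \<epsilon> b"
  unfolding diff_def by (subst mem_sep) (intro dfn, simp)

definition adj :: "'a \<Rightarrow> 'a \<Rightarrow> 'a" where "adj a x = a \<squnion> upr x x"

lemma dterm_adj [dfn]: "dterm t \<Longrightarrow> dterm u \<Longrightarrow> dterm (\<lambda>e. adj (t e) (u e))"
  by (rule dterm_comp2) (unfold adj_def, intro dfn)

lemma mem_adj [simp]: "y \<epsilon> adj a x \<longleftrightarrow> y \<epsilon> a \<or> y = x"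
  unfolding adj_def by auto

definition pow :: "'a \<Rightarrow> 'a" where "pow a = setc (\<lambda>x. x \<sqsubseteq> a)"

lemma dterm_pow [dfn]: "dterm t \<Longrightarrow> dterm (\<lambda>e. pow (t e))"
  by (rule dterm_comp1) (unfold pow_def, intro dfn)

lemma mem_pow [simp]: "x \<epsilon> pow a \<longleftrightarrow> x \<sqsubseteq> a"
proof -
  have "\<exists>p. is_Pow E a p" using ZFC unfolding ZFC_def Power_Set_axiom_def by blast
  then show ?thesis unfolding pow_def by (intro mem_setc) (unfold is_Pow_def, blast, intro dfn)
qed

lemma is_Pow_iff: "is_Pow E a p \<longleftrightarrow> p = pow a"
  unfolding is_Pow_def by (metis ext mem_pow)

definition repl :: "'a \<Rightarrow> ('a \<Rightarrow> 'a) \<Rightarrow> 'a" where "repl a F = setc (\<lambda>y. \<exists>x. x \<epsilon> a \<and> y = F x)"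

lemma dterm_repl [dfn]:
  assumes "dterm t" "dterm (\<lambda>e. F (\<lambda>i. e (Suc i)) (e 0))" shows "dterm (\<lambda>e. repl (t e) (F e))"
  unfolding repl_def
  using dterm_shift[OF assms(2), of "case_nat 0 (\<lambda>i. Suc (Suc i))"]
  by (intro dfn dterm_shift[OF assms(1)]) simp

lemma mem_repl: "dterm (\<lambda>e. F (e 0)) \<Longrightarrow> y \<epsilon> repl a F \<longleftrightarrow> (\<exists>x. x \<epsilon> a \<and> y = F x)"
proof -
  assume F: "dterm (\<lambda>e. F (e 0))"
  have "\<exists>b. \<forall>y. y \<epsilon> b \<longleftrightarrow> (\<exists>x. x \<epsilon> a \<and> y = F x)"
    by (rule replacement) (auto intro!: dfn dterm_comp1[OF F])
  then show ?thesis unfolding repl_def by (intro mem_setc) (blast, intro dfn dterm_comp1[OF F])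
qed

definition prod :: "'a \<Rightarrow> 'a \<Rightarrow> 'a" (infixr "\<otimes>" 70) where
  "a \<otimes> b = uni (repl a (\<lambda>x. repl b (\<lambda>y. \<langle>x, y\<rangle>)))"

lemma dterm_prod [dfn]: "dterm t \<Longrightarrow> dterm u \<Longrightarrow> dterm (\<lambda>e. t e \<otimes> u e)"
  by (rule dterm_comp2) (unfold prod_def, intro dfn)

lemma mem_prod: "p \<epsilon> a \<otimes> b \<longleftrightarrow> (\<exists>x y. x \<epsilon> a \<and> y \<epsilon> b \<and> p = \<langle>x, y\<rangle>)"
proof -
  have "p \<epsilon> a \<otimes> b \<longleftrightarrow> (\<exists>x. x \<epsilon> a \<and> p \<epsilon> repl b (\<lambda>y. \<langle>x, y\<rangle>))"
    unfolding prod_def by (simp, subst mem_repl) (intro dfn, blast)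
  also have "\<dots> \<longleftrightarrow> (\<exists>x y. x \<epsilon> a \<and> y \<epsilon> b \<and> p = \<langle>x, y\<rangle>)"
    by (subst mem_repl) (intro dfn, blast)
  finally show ?thesis .
qed

lemma opair_mem_prod [simp]: "\<langle>x, y\<rangle> \<epsilon> a \<otimes> b \<longleftrightarrow> x \<epsilon> a \<and> y \<epsilon> b"
  unfolding mem_prod by auto

definition p1 :: "'a \<Rightarrow> 'a" where "p1 p = the1 (\<lambda>x. \<exists>y. p = \<langle>x, y\<rangle>)"
definition p2 :: "'a \<Rightarrow> 'a" where "p2 p = the1 (\<lambda>y. \<exists>x. p = \<langle>x, y\<rangle>)"

lemma dterm_p1 [dfn]: "dterm t \<Longrightarrow> dterm (\<lambda>e. p1 (t e))"
  by (rule dterm_comp1) (unfold p1_def, intro dfn)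

lemma dterm_p2 [dfn]: "dterm t \<Longrightarrow> dterm (\<lambda>e. p2 (t e))"
  by (rule dterm_comp1) (unfold p2_def, intro dfn)

lemma p1_opair [simp]: "p1 \<langle>x, y\<rangle> = x" and p2_opair [simp]: "p2 \<langle>x, y\<rangle> = y"
  unfolding p1_def p2_def by (rule the1_equality; auto)+

subsection \<open>Functions\<close>

text \<open>Outside the domain the value is \<open>\<emptyset>\<close>, which makes application a
  total term; the coding of finite relations by sequences relies on this default.\<close>

definition app :: "'a \<Rightarrow> 'a \<Rightarrow> 'a" (infixl "\<cdot>" 90) where "f \<cdot> x = the1 (\<lambda>y. \<langle>x, y\<rangle> \<epsilon> f)"

lemma dterm_app [dfn]: "dterm t \<Longrightarrow> dterm u \<Longrightarrow> dterm (\<lambda>e. t e \<cdot> u e)"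
  by (rule dterm_comp2) (unfold app_def, intro dfn)

definition func :: "'a \<Rightarrow> 'a \<Rightarrow> bool" where
  "func f a \<longleftrightarrow> (\<forall>p. p \<epsilon> f \<longrightarrow> (\<exists>x y. x \<epsilon> a \<and> p = \<langle>x, y\<rangle>)) \<and> (\<forall>x. x \<epsilon> a \<longrightarrow> (\<exists>!y. \<langle>x, y\<rangle> \<epsilon> f))"

lemma definable_func [dfn]: "dterm t \<Longrightarrow> dterm u \<Longrightarrow> definable (\<lambda>e. func (t e) (u e))"
  by (rule definable_comp2) (unfold func_def, intro dfn)

lemma func_app: "func f a \<Longrightarrow> x \<epsilon> a \<Longrightarrow> \<langle>x, f \<cdot> x\<rangle> \<epsilon> f"
proof -
  assume "func f a" "x \<epsilon> a"
  then obtain y where "\<langle>x, y\<rangle> \<epsilon> f" "\<And>z. \<langle>x, z\<rangle> \<epsilon> f \<Longrightarrow> z = y" unfolding func_def by blast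
  then show ?thesis unfolding app_def by (metis the1_equality)
qed

lemma func_pair_iff: "func f a \<Longrightarrow> \<langle>x, y\<rangle> \<epsilon> f \<longleftrightarrow> x \<epsilon> a \<and> y = f \<cdot> x"
  by (metis func_app func_def opair_eq_iff)

lemma mem_func_iff: "func f a \<Longrightarrow> p \<epsilon> f \<longleftrightarrow> (\<exists>x. x \<epsilon> a \<and> p = \<langle>x, f \<cdot> x\<rangle>)"
  using func_pair_iff[of f a] unfolding func_def by blast

lemma func_eqI:
  assumes "func f a" "func g a" "\<And>x. x \<epsilon> a \<Longrightarrow> f \<cdot> x = g \<cdot> x" shows "f = g"
proof (rule ext)
  fix p show "p \<epsilon> f \<longleftrightarrow> p \<epsilon> g"
    using assms(3) unfolding mem_func_iff[OF assms(1)] mem_func_iff[OF assms(2)] by auto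
qed

lemma func_dom_unique: "func f a \<Longrightarrow> func f b \<Longrightarrow> a = b"
  by (rule ext) (metis func_app func_pair_iff)

definition maps :: "'a \<Rightarrow> 'a \<Rightarrow> 'a \<Rightarrow> bool" where
  "maps f a b \<longleftrightarrow> func f a \<and> (\<forall>x. x \<epsilon> a \<longrightarrow> f \<cdot> x \<epsilon> b)"

lemma definable_maps [dfn]: "dterm t \<Longrightarrow> dterm u \<Longrightarrow> dterm v \<Longrightarrow> definable (\<lambda>e. maps (t e) (u e) (v e))"
  by (rule definable_comp3) (unfold maps_def, intro dfn)

lemma maps_sub_prod: "maps f a b \<Longrightarrow> f \<sqsubseteq> a \<otimes> b"
  by (rule subI) (auto simp: maps_def mem_func_iff)

definition fspace :: "'a \<Rightarrow> 'a \<Rightarrow> 'a" where "fspace a b = sep (pow (a \<otimes> b)) (\<lambda>f. maps f a b)"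

lemma dterm_fspace [dfn]: "dterm t \<Longrightarrow> dterm u \<Longrightarrow> dterm (\<lambda>e. fspace (t e) (u e))"
  by (rule dterm_comp2) (unfold fspace_def, intro dfn)

lemma mem_fspace [simp]: "f \<epsilon> fspace a b \<longleftrightarrow> maps f a b"
  unfolding fspace_def by (subst mem_sep) (intro dfn, auto dest: maps_sub_prod)

definition lam :: "'a \<Rightarrow> ('a \<Rightarrow> 'a) \<Rightarrow> 'a" where "lam a F = repl a (\<lambda>x. \<langle>x, F x\<rangle>)"

lemma dterm_lam [dfn]:
  "dterm t \<Longrightarrow> dterm (\<lambda>e. F (\<lambda>i. e (Suc i)) (e 0)) \<Longrightarrow> dterm (\<lambda>e. lam (t e) (F e))"
  unfolding lam_def by (intro dfn)

lemma mem_lam: "dterm (\<lambda>e. F (e 0)) \<Longrightarrow> p \<epsilon> lam a F \<longleftrightarrow> (\<exists>x. x \<epsilon> a \<and> p = \<langle>x, F x\<rangle>)"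
  unfolding lam_def by (subst mem_repl) (intro dfn, auto)

lemma func_lam: "dterm (\<lambda>e. F (e 0)) \<Longrightarrow> func (lam a F) a"
  unfolding func_def by (auto simp: mem_lam)

lemma app_lam: "dterm (\<lambda>e. F (e 0)) \<Longrightarrow> x \<epsilon> a \<Longrightarrow> lam a F \<cdot> x = F x"
  unfolding app_def by (rule the1_equality) (auto simp: mem_lam)

lemma maps_lam: "dterm (\<lambda>e. F (e 0)) \<Longrightarrow> (\<And>x. x \<epsilon> a \<Longrightarrow> F x \<epsilon> b) \<Longrightarrow> maps (lam a F) a b"
  unfolding maps_def by (auto simp: func_lam app_lam)

definition res :: "'a \<Rightarrow> 'a \<Rightarrow> 'a" (infixl "\<restriction>" 90) where
  "f \<restriction> b = sep f (\<lambda>p. p1 p \<epsilon> b)"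

lemma dterm_res [dfn]: "dterm t \<Longrightarrow> dterm u \<Longrightarrow> dterm (\<lambda>e. t e \<restriction> u e)"
  by (rule dterm_comp2) (unfold res_def, intro dfn)

lemma mem_res: "p \<epsilon> f \<restriction> b \<longleftrightarrow> p \<epsilon> f \<and> p1 p \<epsilon> b"
  unfolding res_def by (rule mem_sep) (intro dfn)

lemma func_res: "func f a \<Longrightarrow> b \<sqsubseteq> a \<Longrightarrow> func (f \<restriction> b) b"
  unfolding func_def mem_res by (metis p1_opair subD)

lemma app_res [simp]: "x \<epsilon> b \<Longrightarrow> (f \<restriction> b) \<cdot> x = f \<cdot> x"
  unfolding app_def mem_res by simp

lemma maps_res: "maps f a c \<Longrightarrow> b \<sqsubseteq> a \<Longrightarrow> maps (f \<restriction> b) b c"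
  unfolding maps_def by (auto intro: func_res dest: subD)

lemma res_res: "c \<sqsubseteq> b \<Longrightarrow> f \<restriction> b \<restriction> c = f \<restriction> c"
  by (rule ext) (auto simp: mem_res dest: subD)

lemma func_adj:
  assumes "func f a" "\<not> i \<epsilon> a" shows "func (adj f \<langle>i, y\<rangle>) (adj a i)"
    and "adj f \<langle>i, y\<rangle> \<cdot> i = y" and "x \<epsilon> a \<Longrightarrow> adj f \<langle>i, y\<rangle> \<cdot> x = f \<cdot> x" and "adj f \<langle>i, y\<rangle> \<restriction> a = f"
proof -
  show "func (adj f \<langle>i, y\<rangle>) (adj a i)" using assms unfolding func_def by auto
  show "adj f \<langle>i, y\<rangle> \<cdot> i = y" unfolding app_def
    by (rule the1_equality) (use assms in \<open>auto simp: func_pair_iff\<close>)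
  show "adj f \<langle>i, y\<rangle> \<cdot> x = f \<cdot> x" if "x \<epsilon> a" unfolding app_def
    by (rule arg_cong[of _ _ the1]) (use assms that in auto)
  show "adj f \<langle>i, y\<rangle> \<restriction> a = f"
    by (rule ext) (use assms in \<open>auto simp: mem_res func_def\<close>)
qed

lemma func_empty [simp]: "func \<emptyset> \<emptyset>"
  unfolding func_def by simp

lemma func_empty_iff: "func f \<emptyset> \<longleftrightarrow> f = \<emptyset>"
  by (metis func_empty func_def eq_emp_iff)

subsection \<open>Choice, foundation and recursion\<close>

lemma foundation: "x \<epsilon> a \<Longrightarrow> \<exists>x. x \<epsilon> a \<and> (\<forall>y. y \<epsilon> x \<longrightarrow> \<not> y \<epsilon> a)"
  using ZFC unfolding ZFC_def Foundation_axiom_def by blast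

lemma choice_function: "\<exists>c. \<forall>x. x \<epsilon> a \<longrightarrow> x \<noteq> \<emptyset> \<longrightarrow> c \<cdot> x \<epsilon> x"
proof -
  \<comment> \<open>The axiom of choice is stated for disjoint families; \<open>G x\<close> is the
    copy of \<open>x\<close> with first coordinate \<open>x\<close>, so different sets get disjoint
    copies.\<close>
  define G where "G x = repl x (\<lambda>y. \<langle>x, y\<rangle>)" for x
  have G: "dterm (\<lambda>e. G (e 0))" unfolding G_def by (intro dfn)
  have mG: "p \<epsilon> G x \<longleftrightarrow> (\<exists>y. y \<epsilon> x \<and> p = \<langle>x, y\<rangle>)" for p x
    unfolding G_def by (rule mem_repl) (intro dfn)
  define b where "b = repl (a \<ominus> upr \<emptyset> \<emptyset>) G"
  have mb: "g \<epsilon> b \<longleftrightarrow> (\<exists>x. x \<epsilon> a \<and> x \<noteq> \<emptyset> \<and> g = G x)" for g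
    unfolding b_def mem_repl[OF G] by auto
  have "(\<forall>x. x \<epsilon> b \<longrightarrow> \<not> is_empty E x) \<and> (\<forall>x y. x \<epsilon> b \<and> y \<epsilon> b \<and> x \<noteq> y \<longrightarrow> \<not> (\<exists>z. z \<epsilon> x \<and> z \<epsilon> y))"
    unfolding is_empty_def mb by (auto simp: mG eq_emp_iff)
  then obtain c where c: "\<forall>g. g \<epsilon> b \<longrightarrow> (\<exists>!z. z \<epsilon> g \<and> z \<epsilon> c)"
    using ZFC unfolding ZFC_def Choice_axiom_def by blast
  define d where "d = lam a (\<lambda>x. the1 (\<lambda>y. y \<epsilon> x \<and> \<langle>x, y\<rangle> \<epsilon> c))"
  have "d \<cdot> x \<epsilon> x" if x: "x \<epsilon> a" "x \<noteq> \<emptyset>" for x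
  proof -
    have "\<exists>!z. z \<epsilon> G x \<and> z \<epsilon> c" using c x mb by blast
    then obtain y where y: "y \<epsilon> x" "\<langle>x, y\<rangle> \<epsilon> c" "\<And>z. z \<epsilon> x \<Longrightarrow> \<langle>x, z\<rangle> \<epsilon> c \<Longrightarrow> z = y"
      unfolding mG by (metis opair_eq_iff)
    have "dterm (\<lambda>e. the1 (\<lambda>y. y \<epsilon> e 0 \<and> \<langle>e 0, y\<rangle> \<epsilon> c))" by (intro dfn)
    from app_lam[OF this x(1)] have "d \<cdot> x = the1 (\<lambda>y. y \<epsilon> x \<and> \<langle>x, y\<rangle> \<epsilon> c)"
      unfolding d_def .
    moreover have "\<dots> = y" by (rule the1_equality) (use y in blast)+
    ultimately have "d \<cdot> x = y" by simp
    with y(1) show ?thesis by simp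

  qed
  then show ?thesis by blast
qed

text \<open>The form in which choice is used below. Bounding the values by a set \<open>b\<close>
  makes all sets of candidates elements of \<open>pow b\<close>, to which one choice function
  applies.\<close>

lemma set_choice:
  assumes Q: "definable (\<lambda>e. Q (e 0) (e 1))" and ex: "\<And>i. i \<epsilon> a \<Longrightarrow> \<exists>y. y \<epsilon> b \<and> Q i y"
  shows "\<exists>h. maps h a b \<and> (\<forall>i. i \<epsilon> a \<longrightarrow> Q i (h \<cdot> i))"
proof -
  obtain c where c: "\<forall>x. x \<epsilon> pow b \<longrightarrow> x \<noteq> \<emptyset> \<longrightarrow> c \<cdot> x \<epsilon> x" using choice_function by blast
  define h where "h = lam a (\<lambda>i. c \<cdot> sep b (Q i))"
  have d: "dterm (\<lambda>e. c \<cdot> sep b (Q (e 0)))"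
    using definable_rename[OF Q, of "case_nat 1 (case_nat 0 id)"] by (intro dfn) simp
  have m: "y \<epsilon> sep b (Q i) \<longleftrightarrow> y \<epsilon> b \<and> Q i y" for i y
    by (rule mem_sep) (intro definable_comp2[OF Q] dfn)
  have h: "h \<cdot> i \<epsilon> b \<and> Q i (h \<cdot> i)" if i: "i \<epsilon> a" for i
  proof -
    have "sep b (Q i) \<noteq> \<emptyset>" using ex[OF i] m eq_emp_iff by blast
    moreover have "sep b (Q i) \<epsilon> pow b" using m by (auto intro: subI)
    ultimately have "c \<cdot> sep b (Q i) \<epsilon> sep b (Q i)" using c by blast
    then show ?thesis unfolding h_def app_lam[OF d i] m .
  qed
  then show ?thesis unfolding maps_def h_def using func_lam[OF d] by blast
qed

text \<open>Minimal elements are required only for sets of the model; accordingly, induction is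
  available for definable predicates.\<close>

definition wf_on :: "'a \<Rightarrow> ('a \<Rightarrow> 'a \<Rightarrow> bool) \<Rightarrow> bool" where
  "wf_on a r \<longleftrightarrow> (\<forall>s. s \<sqsubseteq> a \<longrightarrow> s \<noteq> \<emptyset> \<longrightarrow> (\<exists>m. m \<epsilon> s \<and> (\<forall>y. y \<epsilon> s \<longrightarrow> \<not> r y m)))"

lemma wf_on_induct:
  assumes "wf_on a r" "definable (\<lambda>e. P (e 0))"
    and step: "\<And>x. x \<epsilon> a \<Longrightarrow> (\<And>y. y \<epsilon> a \<Longrightarrow> r y x \<Longrightarrow> P y) \<Longrightarrow> P x"
    and "x \<epsilon> a"
  shows "P x"
proof (rule ccontr)
  assume "\<not> P x"
  have m: "x \<epsilon> sep a (\<lambda>x. \<not> P x) \<longleftrightarrow> x \<epsilon> a \<and> \<not> P x" for x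
    by (rule mem_sep) (intro dfn assms)
  have "sep a (\<lambda>x. \<not> P x) \<noteq> \<emptyset>" using \<open>\<not> P x\<close> \<open>x \<epsilon> a\<close> m eq_emp_iff by blast
  moreover have "sep a (\<lambda>x. \<not> P x) \<sqsubseteq> a" using m by (auto intro: subI)
  ultimately obtain z where "z \<epsilon> a" "\<not> P z" "\<And>y. y \<epsilon> a \<Longrightarrow> \<not> P y \<Longrightarrow> \<not> r y z"
    using assms(1) m unfolding wf_on_def by metis
  then show False using step by blast
qed

lemma wf_on_mem: "wf_on a (\<epsilon>)"
  unfolding wf_on_def using foundation eq_emp_iff by metis

text \<open>The solution is the union of all attempts, that is, of solutions on downward closed
  subsets of \<open>a\<close>; two attempts agree on common arguments by induction. Closed domains
  compensate for the fact that \<open>r\<close> may fail to be transitive.\<close>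

lemma wf_recursion:
  assumes wf: "wf_on a r" and r: "definable (\<lambda>e. r (e 0) (e 1))" and G: "dterm (\<lambda>e. G (e 0) (e 1))"
  shows "\<exists>f. func f a \<and> (\<forall>x. x \<epsilon> a \<longrightarrow> f \<cdot> x = G x (f \<restriction> sep a (\<lambda>y. r y x)))"
proof -
  note [dfn] = definable_comp2[OF r] dterm_comp2[OF G]
  let ?p = "\<lambda>x. sep a (\<lambda>y. r y x)"
  have mp: "y \<epsilon> ?p x \<longleftrightarrow> y \<epsilon> a \<and> r y x" for x y by (rule mem_sep) (intro dfn)
  define att where "att h d \<longleftrightarrow> d \<sqsubseteq> a \<and> (\<forall>x y. x \<epsilon> d \<and> y \<epsilon> a \<and> r y x \<longrightarrow> y \<epsilon> d) \<and> func h d \<and>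
    (\<forall>x. x \<epsilon> d \<longrightarrow> h \<cdot> x = G x (h \<restriction> ?p x))" for h d
  have att_dfn: "definable (\<lambda>e. att (e 0) (e 1))" unfolding att_def by (intro dfn)
  note [dfn] = definable_comp2[OF att_dfn]
  have p_sub: "?p x \<sqsubseteq> d" if "att h d" "x \<epsilon> d" for h d x
    using that unfolding att_def by (auto intro!: subI simp: mp)
  have res_eq: "h \<restriction> ?p x = h' \<restriction> ?p x"
    if "func h d" "func h' d'" "?p x \<sqsubseteq> d" "?p x \<sqsubseteq> d'" "\<And>y. y \<epsilon> ?p x \<Longrightarrow> h \<cdot> y = h' \<cdot> y" for h h' d d' x
    by (rule func_eqI[of _ "?p x"]) (use that in \<open>auto intro: func_res\<close>)
  have agree: "h \<cdot> x = h' \<cdot> x" if h: "att h d" "att h' d'" and x: "x \<epsilon> d" "x \<epsilon> d'" for h h' d d' x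
  proof -
    have "x \<epsilon> d \<longrightarrow> x \<epsilon> d' \<longrightarrow> h \<cdot> x = h' \<cdot> x"
    proof (rule wf_on_induct[OF wf, where x = x])
      show "x \<epsilon> a" using h x unfolding att_def by (auto dest: subD)
    next
      fix x assume "x \<epsilon> a" and IH: "\<And>y. y \<epsilon> a \<Longrightarrow> r y x \<Longrightarrow> y \<epsilon> d \<longrightarrow> y \<epsilon> d' \<longrightarrow> h \<cdot> y = h' \<cdot> y"
      show "x \<epsilon> d \<longrightarrow> x \<epsilon> d' \<longrightarrow> h \<cdot> x = h' \<cdot> x"
      proof (intro impI)
        assume x: "x \<epsilon> d" "x \<epsilon> d'"
        have "h \<restriction> ?p x = h' \<restriction> ?p x"
          by (rule res_eq[of h d h' d']) (use h x IH p_sub in \<open>auto simp: att_def mp\<close>)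
        then show "h \<cdot> x = h' \<cdot> x" using h x unfolding att_def by simp
      qed
    qed (intro dfn)
    then show ?thesis using x by blast
  qed
  define F where "F x = the1 (\<lambda>y. \<exists>h d. att h d \<and> x \<epsilon> d \<and> y = h \<cdot> x)" for x
  have F: "F x = h \<cdot> x" if "att h d" "x \<epsilon> d" for h d x
    unfolding F_def by (rule the1_equality) (use that agree in blast)+
  have dF: "dterm (\<lambda>e. F (e 0))" unfolding F_def by (intro dfn)
  define D where "D = sep a (\<lambda>x. \<exists>h d. att h d \<and> x \<epsilon> d)"
  have mD: "x \<epsilon> D \<longleftrightarrow> (\<exists>h d. att h d \<and> x \<epsilon> d)" for x
    unfolding D_def by (subst mem_sep) (intro dfn, auto simp: att_def dest: subD)
  define f where "f = lam D F"
  have f: "func f D" "\<And>x. x \<epsilon> D \<Longrightarrow> f \<cdot> x = F x" unfolding f_def using func_lam[OF dF] app_lam[OF dF] by auto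
  have attf: "att f D" unfolding att_def
  proof (intro conjI allI impI f)
    show "D \<sqsubseteq> a" unfolding D_def by (rule subI) (subst (asm) mem_sep; (intro dfn)?; blast)
    show "y \<epsilon> D" if "x \<epsilon> D \<and> y \<epsilon> a \<and> r y x" for x y
      using that unfolding mD att_def by blast
    fix x assume "x \<epsilon> D"
    then obtain h d where h: "att h d" "x \<epsilon> d" unfolding mD by blast
    have "h \<restriction> ?p x = f \<restriction> ?p x"
    proof (rule res_eq)
      show "func h d" using h by (simp add: att_def)
      show "?p x \<sqsubseteq> d" using p_sub h by blast
      then show "?p x \<sqsubseteq> D" using h mD by (auto intro!: subI dest: subD)
      show "h \<cdot> y = f \<cdot> y" if "y \<epsilon> ?p x" for y
        using F h \<open>?p x \<sqsubseteq> d\<close> \<open>?p x \<sqsubseteq> D\<close> that f(2) subD by metis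
    qed (rule f)
    then show "f \<cdot> x = G x (f \<restriction> ?p x)" using h F f(2)[OF \<open>x \<epsilon> D\<close>] unfolding att_def by simp
  qed
  have "x \<epsilon> D" if "x \<epsilon> a" for x
  proof (rule wf_on_induct[OF wf, where x = x, OF _ _ that])
    fix x assume x: "x \<epsilon> a" and IH: "\<And>y. y \<epsilon> a \<Longrightarrow> r y x \<Longrightarrow> y \<epsilon> D"
    show "x \<epsilon> D"
    proof (rule ccontr)
      assume nD: "\<not> x \<epsilon> D"
      \<comment> \<open>All predecessors of \<open>x\<close> lie in \<open>D\<close>, so the union
        of the attempts could be prolonged by the value that \<open>G\<close> prescribes at
        \<open>x\<close>.\<close>
      let ?h = "adj f \<langle>x, G x (f \<restriction> ?p x)\<rangle>"
      note fa = func_adj[OF f(1) nD]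
      have sD: "?p y \<sqsubseteq> D" if "y \<epsilon> adj D x" for y
        using that p_sub[OF attf] IH mp by (auto intro!: subI dest: subD)
      have "?h \<restriction> ?p y = f \<restriction> ?p y" if "y \<epsilon> adj D x" for y
      proof (rule res_eq[OF fa(1) f(1)])
        show "?p y \<sqsubseteq> D" by (rule sD[OF that])
        then show "?p y \<sqsubseteq> adj D x" by (auto intro!: subI dest: subD)
        show "?h \<cdot> z = f \<cdot> z" if "z \<epsilon> ?p y" for z
          by (rule fa(3)) (use \<open>?p y \<sqsubseteq> D\<close> that in \<open>auto dest: subD\<close>)
      qed
      then have "att ?h (adj D x)"
        unfolding att_def using attf x fa IH unfolding att_def
        by (auto intro!: subI dest: subD)
      then show False using nD unfolding mD by (meson mem_adj)
    qed
  qed (intro dfn)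
  then have "D = a" using attf unfolding att_def by (metis ext subD)
  then show ?thesis using attf unfolding att_def by blast
qed

text \<open>Recursion with a choice at each step. Earlier values are known to be correct only for
  those \<open>y\<close> whose predecessors are all predecessors of \<open>x\<close>:
  \<open>r\<close> may fail to be transitive, and \<open>h\<close> knows nothing outside its
  domain.\<close>

lemma wf_choice:
  assumes wf: "wf_on a r" and r: "definable (\<lambda>e. r (e 0) (e 1))" and Q: "definable (\<lambda>e. Q (e 0) (e 1) (e 2))"
    and ex: "\<And>x h. x \<epsilon> a \<Longrightarrow> maps h (sep a (\<lambda>y. r y x)) b \<Longrightarrow>
      (\<And>y. y \<epsilon> a \<Longrightarrow> r y x \<Longrightarrow> sep a (\<lambda>z. r z y) \<sqsubseteq> sep a (\<lambda>z. r z x) \<Longrightarrow> Q y (h \<restriction> sep a (\<lambda>z. r z y)) (h \<cdot> y)) \<Longrightarrow>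
      \<exists>v. v \<epsilon> b \<and> Q x h v"
  shows "\<exists>f. maps f a b \<and> (\<forall>x. x \<epsilon> a \<longrightarrow> Q x (f \<restriction> sep a (\<lambda>y. r y x)) (f \<cdot> x))"
proof -
  note [dfn] = definable_comp2[OF r] definable_comp3[OF Q]
  let ?p = "\<lambda>x. sep a (\<lambda>y. r y x)"
  have mp: "y \<epsilon> ?p x \<longleftrightarrow> y \<epsilon> a \<and> r y x" for x y by (rule mem_sep) (intro dfn)
  obtain c where c: "\<forall>x. x \<epsilon> pow b \<longrightarrow> x \<noteq> \<emptyset> \<longrightarrow> c \<cdot> x \<epsilon> x" using choice_function by blast
  have m: "v \<epsilon> sep b (Q x h) \<longleftrightarrow> v \<epsilon> b \<and> Q x h v" for x h v
    by (rule mem_sep) (intro dfn)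
  define G where "G x h = c \<cdot> sep b (Q x h)" for x h
  have "dterm (\<lambda>e. G (e 0) (e 1))" unfolding G_def by (intro dfn)
  from wf_recursion[OF wf r this] obtain f
    where f: "func f a" "\<And>x. x \<epsilon> a \<Longrightarrow> f \<cdot> x = G x (f \<restriction> ?p x)" by blast
  have G: "G x h \<epsilon> b \<and> Q x h (G x h)" if "\<exists>v. v \<epsilon> b \<and> Q x h v" for x h
  proof -
    have "sep b (Q x h) \<epsilon> pow b" "sep b (Q x h) \<noteq> \<emptyset>"
      using that m eq_emp_iff by (auto intro!: subI)
    then have "c \<cdot> sep b (Q x h) \<epsilon> sep b (Q x h)" using c by blast
    then show ?thesis unfolding m G_def .
  qed
  have main: "f \<cdot> x \<epsilon> b \<and> Q x (f \<restriction> ?p x) (f \<cdot> x)" if "x \<epsilon> a" for x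
  proof (rule wf_on_induct[OF wf, where x = x, OF _ _ that])
    fix x assume x: "x \<epsilon> a" and IH: "\<And>y. y \<epsilon> a \<Longrightarrow> r y x \<Longrightarrow> f \<cdot> y \<epsilon> b \<and> Q y (f \<restriction> ?p y) (f \<cdot> y)"
    have "?p x \<sqsubseteq> a" using mp by (auto intro: subI)
    have "\<exists>v. v \<epsilon> b \<and> Q x (f \<restriction> ?p x) v"
    proof (rule ex[OF x])
      show "maps (f \<restriction> ?p x) (?p x) b"
        unfolding maps_def using func_res[OF f(1) \<open>?p x \<sqsubseteq> a\<close>] IH mp by auto
      show "Q y (f \<restriction> ?p x \<restriction> ?p y) (f \<restriction> ?p x \<cdot> y)"
        if "y \<epsilon> a" "r y x" "?p y \<sqsubseteq> ?p x" for y
        using IH[OF that(1,2)] that by (simp add: res_res mp)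
    qed
    from G[OF this] show "f \<cdot> x \<epsilon> b \<and> Q x (f \<restriction> ?p x) (f \<cdot> x)" using f(2)[OF x] by simp
  qed (intro dfn)
  then show ?thesis using f(1) unfolding maps_def by blast
qed

subsection \<open>Ordinals\<close>

lemma definable_transitive_set [dfn]: "dterm t \<Longrightarrow> definable (\<lambda>e. transitive_set E (t e))"
  by (rule definable_comp1) (unfold transitive_set_def, intro dfn)

lemma definable_is_ordinal [dfn]: "dterm t \<Longrightarrow> definable (\<lambda>e. is_ordinal E (t e))"
  by (rule definable_comp1) (unfold is_ordinal_def, intro dfn)

lemma mem_irrefl [simp]: "\<not> x \<epsilon> x"
  using foundation[of x "upr x x"] by auto

lemma mem_asym: "x \<epsilon> y \<Longrightarrow> \<not> y \<epsilon> x"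
  using foundation[of x "upr x y"] by auto

lemma ord_mem_trans: "is_ordinal E a \<Longrightarrow> x \<epsilon> y \<Longrightarrow> y \<epsilon> a \<Longrightarrow> x \<epsilon> a"
  unfolding is_ordinal_def transitive_set_def by (blast dest: subD)

lemma ord_mem_ord: "is_ordinal E a \<Longrightarrow> x \<epsilon> a \<Longrightarrow> is_ordinal E x"
  unfolding is_ordinal_def transitive_set_def by (blast dest: subD)

lemma ord_mem_sub: "is_ordinal E a \<Longrightarrow> x \<epsilon> a \<Longrightarrow> x \<sqsubseteq> a"
  unfolding is_ordinal_def transitive_set_def by blast

definition suc :: "'a \<Rightarrow> 'a" where "suc a = adj a a"

lemma dterm_suc [dfn]: "dterm t \<Longrightarrow> dterm (\<lambda>e. suc (t e))"
  unfolding suc_def by (intro dfn)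

lemma mem_suc [simp]: "x \<epsilon> suc a \<longleftrightarrow> x \<epsilon> a \<or> x = a"
  unfolding suc_def by simp

lemma suc_inject [simp]: "suc a = suc b \<longleftrightarrow> a = b"
  by (metis mem_asym mem_suc)

lemma suc_ne_emp [simp]: "suc a \<noteq> \<emptyset>" "\<emptyset> \<noteq> suc a"
  by (metis mem_suc not_mem_emp)+

lemma ord_suc: "is_ordinal E a \<Longrightarrow> is_ordinal E (suc a)"
proof -
  assume a: "is_ordinal E a"
  have "x \<sqsubseteq> suc a \<and> transitive_set E x" if "x \<epsilon> suc a" for x
    using that ord_mem_trans[OF a] ord_mem_ord[OF a] a unfolding is_ordinal_def by (auto intro!: subI)
  then show ?thesis unfolding is_ordinal_def transitive_set_def[of E "suc a"] by blast
qed

lemma ord_least: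
  assumes "definable (\<lambda>e. P (e 0))" "is_ordinal E a" "P a"
  shows "\<exists>b. is_ordinal E b \<and> P b \<and> (\<forall>c. c \<epsilon> b \<longrightarrow> \<not> P c)"
proof -
  have m: "x \<epsilon> sep (suc a) P \<longleftrightarrow> x \<epsilon> suc a \<and> P x" for x by (rule mem_sep[OF assms(1)])
  have "a \<epsilon> sep (suc a) P" unfolding m using assms by simp
  from foundation[OF this] obtain b where b: "b \<epsilon> suc a" "P b" "\<forall>c. c \<epsilon> b \<longrightarrow> \<not> (c \<epsilon> suc a \<and> P c)"
    unfolding m by blast
  then show ?thesis using ord_mem_trans[OF ord_suc[OF assms(2)]] ord_mem_ord[OF ord_suc[OF assms(2)]] by blast
qed

lemma ord_linear:
  assumes "is_ordinal E a" "is_ordinal E b" shows "a \<epsilon> b \<or> a = b \<or> b \<epsilon> a"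
proof (rule ccontr)
  assume "\<not> ?thesis"
  \<comment> \<open>A counterexample minimal in both coordinates, first in \<open>a\<close> and then
    in \<open>b\<close> for this \<open>a\<close>, consists of two sets included in each
    other.\<close>
  define N where "N a b \<longleftrightarrow> is_ordinal E b \<and> \<not> (a \<epsilon> b \<or> a = b \<or> b \<epsilon> a)" for a b
  have "definable (\<lambda>e. \<exists>b. N (e 0) b)" unfolding N_def by (intro dfn)
  from ord_least[where P = "\<lambda>a. \<exists>b. N a b", OF this assms(1)] \<open>\<not> ?thesis\<close> assms(2)
  obtain a where a: "is_ordinal E a" "\<exists>b. N a b" "\<And>c b. c \<epsilon> a \<Longrightarrow> \<not> N c b" by (metis N_def)
  then obtain b where "N a b" by blast
  have "definable (\<lambda>e. N a (e 0))" unfolding N_def by (intro dfn)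
  from ord_least[where P = "N a", OF this _ \<open>N a b\<close>] \<open>N a b\<close>
  obtain b where b: "is_ordinal E b" "N a b" "\<And>c. c \<epsilon> b \<Longrightarrow> \<not> N a c" by (metis N_def)
  have "x \<epsilon> b" if "x \<epsilon> a" for x using a(3)[OF that, of b] b(1,2) that ord_mem_trans[OF a(1)] unfolding N_def by blast
  moreover have "x \<epsilon> a" if "x \<epsilon> b" for x using b(3)[OF that] ord_mem_ord[OF b(1) that] b(2) that ord_mem_trans[OF b(1)]
    unfolding N_def by blast
  ultimately have "a = b" by (blast intro: ext)
  then show False using b(2) unfolding N_def by blast
qed

lemma ord_sub_iff: "is_ordinal E a \<Longrightarrow> is_ordinal E b \<Longrightarrow> a \<sqsubseteq> b \<longleftrightarrow> a \<epsilon> b \<or> a = b"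
  using ord_linear[of a b] ord_mem_sub[of b a] subD[of a b b] by auto

lemma ord_un: "is_ordinal E a \<Longrightarrow> is_ordinal E b \<Longrightarrow> a \<squnion> b = a \<or> a \<squnion> b = b"
proof -
  assume ab: "is_ordinal E a" "is_ordinal E b"
  consider "a \<sqsubseteq> b" | "b \<sqsubseteq> a" using ord_linear[OF ab] ord_mem_sub ab sub_refl by metis
  then show ?thesis by cases (auto intro!: ext dest: subD)
qed

lemma ord_uni: "(\<And>x. x \<epsilon> a \<Longrightarrow> is_ordinal E x) \<Longrightarrow> is_ordinal E (uni a)"
proof -
  assume a: "\<And>x. x \<epsilon> a \<Longrightarrow> is_ordinal E x"
  have "y \<sqsubseteq> uni a \<and> transitive_set E y" if "y \<epsilon> uni a" for y
  proof -
    obtain x where x: "x \<epsilon> a" "y \<epsilon> x" using \<open>y \<epsilon> uni a\<close> by auto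
    have "is_ordinal E y" using ord_mem_ord[OF a[OF x(1)] x(2)] .
    moreover have "y \<sqsubseteq> uni a" using ord_mem_trans[OF a[OF x(1)] _ x(2)] x(1) unfolding subset_of_def mem_uni by blast
    ultimately show ?thesis unfolding is_ordinal_def by simp
  qed
  then show ?thesis unfolding is_ordinal_def transitive_set_def[of E "uni a"] by blast
qed

subsection \<open>The natural numbers\<close>

lemma is_inductive_iff: "is_inductive E v \<longleftrightarrow> \<emptyset> \<epsilon> v \<and> (\<forall>x. x \<epsilon> v \<longrightarrow> suc x \<epsilon> v)"
proof -
  have "is_empty E z \<longleftrightarrow> z = \<emptyset>" for z unfolding is_empty_def eq_emp_iff by simp
  moreover have "is_succ E x s \<longleftrightarrow> s = suc x" for x s
    unfolding is_succ_def by (metis ext mem_suc)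
  ultimately show ?thesis unfolding is_inductive_def by simp
qed

definition om :: 'a where "om = setc (\<lambda>x. \<forall>v. is_inductive E v \<longrightarrow> x \<epsilon> v)"

lemma mem_om: "x \<epsilon> om \<longleftrightarrow> (\<forall>v. is_inductive E v \<longrightarrow> x \<epsilon> v)"
proof -
  obtain w where "is_inductive E w" using ZFC unfolding ZFC_def Infinity_axiom_def by blast
  then show ?thesis unfolding om_def
    by (intro mem_setc) (blast, unfold is_inductive_iff, intro dfn)
qed

lemma zero_om [simp]: "\<emptyset> \<epsilon> om" and suc_om [simp]: "n \<epsilon> om \<Longrightarrow> suc n \<epsilon> om"
  unfolding mem_om is_inductive_iff by blast+

lemma is_omega_iff: "is_omega E w \<longleftrightarrow> w = om"
proof -
  have om: "is_omega E om"
    unfolding is_omega_def by (auto simp: is_inductive_iff[of om] intro!: subI) (simp add: mem_om)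
  then show ?thesis by (metis is_omega_def sub_antisym)
qed

lemma om_induct [consumes 2, case_names zero suc]:
  assumes "definable (\<lambda>e. P (e 0))" "n \<epsilon> om"
    and "P \<emptyset>" "\<And>n. n \<epsilon> om \<Longrightarrow> P n \<Longrightarrow> P (suc n)"
  shows "P n"
proof -
  have m: "x \<epsilon> sep om P \<longleftrightarrow> x \<epsilon> om \<and> P x" for x by (rule mem_sep[OF assms(1)])
  have "is_inductive E (sep om P)" unfolding is_inductive_iff m using assms by auto
  then have "n \<epsilon> sep om P" using assms(2) mem_om by blast
  then show ?thesis unfolding m by blast
qed

lemma om_ord: "n \<epsilon> om \<Longrightarrow> is_ordinal E n"
  by (rule om_induct) (intro dfn, assumption, simp add: is_ordinal_def transitive_set_def, rule ord_suc)

lemma om_sub: "n \<epsilon> om \<Longrightarrow> n \<sqsubseteq> om"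
  by (rule om_induct) (intro dfn, auto intro!: subI dest: subD)

lemma om_mem: "n \<epsilon> om \<Longrightarrow> m \<epsilon> n \<Longrightarrow> m \<epsilon> om"
  using om_sub subD by blast

lemma om_cases: "n \<epsilon> om \<Longrightarrow> n = \<emptyset> \<or> (\<exists>m. m \<epsilon> om \<and> n = suc m)"
  by (rule om_induct) (intro dfn, auto)

lemma ord_om: "is_ordinal E om"
  unfolding is_ordinal_def transitive_set_def using om_sub om_ord
  by (simp add: is_ordinal_def transitive_set_def)

lemma om_linear: "m \<epsilon> om \<Longrightarrow> n \<epsilon> om \<Longrightarrow> m \<epsilon> n \<or> m = n \<or> n \<epsilon> m"
  by (simp add: om_ord ord_linear)

lemma om_trans: "x \<epsilon> y \<Longrightarrow> y \<epsilon> n \<Longrightarrow> n \<epsilon> om \<Longrightarrow> x \<epsilon> n"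
  using om_ord ord_mem_trans by blast

lemma om_zero_sub: "n \<epsilon> om \<Longrightarrow> n = \<emptyset> \<or> \<emptyset> \<epsilon> n"
  using om_linear[of \<emptyset> n] by auto

lemma om_suc_mem_iff: "n \<epsilon> om \<Longrightarrow> m \<epsilon> n \<Longrightarrow> suc m \<epsilon> suc n"
proof -
  assume n: "n \<epsilon> om" and m: "m \<epsilon> n"
  have "suc m \<epsilon> suc n \<or> suc m = suc n \<or> suc n \<epsilon> suc m"
    using om_linear[of "suc m" "suc n"] n om_mem[OF n m] by simp
  then show ?thesis using m mem_asym om_trans[OF _ m n] by (metis mem_irrefl mem_suc suc_inject)
qed

lemma om_un: "m \<epsilon> om \<Longrightarrow> n \<epsilon> om \<Longrightarrow> m \<squnion> n \<epsilon> om"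
  using ord_un[of m n] om_ord by metis

lemma sub_un1: "a \<sqsubseteq> a \<squnion> b" and sub_un2: "b \<sqsubseteq> a \<squnion> b"
  by (auto intro: subI)

lemma sep_mem_om: "n \<epsilon> om \<Longrightarrow> sep om (\<lambda>y. y \<epsilon> n) = n"
  by (rule ext, subst mem_sep) (intro dfn, auto intro: om_mem)

lemma om_strong_induct:
  assumes "definable (\<lambda>e. P (e 0))" "n \<epsilon> om" "\<And>n. n \<epsilon> om \<Longrightarrow> (\<And>m. m \<epsilon> n \<Longrightarrow> P m) \<Longrightarrow> P n"
  shows "P n"
  by (rule wf_on_induct[OF wf_on_mem assms(1) _ assms(2)]) (use assms(3) om_mem in blast)

lemma om_rec:
  assumes H: "dterm (\<lambda>e. H (e 0) (e 1))"
  shows "\<exists>f. func f om \<and> f \<cdot> \<emptyset> = a \<and> (\<forall>n. n \<epsilon> om \<longrightarrow> f \<cdot> suc n = H n (f \<cdot> n))"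
proof -
  define G where "G n h = (if n = \<emptyset> then a else H (uni n) (h \<cdot> uni n))" for n h
  have d: "definable (\<lambda>e. e 0 \<epsilon> e 1)" by (intro dfn)
  have "dterm (\<lambda>e. G (e 0) (e 1))" unfolding G_def by (intro dfn dterm_comp2[OF H])
  from wf_recursion[OF wf_on_mem[of om] d this]
  obtain f where f: "func f om" "\<And>n. n \<epsilon> om \<Longrightarrow> f \<cdot> n = G n (f \<restriction> sep om (\<lambda>y. y \<epsilon> n))" by blast
  have "f \<cdot> \<emptyset> = a" using f(2)[of \<emptyset>] by (simp add: G_def)
  moreover have "f \<cdot> suc n = H n (f \<cdot> n)" if n: "n \<epsilon> om" for n
  proof -
    have "uni (suc n) = n" by (rule ext) (use om_trans n in auto)
    then show ?thesis using f(2)[of "suc n", unfolded sep_mem_om[OF suc_om[OF n]]] n by (simp add: G_def)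
  qed
  ultimately show ?thesis using f(1) by blast
qed

text \<open>Dependent choice: successors are chosen once for all pairs of a stage and a state, and
  the resulting function is iterated.\<close>

lemma om_choice:
  assumes Q: "definable (\<lambda>e. Q (e 0) (e 1) (e 2))" and v: "v \<epsilon> b"
    and ex: "\<And>n v. n \<epsilon> om \<Longrightarrow> v \<epsilon> b \<Longrightarrow> \<exists>w. w \<epsilon> b \<and> Q n v w"
  shows "\<exists>f. maps f om b \<and> f \<cdot> \<emptyset> = v \<and> (\<forall>n. n \<epsilon> om \<longrightarrow> Q n (f \<cdot> n) (f \<cdot> suc n))"
proof -
  have "definable (\<lambda>e. Q (p1 (e 0)) (p2 (e 0)) (e 1))" by (intro definable_comp3[OF Q] dfn)
  from set_choice[where a = "om \<otimes> b" and Q = "\<lambda>p. Q (p1 p) (p2 p)" and b = b, OF this]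
  obtain h where h: "maps h (om \<otimes> b) b" "\<forall>p. p \<epsilon> om \<otimes> b \<longrightarrow> Q (p1 p) (p2 p) (h \<cdot> p)"
    using ex by (metis mem_prod p1_opair p2_opair)
  have "dterm (\<lambda>e. h \<cdot> \<langle>e 0, e 1\<rangle>)" by (intro dfn)
  from om_rec[where H = "\<lambda>n v. h \<cdot> \<langle>n, v\<rangle>", OF this, of v] obtain f
    where f: "func f om" "f \<cdot> \<emptyset> = v" "\<And>n. n \<epsilon> om \<Longrightarrow> f \<cdot> suc n = h \<cdot> \<langle>n, f \<cdot> n\<rangle>" by blast
  have fb: "f \<cdot> n \<epsilon> b" if "n \<epsilon> om" for n
  proof (rule om_induct[OF _ that])
    show "definable (\<lambda>e. f \<cdot> e 0 \<epsilon> b)" by (intro dfn)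
    show "f \<cdot> suc n \<epsilon> b" if "n \<epsilon> om" "f \<cdot> n \<epsilon> b" for n
      using f(3)[OF that(1)] h(1) that unfolding maps_def by simp
  qed (use f v in simp)
  have "Q n (f \<cdot> n) (f \<cdot> suc n)" if "n \<epsilon> om" for n
    using h(2) f(3)[OF that] fb[OF that] that by (metis opair_mem_prod p1_opair p2_opair)
  then show ?thesis using f fb unfolding maps_def by blast
qed

subsection \<open>A pairing bijection\<close>

text \<open>\<open>pr m n = 2\<^sup>m (2 n + 1) - 1\<close>.\<close>

definition dblf :: 'a where
  "dblf = (SOME f. func f om \<and> f \<cdot> \<emptyset> = \<emptyset> \<and> (\<forall>n. n \<epsilon> om \<longrightarrow> f \<cdot> suc n = suc (suc (f \<cdot> n))))"

text \<open>Recursion on the first argument with whole functions as values. As fixed elements of the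
  model, \<open>dblf\<close> and \<open>pairf\<close> enter formulas as parameters.\<close>

definition pairf :: 'a where
  "pairf = (SOME f. func f om \<and> f \<cdot> \<emptyset> = dblf \<and>
     (\<forall>n. n \<epsilon> om \<longrightarrow> f \<cdot> suc n = lam om (\<lambda>k. suc (dblf \<cdot> (f \<cdot> n \<cdot> k)))))"

abbreviation dbl :: "'a \<Rightarrow> 'a" where "dbl n \<equiv> dblf \<cdot> n"

definition pr :: "'a \<Rightarrow> 'a \<Rightarrow> 'a" where "pr m n = pairf \<cdot> m \<cdot> n"

lemma dterm_pr [dfn]: "dterm t \<Longrightarrow> dterm u \<Longrightarrow> dterm (\<lambda>e. pr (t e) (u e))"
  unfolding pr_def by (intro dfn)

lemma dbl_zero [simp]: "dbl \<emptyset> = \<emptyset>" and dbl_suc [simp]: "n \<epsilon> om \<Longrightarrow> dbl (suc n) = suc (suc (dbl n))"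
proof -
  have "\<exists>f. func f om \<and> f \<cdot> \<emptyset> = \<emptyset> \<and> (\<forall>n. n \<epsilon> om \<longrightarrow> f \<cdot> suc n = suc (suc (f \<cdot> n)))"
    by (rule om_rec) (intro dfn)
  from someI_ex[OF this] show "dbl \<emptyset> = \<emptyset>" "n \<epsilon> om \<Longrightarrow> dbl (suc n) = suc (suc (dbl n))"
    unfolding dblf_def[symmetric] by blast+
qed

lemma pr_zero [simp]: "pr \<emptyset> n = dbl n"
  and pr_suc [simp]: "m \<epsilon> om \<Longrightarrow> n \<epsilon> om \<Longrightarrow> pr (suc m) n = suc (dbl (pr m n))"
proof -
  have "\<exists>f. func f om \<and> f \<cdot> \<emptyset> = dblf \<and>
    (\<forall>n. n \<epsilon> om \<longrightarrow> f \<cdot> suc n = lam om (\<lambda>k. suc (dblf \<cdot> (f \<cdot> n \<cdot> k))))"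
    by (rule om_rec) (intro dfn)
  from someI_ex[OF this] have *: "pairf \<cdot> \<emptyset> = dblf"
    "m \<epsilon> om \<Longrightarrow> pairf \<cdot> suc m = lam om (\<lambda>k. suc (dblf \<cdot> (pairf \<cdot> m \<cdot> k)))"
    unfolding pairf_def[symmetric] by blast+
  then show "pr \<emptyset> n = dbl n" unfolding pr_def by simp
  have d: "dterm (\<lambda>e. suc (dblf \<cdot> (pairf \<cdot> m \<cdot> e 0)))" by (intro dfn)
  show "m \<epsilon> om \<Longrightarrow> n \<epsilon> om \<Longrightarrow> pr (suc m) n = suc (dbl (pr m n))"
    unfolding pr_def using *(2) app_lam[OF d] by simp
qed

lemma dbl_om [simp]: "n \<epsilon> om \<Longrightarrow> dbl n \<epsilon> om"
  by (rule om_induct) (intro dfn, auto)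

lemma pr_om [simp]: "m \<epsilon> om \<Longrightarrow> n \<epsilon> om \<Longrightarrow> pr m n \<epsilon> om"
  by (rule om_induct[where n = m]) (intro dfn, auto)

lemma dbl_inject: "m \<epsilon> om \<Longrightarrow> n \<epsilon> om \<Longrightarrow> dbl m = dbl n \<longleftrightarrow> m = n"
proof -
  assume m: "m \<epsilon> om" "n \<epsilon> om"
  have "\<forall>n. n \<epsilon> om \<longrightarrow> dbl m = dbl n \<longrightarrow> m = n"
  proof (rule om_induct[OF _ m(1)])
    show "\<forall>n. n \<epsilon> om \<longrightarrow> dbl \<emptyset> = dbl n \<longrightarrow> \<emptyset> = n" using om_cases by fastforce
    show "\<forall>n. n \<epsilon> om \<longrightarrow> dbl (suc m) = dbl n \<longrightarrow> suc m = n"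
      if "m \<epsilon> om" "\<forall>n. n \<epsilon> om \<longrightarrow> dbl m = dbl n \<longrightarrow> m = n" for m
    proof (intro allI impI)
      fix n assume n: "n \<epsilon> om" "dbl (suc m) = dbl n"
      from om_cases[OF n(1)] show "suc m = n"
      proof
        assume "n = \<emptyset>"
        then show ?thesis using n that(1) by simp
      next
        assume "\<exists>k. k \<epsilon> om \<and> n = suc k"
        then obtain k where "k \<epsilon> om" "n = suc k" by blast
        then show ?thesis using n(2) that by simp
      qed
    qed
  qed (intro dfn)
  then show ?thesis using m by blast
qed

lemma suc_dbl_ne_dbl: "m \<epsilon> om \<Longrightarrow> n \<epsilon> om \<Longrightarrow> suc (dbl m) \<noteq> dbl n"
proof -
  assume m: "m \<epsilon> om" "n \<epsilon> om"
  have "\<forall>n. n \<epsilon> om \<longrightarrow> suc (dbl m) \<noteq> dbl n"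
  proof (rule om_induct[OF _ m(1)])
    show "\<forall>n. n \<epsilon> om \<longrightarrow> suc (dbl \<emptyset>) \<noteq> dbl n" using om_cases by fastforce
    show "\<forall>n. n \<epsilon> om \<longrightarrow> suc (dbl (suc m)) \<noteq> dbl n"
      if "m \<epsilon> om" "\<forall>n. n \<epsilon> om \<longrightarrow> suc (dbl m) \<noteq> dbl n" for m
    proof (intro allI impI)
      fix n assume "n \<epsilon> om"
      then consider "n = \<emptyset>" | k where "k \<epsilon> om" "n = suc k" using om_cases by blast
      then show "suc (dbl (suc m)) \<noteq> dbl n" using that by cases auto
    qed
  qed (intro dfn)
  then show ?thesis using m by blast
qed

lemma dbl_or_suc_dbl: "n \<epsilon> om \<Longrightarrow> \<exists>k. k \<epsilon> om \<and> (n = dbl k \<or> n = suc (dbl k))"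
proof (rule om_induct[where n = n])
  show "\<exists>k. k \<epsilon> om \<and> (\<emptyset> = dbl k \<or> \<emptyset> = suc (dbl k))" by (rule exI[of _ \<emptyset>]) simp
  show "\<exists>k. k \<epsilon> om \<and> (suc n = dbl k \<or> suc n = suc (dbl k))"
    if "\<exists>k. k \<epsilon> om \<and> (n = dbl k \<or> n = suc (dbl k))" for n
    using that dbl_suc suc_om by metis
qed (intro dfn)

lemma pr_inject [simp]:
  assumes "m \<epsilon> om" "n \<epsilon> om" "m' \<epsilon> om" "n' \<epsilon> om" shows "pr m n = pr m' n' \<longleftrightarrow> m = m' \<and> n = n'"
proof -
  have "\<forall>m'. m' \<epsilon> om \<longrightarrow> pr m n = pr m' n' \<longrightarrow> m = m' \<and> n = n'"
  proof (rule om_induct[OF _ assms(1)])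
    show "\<forall>m'. m' \<epsilon> om \<longrightarrow> pr \<emptyset> n = pr m' n' \<longrightarrow> \<emptyset> = m' \<and> n = n'"
    proof (intro allI impI)
      fix m' assume "m' \<epsilon> om" "pr \<emptyset> n = pr m' n'"
      then show "\<emptyset> = m' \<and> n = n'" using om_cases[of m'] assms dbl_inject suc_dbl_ne_dbl
        by (metis pr_om pr_suc pr_zero)
    qed
    fix m assume m: "m \<epsilon> om" and IH: "\<forall>m'. m' \<epsilon> om \<longrightarrow> pr m n = pr m' n' \<longrightarrow> m = m' \<and> n = n'"
    show "\<forall>m'. m' \<epsilon> om \<longrightarrow> pr (suc m) n = pr m' n' \<longrightarrow> suc m = m' \<and> n = n'"
    proof (intro allI impI)
      fix m' assume m': "m' \<epsilon> om" "pr (suc m) n = pr m' n'"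
      from om_cases[OF m'(1)] show "suc m = m' \<and> n = n'"
      proof
        assume "m' = \<emptyset>"
        then show ?thesis using m' suc_dbl_ne_dbl[of "pr m n" n'] m assms by simp
      next
        assume "\<exists>k. k \<epsilon> om \<and> m' = suc k"
        then obtain k where k: "k \<epsilon> om" "m' = suc k" by blast
        then have "pr m n = pr k n'" using m'(2) m assms dbl_inject by simp
        then show ?thesis using IH k by simp
      qed
    qed
  qed (intro dfn)
  then show ?thesis using assms by blast
qed

lemma dbl_ge: "n \<epsilon> om \<Longrightarrow> n \<epsilon> suc (dbl n)"
proof (rule om_induct[where n = n])
  show "suc n \<epsilon> suc (dbl (suc n))" if n: "n \<epsilon> om" "n \<epsilon> suc (dbl n)" for n
  proof -
    have "suc n \<epsilon> suc (suc (dbl n))" using om_suc_mem_iff[of "suc (dbl n)" n] n by simp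
    then show ?thesis using n by auto
  qed
qed (intro dfn, auto)

lemma suc_mem_trans: "x \<epsilon> suc y \<Longrightarrow> y \<epsilon> z \<Longrightarrow> z \<epsilon> om \<Longrightarrow> x \<epsilon> z"
  using om_trans by auto

lemma pr_surj: "c \<epsilon> om \<Longrightarrow> \<exists>m n. m \<epsilon> om \<and> n \<epsilon> om \<and> c = pr m n"
proof (rule om_strong_induct[where n = c])
  fix c assume c: "c \<epsilon> om" and IH: "\<And>d. d \<epsilon> c \<Longrightarrow> \<exists>m n. m \<epsilon> om \<and> n \<epsilon> om \<and> d = pr m n"
  obtain k where k: "k \<epsilon> om" "c = dbl k \<or> c = suc (dbl k)" using dbl_or_suc_dbl[OF c] by blast
  show "\<exists>m n. m \<epsilon> om \<and> n \<epsilon> om \<and> c = pr m n"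
  proof (cases "c = dbl k")
    case True
    then show ?thesis using k by (metis pr_zero zero_om)
  next
    case False
    then have "k \<epsilon> c" using k dbl_ge by simp
    from IH[OF this] obtain m n where "m \<epsilon> om" "n \<epsilon> om" "k = pr m n" by blast
    then show ?thesis using False k by (metis pr_suc suc_om)
  qed
qed (intro dfn)

lemma pr_ge2: "m \<epsilon> om \<Longrightarrow> n \<epsilon> om \<Longrightarrow> n \<epsilon> suc (pr m n)"
proof (rule om_induct[where n = m])
  show "n \<epsilon> suc (pr (suc m) n)" if "n \<epsilon> om" "m \<epsilon> om" "n \<epsilon> suc (pr m n)" for m
    using suc_mem_trans[OF that(3) dbl_ge] that by simp
qed (intro dfn, auto simp: dbl_ge[unfolded mem_suc])

text \<open>Strictness, which fails for \<open>pr \<emptyset> \<emptyset>\<close>, will place each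
  compound node of the coding after its arguments.\<close>

lemma pr_suc_gt2: "m \<epsilon> om \<Longrightarrow> n \<epsilon> om \<Longrightarrow> n \<epsilon> pr (suc m) n"
  using suc_mem_trans[OF pr_ge2 dbl_ge] by simp

lemma pr_ge1: "m \<epsilon> om \<Longrightarrow> n \<epsilon> om \<Longrightarrow> m \<epsilon> suc (pr m n)"
proof (rule om_induct[where n = m])
  show "\<emptyset> \<epsilon> suc (pr \<emptyset> n)" if "n \<epsilon> om" using om_zero_sub[of "suc (dbl n)"] that by simp
  show "suc m \<epsilon> suc (pr (suc m) n)" if "n \<epsilon> om" "m \<epsilon> om" "m \<epsilon> suc (pr m n)" for m
    using om_suc_mem_iff[of "suc (dbl (pr m n))" m] suc_mem_trans[OF that(3) dbl_ge] that by simp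
qed (intro dfn)

definition prl :: "'a \<Rightarrow> 'a" where "prl c = the1 (\<lambda>m. m \<epsilon> om \<and> (\<exists>n. n \<epsilon> om \<and> c = pr m n))"
definition prr :: "'a \<Rightarrow> 'a" where "prr c = the1 (\<lambda>n. n \<epsilon> om \<and> (\<exists>m. m \<epsilon> om \<and> c = pr m n))"

lemma dterm_prl [dfn]: "dterm t \<Longrightarrow> dterm (\<lambda>e. prl (t e))"
  by (rule dterm_comp1) (unfold prl_def, intro dfn)

lemma dterm_prr [dfn]: "dterm t \<Longrightarrow> dterm (\<lambda>e. prr (t e))"
  by (rule dterm_comp1) (unfold prr_def, intro dfn)

lemma prl_pr [simp]: "m \<epsilon> om \<Longrightarrow> n \<epsilon> om \<Longrightarrow> prl (pr m n) = m"
  and prr_pr [simp]: "m \<epsilon> om \<Longrightarrow> n \<epsilon> om \<Longrightarrow> prr (pr m n) = n"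
  unfolding prl_def prr_def by (rule the1_equality; auto)+

lemma prl_om [simp]: "c \<epsilon> om \<Longrightarrow> prl c \<epsilon> om" and prr_om [simp]: "c \<epsilon> om \<Longrightarrow> prr c \<epsilon> om"
  and pr_prl_prr [simp]: "c \<epsilon> om \<Longrightarrow> pr (prl c) (prr c) = c"
  and prl_le: "c \<epsilon> om \<Longrightarrow> prl c \<epsilon> suc c" and prr_le: "c \<epsilon> om \<Longrightarrow> prr c \<epsilon> suc c"
  using pr_surj[of c] pr_ge1 pr_ge2 by fastforce+

subsection \<open>Countable sets\<close>

text \<open>Only covering is asked: values outside \<open>X\<close> are allowed, so the empty set is
  no special case.\<close>

definition cnt :: "'a \<Rightarrow> bool" where
  "cnt X \<longleftrightarrow> (\<exists>f. func f om \<and> (\<forall>x. x \<epsilon> X \<longrightarrow> (\<exists>n. n \<epsilon> om \<and> x = f \<cdot> n)))"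

lemma definable_cnt [dfn]: "dterm t \<Longrightarrow> definable (\<lambda>e. cnt (t e))"
  by (rule definable_comp1) (unfold cnt_def, intro dfn)

lemma cnt_lam:
  assumes "dterm (\<lambda>e. F (e 0))" "\<And>x. x \<epsilon> X \<Longrightarrow> \<exists>n. n \<epsilon> om \<and> x = F n" shows "cnt X"
  unfolding cnt_def using func_lam[OF assms(1)] app_lam[OF assms(1)] assms(2) by metis

lemma cnt_sub: "cnt X \<Longrightarrow> Y \<sqsubseteq> X \<Longrightarrow> cnt Y"
  unfolding cnt_def by (blast dest: subD)

lemma cnt_om: "cnt om"
  by (rule cnt_lam[where F = "\<lambda>x. x"]) (intro dfn, blast)

lemma cnt_image:
  assumes "cnt X" "dterm (\<lambda>e. F (e 0))" "\<And>y. y \<epsilon> Y \<Longrightarrow> \<exists>x. x \<epsilon> X \<and> y = F x" shows "cnt Y"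
proof -
  obtain f where f: "\<And>x. x \<epsilon> X \<Longrightarrow> \<exists>n. n \<epsilon> om \<and> x = f \<cdot> n" using assms(1) unfolding cnt_def by blast
  show ?thesis
    by (rule cnt_lam[where F = "\<lambda>n. F (f \<cdot> n)"]) (intro dterm_comp1[OF assms(2)] dfn, use f assms(3) in metis)
qed

lemma cnt_prod: "cnt X \<Longrightarrow> cnt Y \<Longrightarrow> cnt (X \<otimes> Y)"
proof -
  assume "cnt X" "cnt Y"
  then obtain f g where fg: "\<And>x. x \<epsilon> X \<Longrightarrow> \<exists>n. n \<epsilon> om \<and> x = f \<cdot> n" "\<And>x. x \<epsilon> Y \<Longrightarrow> \<exists>n. n \<epsilon> om \<and> x = g \<cdot> n"
    unfolding cnt_def by blast
  show ?thesis
  proof (rule cnt_lam[where F = "\<lambda>k. \<langle>f \<cdot> prl k, g \<cdot> prr k\<rangle>"])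
    fix p assume "p \<epsilon> X \<otimes> Y"
    then obtain m n where "m \<epsilon> om" "n \<epsilon> om" "p = \<langle>f \<cdot> m, g \<cdot> n\<rangle>" using fg unfolding mem_prod by metis
    then show "\<exists>k. k \<epsilon> om \<and> p = \<langle>f \<cdot> prl k, g \<cdot> prr k\<rangle>" by (intro exI[of _ "pr m n"]) simp
  qed (intro dfn)
qed

lemma cnt_maps: "cnt X \<Longrightarrow> \<exists>f. maps f om (adj X \<emptyset>) \<and> (\<forall>x. x \<epsilon> X \<longrightarrow> (\<exists>n. n \<epsilon> om \<and> x = f \<cdot> n))"
proof -
  assume "cnt X"
  then obtain f where f: "\<And>x. x \<epsilon> X \<Longrightarrow> \<exists>n. n \<epsilon> om \<and> x = f \<cdot> n" unfolding cnt_def by blast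
  have d: "dterm (\<lambda>e. if f \<cdot> e 0 \<epsilon> X then f \<cdot> e 0 else \<emptyset>)" by (intro dfn)
  show ?thesis
    by (rule exI[of _ "lam om (\<lambda>n. if f \<cdot> n \<epsilon> X then f \<cdot> n else \<emptyset>)"])
       (use f in \<open>auto intro!: maps_lam d simp: app_lam[OF d]\<close>, metis app_lam[OF d])
qed

text \<open>Enumerations of all \<open>F i\<close> are chosen simultaneously. They are taken with
  values in the union plus \<open>\<emptyset>\<close>, which confines the candidates to one
  set.\<close>

lemma cnt_UN:
  assumes F: "dterm (\<lambda>e. F (e 0))" and cnt: "\<And>i. i \<epsilon> om \<Longrightarrow> cnt (F i)"
  shows "cnt (uni (repl om F))"
proof -
  note [dfn] = dterm_comp1[OF F]
  let ?X = "uni (repl om F)"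
  have mX: "x \<epsilon> ?X \<longleftrightarrow> (\<exists>i. i \<epsilon> om \<and> x \<epsilon> F i)" for x by (auto simp: mem_repl[OF F])
  have ex: "\<exists>f. f \<epsilon> fspace om (adj ?X \<emptyset>) \<and> (\<forall>x. x \<epsilon> F i \<longrightarrow> (\<exists>n. n \<epsilon> om \<and> x = f \<cdot> n))" if i: "i \<epsilon> om" for i
  proof -
    obtain f where "maps f om (adj (F i) \<emptyset>)" "\<forall>x. x \<epsilon> F i \<longrightarrow> (\<exists>n. n \<epsilon> om \<and> x = f \<cdot> n)"
      using cnt_maps[OF cnt[OF i]] by blast
    then show ?thesis using i unfolding mem_fspace maps_def mem_adj mX by blast
  qed
  have d: "definable (\<lambda>e. \<forall>x. x \<epsilon> F (e 0) \<longrightarrow> (\<exists>n. n \<epsilon> om \<and> x = e 1 \<cdot> n))" by (intro dfn)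
  obtain h where h: "\<And>i. i \<epsilon> om \<Longrightarrow> \<forall>x. x \<epsilon> F i \<longrightarrow> (\<exists>n. n \<epsilon> om \<and> x = h \<cdot> i \<cdot> n)"
    using set_choice[where Q = "\<lambda>i f. \<forall>x. x \<epsilon> F i \<longrightarrow> (\<exists>n. n \<epsilon> om \<and> x = f \<cdot> n)", OF d ex] by blast
  show ?thesis
  proof (rule cnt_lam[where F = "\<lambda>k. h \<cdot> prl k \<cdot> prr k"])
    fix x assume "x \<epsilon> ?X"
    then obtain i n where "i \<epsilon> om" "n \<epsilon> om" "x = h \<cdot> i \<cdot> n" using h unfolding mX by blast
    then show "\<exists>k. k \<epsilon> om \<and> x = h \<cdot> prl k \<cdot> prr k" by (intro exI[of _ "pr i n"]) simp
  qed (intro dfn)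
qed

lemma cnt_un: "cnt X \<Longrightarrow> cnt Y \<Longrightarrow> cnt (X \<squnion> Y)"
proof -
  assume XY: "cnt X" "cnt Y"
  have d: "dterm (\<lambda>e. if e 0 = \<emptyset> then X else Y)" by (intro dfn)
  have "cnt (uni (repl om (\<lambda>i. if i = \<emptyset> then X else Y)))"
    by (rule cnt_UN[OF d]) (use XY in simp)
  then show ?thesis
  proof (rule cnt_sub, intro subI)
    fix x assume "x \<epsilon> X \<squnion> Y"
    then have "x \<epsilon> (if \<emptyset> = \<emptyset> then X else Y) \<or> x \<epsilon> (if suc \<emptyset> = \<emptyset> then X else Y)" by simp
    then show "x \<epsilon> uni (repl om (\<lambda>i. if i = \<emptyset> then X else Y))"
      unfolding mem_uni mem_repl[OF d] by (metis suc_om zero_om)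
  qed
qed

lemma cnt_sing: "cnt (upr a a)"
  by (rule cnt_lam[where F = "\<lambda>_. a"]) (intro dfn, auto intro: zero_om)

definition seqs :: "'a \<Rightarrow> 'a" where "seqs V = uni (repl om (\<lambda>n. fspace n V))"

lemma mem_seqs: "s \<epsilon> seqs V \<longleftrightarrow> (\<exists>n. n \<epsilon> om \<and> maps s n V)"
proof -
  have d: "dterm (\<lambda>e. fspace (e 0) V)" by (intro dfn)
  show ?thesis unfolding seqs_def by (auto simp: mem_repl[OF d])
qed

lemma cnt_seqs: "cnt V \<Longrightarrow> cnt (seqs V)"
proof -
  assume V: "cnt V"
  have d: "dterm (\<lambda>e. fspace (e 0) V)" by (intro dfn)
  have "cnt (fspace n V)" if "n \<epsilon> om" for n
  proof (rule om_induct[OF _ that])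
    show "cnt (fspace \<emptyset> V)"
      by (rule cnt_sub[OF cnt_sing[of \<emptyset>]]) (auto intro!: subI simp: maps_def func_empty_iff)
    fix n assume n: "n \<epsilon> om" and IH: "cnt (fspace n V)"
    show "cnt (fspace (suc n) V)"
    proof (rule cnt_image[OF cnt_prod[OF IH V], where F = "\<lambda>p. adj (p1 p) \<langle>n, p2 p\<rangle>"])
      fix s assume "s \<epsilon> fspace (suc n) V"
      then have s: "func s (suc n)" "\<And>i. i \<epsilon> suc n \<Longrightarrow> s \<cdot> i \<epsilon> V" by (auto simp: maps_def)
      have r: "func (s \<restriction> n) n" by (rule func_res[OF s(1)]) (auto intro: subI)
      have "maps (s \<restriction> n) n V" unfolding maps_def using r s(2) by auto
      moreover have "s = adj (s \<restriction> n) \<langle>n, s \<cdot> n\<rangle>"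
        by (rule func_eqI[OF s(1)]) (use func_adj[OF r] in \<open>auto simp: suc_def\<close>)
      ultimately show "\<exists>p. p \<epsilon> fspace n V \<otimes> V \<and> s = adj (p1 p) \<langle>n, p2 p\<rangle>"
        using s(2)[of n] by (intro exI[of _ "\<langle>s \<restriction> n, s \<cdot> n\<rangle>"]) auto
    qed (intro dfn)
  qed (intro dfn)
  then show ?thesis unfolding seqs_def by (rule cnt_UN[OF d])
qed

text \<open>Bounded subsets of \<open>om\<close> serve as the finite sets of numbers, in the sense
  of the model.\<close>

definition finpow :: 'a where "finpow = uni (repl om pow)"

lemma mem_finpow: "u \<epsilon> finpow \<longleftrightarrow> (\<exists>n. n \<epsilon> om \<and> u \<sqsubseteq> n)"
proof -
  have d: "dterm (\<lambda>e. pow (e 0))" by (intro dfn)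
  show ?thesis unfolding finpow_def by (auto simp: mem_repl[OF d])
qed

lemma cnt_finpow: "cnt finpow"
proof -
  have d: "dterm (\<lambda>e. pow (e 0))" by (intro dfn)
  have "cnt (pow n)" if "n \<epsilon> om" for n
  proof (rule om_induct[OF _ that])
    show "cnt (pow \<emptyset>)"
      by (rule cnt_sub[OF cnt_sing[of \<emptyset>]]) (auto intro!: subI simp: eq_emp_iff subset_of_def)
    fix n assume n: "n \<epsilon> om" and IH: "cnt (pow n)"
    show "cnt (pow (suc n))"
    proof (rule cnt_image[OF cnt_prod[OF IH cnt_om], where F = "\<lambda>p. if p2 p = \<emptyset> then p1 p else adj (p1 p) n"])
      fix u assume u: "u \<epsilon> pow (suc n)"
      show "\<exists>p. p \<epsilon> pow n \<otimes> om \<and> u = (if p2 p = \<emptyset> then p1 p else adj (p1 p) n)"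
      proof (cases "n \<epsilon> u")
        case True
        then have "u = adj (u \<sqinter> n) n" using u by (auto intro!: ext dest: subD)
        then show ?thesis by (intro exI[of _ "\<langle>u \<sqinter> n, suc \<emptyset>\<rangle>"]) (auto intro: subI)
      next
        case False
        then have "u \<sqsubseteq> n" using u by (auto intro!: subI dest: subD)
        then show ?thesis by (intro exI[of _ "\<langle>u, \<emptyset>\<rangle>"]) auto
      qed
    qed (intro dfn)
  qed (intro dfn)
  then show ?thesis unfolding finpow_def by (rule cnt_UN[OF d])
qed

subsection \<open>Cardinality\<close>

lemma is_injection_iff:
  "is_injection E f a b \<longleftrightarrow> maps f a b \<and> (\<forall>x x'. x \<epsilon> a \<longrightarrow> x' \<epsilon> a \<longrightarrow> f \<cdot> x = f \<cdot> x' \<longrightarrow> x = x')"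
proof -
  have rel: "related E f x y \<longleftrightarrow> \<langle>x, y\<rangle> \<epsilon> f" for x y
    unfolding related_def is_pair_iff by blast
  show ?thesis
  proof
    assume *: "is_injection E f a b"
    then have 1: "\<And>p. p \<epsilon> f \<Longrightarrow> \<exists>x y. x \<epsilon> a \<and> y \<epsilon> b \<and> p = \<langle>x, y\<rangle>"
      and 2: "\<And>x. x \<epsilon> a \<Longrightarrow> \<exists>!y. \<langle>x, y\<rangle> \<epsilon> f" and 3: "\<And>x x' y. \<langle>x, y\<rangle> \<epsilon> f \<Longrightarrow> \<langle>x', y\<rangle> \<epsilon> f \<Longrightarrow> x = x'"
      unfolding is_injection_def relation_between_def rel is_pair_iff by blast+
    have f: "func f a" unfolding func_def using 1 2 by blast
    have "f \<cdot> x \<epsilon> b" if "x \<epsilon> a" for x using 1[OF func_app[OF f that]] by auto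
    then show "maps f a b \<and> (\<forall>x x'. x \<epsilon> a \<longrightarrow> x' \<epsilon> a \<longrightarrow> f \<cdot> x = f \<cdot> x' \<longrightarrow> x = x')"
      unfolding maps_def using f func_app[OF f] 3 by metis
  next
    assume *: "maps f a b \<and> (\<forall>x x'. x \<epsilon> a \<longrightarrow> x' \<epsilon> a \<longrightarrow> f \<cdot> x = f \<cdot> x' \<longrightarrow> x = x')"
    then have f: "func f a" unfolding maps_def by blast
    show "is_injection E f a b"
      unfolding is_injection_def relation_between_def rel is_pair_iff
    proof (intro conjI allI impI)
      show "\<exists>x y. x \<epsilon> a \<and> y \<epsilon> b \<and> p = \<langle>x, y\<rangle>" if "p \<epsilon> f" for p
        using that * mem_func_iff[OF f] unfolding maps_def by blast
      show "\<exists>!y. \<langle>x, y\<rangle> \<epsilon> f" if "x \<epsilon> a" for x using f that unfolding func_def by blast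
      show "x = x'" if "\<langle>x, y\<rangle> \<epsilon> f \<and> \<langle>x', y\<rangle> \<epsilon> f" for x x' y
        using that * unfolding func_pair_iff[OF f] by metis
    qed
  qed
qed

lemma card_le_lam:
  assumes "dterm (\<lambda>e. F (e 0))" "\<And>x. x \<epsilon> a \<Longrightarrow> F x \<epsilon> b"
    "\<And>x x'. x \<epsilon> a \<Longrightarrow> x' \<epsilon> a \<Longrightarrow> F x = F x' \<Longrightarrow> x = x'"
  shows "card_le E a b"
  unfolding card_le_def is_injection_iff
  using assms by (intro exI[of _ "lam a F"]) (simp add: maps_lam app_lam)

lemma card_le_sub: "a \<sqsubseteq> b \<Longrightarrow> card_le E a b"
  by (rule card_le_lam[where F = "\<lambda>x. x"]) (intro dfn, auto dest: subD)

lemma card_le_trans: "card_le E a b \<Longrightarrow> card_le E b c \<Longrightarrow> card_le E a c"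
proof -
  assume "card_le E a b" "card_le E b c"
  then obtain f g where f: "maps f a b" "\<And>x x'. x \<epsilon> a \<Longrightarrow> x' \<epsilon> a \<Longrightarrow> f \<cdot> x = f \<cdot> x' \<Longrightarrow> x = x'"
    and g: "maps g b c" "\<And>x x'. x \<epsilon> b \<Longrightarrow> x' \<epsilon> b \<Longrightarrow> g \<cdot> x = g \<cdot> x' \<Longrightarrow> x = x'"
    unfolding card_le_def is_injection_iff by blast
  show ?thesis
    by (rule card_le_lam[where F = "\<lambda>x. g \<cdot> (f \<cdot> x)"]) (intro dfn, use f g in \<open>auto simp: maps_def\<close>)
qed

lemma cnt_card_le_om: "cnt X \<Longrightarrow> card_le E X om"
proof -
  assume "cnt X"
  then obtain f where f: "\<And>x. x \<epsilon> X \<Longrightarrow> \<exists>n. n \<epsilon> om \<and> x = f \<cdot> n" unfolding cnt_def by blast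
  \<comment> \<open>The injection sends \<open>x\<close> to its least index.\<close>
  define P where "P x n \<longleftrightarrow> n \<epsilon> om \<and> x = f \<cdot> n \<and> (\<forall>m. m \<epsilon> n \<longrightarrow> x \<noteq> f \<cdot> m)" for x n
  have P: "P x (the1 (P x))" if x: "x \<epsilon> X" for x
  proof -
    obtain n where n: "n \<epsilon> om" "x = f \<cdot> n" using f[OF x] by blast
    have "definable (\<lambda>e. x = f \<cdot> e 0)" by (intro dfn)
    from ord_least[where P = "\<lambda>n. x = f \<cdot> n", OF this om_ord[OF n(1)] n(2)] obtain k
      where k: "is_ordinal E k" "x = f \<cdot> k" "\<forall>m. m \<epsilon> k \<longrightarrow> x \<noteq> f \<cdot> m" by blast
    have "k \<epsilon> n \<or> k = n" using ord_linear[OF k(1) om_ord[OF n(1)]] k n by blast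
    then have "P x k" using k n om_mem unfolding P_def by blast
    moreover have "z = k" if "P x z" for z
      using om_linear[of z k] that \<open>P x k\<close> unfolding P_def by blast
    ultimately show ?thesis by (metis the1_equality)
  qed
  show ?thesis
  proof (rule card_le_lam[where F = "\<lambda>x. the1 (P x)"])
    show "dterm (\<lambda>e. the1 (P (e 0)))" unfolding P_def by (intro dfn)
  qed (use P P_def in \<open>metis+\<close>)
qed

lemma card_le_om_cnt: "card_le E X om \<Longrightarrow> cnt X"
proof -
  assume "card_le E X om"
  then obtain f where f: "maps f X om" "\<And>x x'. x \<epsilon> X \<Longrightarrow> x' \<epsilon> X \<Longrightarrow> f \<cdot> x = f \<cdot> x' \<Longrightarrow> x = x'"
    unfolding card_le_def is_injection_iff by blast
  show ?thesis
  proof (rule cnt_lam[where F = "\<lambda>n. the1 (\<lambda>x. x \<epsilon> X \<and> f \<cdot> x = n)"])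
    fix x assume x: "x \<epsilon> X"
    have "the1 (\<lambda>z. z \<epsilon> X \<and> f \<cdot> z = f \<cdot> x) = x" by (rule the1_equality) (use f(2) x in auto)
    then show "\<exists>n. n \<epsilon> om \<and> x = the1 (\<lambda>x. x \<epsilon> X \<and> f \<cdot> x = n)"
      using f(1) x unfolding maps_def by (intro exI[of _ "f \<cdot> x"]) simp
  qed (intro dfn)
qed

lemma countable_set_iff: "countable_set E X \<longleftrightarrow> cnt X"
  unfolding countable_set_def is_omega_iff using cnt_card_le_om card_le_om_cnt by blast

end

section \<open>Countably complete ultrafilters\<close>

text \<open>The consequences of measurability that drive the game: an ultrafilter closed under
  countable intersections and concentrating on the final segments of \<open>K\<close>. Countable
  families are given by definable operations, so that they are sets of the model.\<close>

locale zfc_measure = zfc +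
  fixes K U :: 'a
  assumes K_ord: "is_ordinal E K"
    and U_sub: "a \<epsilon> U \<Longrightarrow> a \<sqsubseteq> K"
    and U_top: "K \<epsilon> U"
    and U_nonempty: "\<not> \<emptyset> \<epsilon> U"
    and U_ultra: "a \<sqsubseteq> K \<Longrightarrow> \<not> a \<epsilon> U \<Longrightarrow> K \<ominus> a \<epsilon> U"
    and U_Inter: "dterm (\<lambda>e. F (e 0)) \<Longrightarrow> (\<And>n. n \<epsilon> om \<Longrightarrow> F n \<epsilon> U) \<Longrightarrow>
      sep K (\<lambda>x. \<forall>n. n \<epsilon> om \<longrightarrow> x \<epsilon> F n) \<epsilon> U"
    and U_final: "\<alpha> \<epsilon> K \<Longrightarrow> K \<ominus> suc \<alpha> \<epsilon> U"

lemma (in zfc) measurable_measure: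
  assumes "measurable_cardinal E K" shows "\<exists>U. zfc_measure E K U"
proof -
  obtain U where card: "is_cardinal E K" "\<not> countable_set E K"
    and uf: "is_ultrafilter E U K" "nonprincipal E U" "complete_filter E U K"
    using assms unfolding measurable_cardinal_def by blast
  have ord: "is_ordinal E K" and less: "\<And>a. a \<epsilon> K \<Longrightarrow> card_less E a K"
    using card(1) unfolding is_cardinal_def by blast+
  have sub: "a \<epsilon> U \<Longrightarrow> a \<sqsubseteq> K" and top: "K \<epsilon> U" and ne: "a \<epsilon> U \<Longrightarrow> a \<noteq> \<emptyset>"
    and inter: "a \<epsilon> U \<Longrightarrow> b \<epsilon> U \<Longrightarrow> a \<sqinter> b \<epsilon> U" and ultra: "a \<sqsubseteq> K \<Longrightarrow> \<not> a \<epsilon> U \<Longrightarrow> K \<ominus> a \<epsilon> U" for a b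
    using uf(1) unfolding is_ultrafilter_def is_empty_def eq_emp_iff using mem_int mem_diff by metis+
  have sing: "K \<ominus> upr a a \<epsilon> U" if "a \<epsilon> K" for a
    by (rule ultra) (use that uf(2) in \<open>auto intro: subI simp: nonprincipal_def is_upair_iff\<close>)
  have compl: "sep K (\<lambda>x. \<forall>a. a \<epsilon> F \<longrightarrow> x \<epsilon> a) \<epsilon> U" if F: "F \<sqsubseteq> U" "F \<noteq> \<emptyset>" "card_less E F K" for F
  proof -
    have "x \<epsilon> sep K (\<lambda>x. \<forall>a. a \<epsilon> F \<longrightarrow> x \<epsilon> a) \<longleftrightarrow> (\<forall>a. a \<epsilon> F \<longrightarrow> x \<epsilon> a)" for x
    proof -
      obtain a where "a \<epsilon> F" using F(2) eq_emp_iff by blast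
      then have "a \<sqsubseteq> K" using F(1) sub subD by blast
      then show ?thesis by (subst mem_sep) (intro dfn, use \<open>a \<epsilon> F\<close> in \<open>auto dest: subD\<close>)
    qed
    then show ?thesis using uf(3) F unfolding complete_filter_def is_empty_def eq_emp_iff by blast
  qed
  have unc: "\<not> card_le E K om" using card(2) unfolding countable_set_def is_omega_iff by blast
  have om_K: "om \<sqsubseteq> K"
    using ord_linear[OF ord_om ord] ord_mem_sub[OF ord_om, of K] ord_mem_sub[OF ord, of om]
      card_le_sub[of K om] unc sub_refl by metis
  have Inter: "sep K (\<lambda>x. \<forall>n. n \<epsilon> om \<longrightarrow> x \<epsilon> F n) \<epsilon> U"
    if F: "dterm (\<lambda>e. F (e 0))" and FU: "\<And>n. n \<epsilon> om \<Longrightarrow> F n \<epsilon> U" for F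
  proof -
    let ?F = "repl om F"
    have le: "card_le E ?F om"
      by (rule cnt_card_le_om, rule cnt_image[OF cnt_om F]) (simp add: mem_repl[OF F])
    have "card_less E ?F K" unfolding card_less_def
      using card_le_trans[OF le card_le_sub[OF om_K]] card_le_trans[OF _ le] unc by blast
    moreover have "?F \<sqsubseteq> U" by (rule subI) (use FU mem_repl[OF F] in auto)
    moreover have "?F \<noteq> \<emptyset>" unfolding eq_emp_iff mem_repl[OF F] using zero_om by blast
    ultimately have "sep K (\<lambda>x. \<forall>a. a \<epsilon> ?F \<longrightarrow> x \<epsilon> a) \<epsilon> U" using compl by blast
    also have "sep K (\<lambda>x. \<forall>a. a \<epsilon> ?F \<longrightarrow> x \<epsilon> a) = sep K (\<lambda>x. \<forall>n. n \<epsilon> om \<longrightarrow> x \<epsilon> F n)"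
      unfolding mem_repl[OF F] by (rule arg_cong[where f = "sep K"]) blast
    finally show ?thesis .
  qed
  have final: "K \<ominus> suc \<alpha> \<epsilon> U" if \<alpha>: "\<alpha> \<epsilon> K" for \<alpha>
  proof -
    have \<alpha>K: "\<alpha> \<sqsubseteq> K" by (rule ord_mem_sub[OF ord \<alpha>])
    \<comment> \<open>An initial segment is null as a union of fewer than \<open>K\<close> points:
      the complements of these points form a family of size at most \<open>\<alpha>\<close>. The
      case of no points is separate because completeness speaks of nonempty families.\<close>
    have "K \<ominus> \<alpha> \<epsilon> U"
    proof (cases "\<alpha> = \<emptyset>")
      case True
      then have "K \<ominus> \<alpha> = K" by (auto intro: ext)
      then show ?thesis using top by simp
    next
      case False
      define G where "G \<beta> = K \<ominus> upr \<beta> \<beta>" for \<beta>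
      have G: "dterm (\<lambda>e. G (e 0))" unfolding G_def by (intro dfn)
      have inj: "\<beta> = \<gamma>" if "\<beta> \<epsilon> K" "\<gamma> \<epsilon> K" "G \<beta> = G \<gamma>" for \<beta> \<gamma>
        using that unfolding G_def by (metis mem_diff mem_upr)
      let ?F = "repl \<alpha> G"
      have le: "card_le E ?F \<alpha>"
      proof (rule card_le_lam[where F = "\<lambda>X. the1 (\<lambda>\<beta>. \<beta> \<epsilon> \<alpha> \<and> X = G \<beta>)"])
        show "dterm (\<lambda>e. the1 (\<lambda>\<beta>. \<beta> \<epsilon> \<alpha> \<and> e 0 = G \<beta>))" by (intro dfn dterm_comp1[OF G])
        have *: "the1 (\<lambda>\<gamma>. \<gamma> \<epsilon> \<alpha> \<and> G \<beta> = G \<gamma>) = \<beta>" if "\<beta> \<epsilon> \<alpha>" for \<beta>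
          by (rule the1_equality) (use that inj \<alpha>K in \<open>auto dest: subD\<close>)
        show "the1 (\<lambda>\<beta>. \<beta> \<epsilon> \<alpha> \<and> X = G \<beta>) \<epsilon> \<alpha>" if "X \<epsilon> ?F" for X
          using that * unfolding mem_repl[OF G] by auto
        show "X = Y" if "X \<epsilon> ?F" "Y \<epsilon> ?F"
          "the1 (\<lambda>\<beta>. \<beta> \<epsilon> \<alpha> \<and> X = G \<beta>) = the1 (\<lambda>\<beta>. \<beta> \<epsilon> \<alpha> \<and> Y = G \<beta>)" for X Y
          using that * unfolding mem_repl[OF G] by auto
      qed
      have "card_less E ?F K" unfolding card_less_def
        using card_le_trans[OF le card_le_sub[OF \<alpha>K]] card_le_trans[OF _ le] less[OF \<alpha>]
        unfolding card_less_def by blast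
      moreover have "?F \<sqsubseteq> U" by (rule subI) (use sing \<alpha>K mem_repl[OF G] in \<open>auto simp: G_def dest: subD\<close>)
      moreover have "?F \<noteq> \<emptyset>" using False unfolding eq_emp_iff mem_repl[OF G] by blast
      ultimately have "sep K (\<lambda>x. \<forall>a. a \<epsilon> ?F \<longrightarrow> x \<epsilon> a) \<epsilon> U" using compl by blast
      also have "sep K (\<lambda>x. \<forall>a. a \<epsilon> ?F \<longrightarrow> x \<epsilon> a) = K \<ominus> \<alpha>"
        by (rule ext, subst mem_sep) (intro dfn, auto simp: mem_repl[OF G] G_def)
      finally show ?thesis .
    qed
    from inter[OF this sing[OF \<alpha>]] have "(K \<ominus> \<alpha>) \<sqinter> (K \<ominus> upr \<alpha> \<alpha>) \<epsilon> U" .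
    also have "(K \<ominus> \<alpha>) \<sqinter> (K \<ominus> upr \<alpha> \<alpha>) = K \<ominus> suc \<alpha>" by (auto intro: ext)
    finally show ?thesis .
  qed
  have "zfc_measure E K U"
    by unfold_locales (use ord sub top ne ultra Inter final in auto)
  then show ?thesis by blast
qed

context zfc_measure begin

lemma U_Inter_ex:
  assumes "dterm (\<lambda>e. F (e 0))" "\<And>n. n \<epsilon> om \<Longrightarrow> F n \<epsilon> U"
  shows "\<exists>x. x \<epsilon> K \<and> (\<forall>n. n \<epsilon> om \<longrightarrow> x \<epsilon> F n)"
proof -
  have "sep K (\<lambda>x. \<forall>n. n \<epsilon> om \<longrightarrow> x \<epsilon> F n) \<noteq> \<emptyset>" using U_Inter[OF assms] U_nonempty by auto
  moreover have "x \<epsilon> sep K (\<lambda>x. \<forall>n. n \<epsilon> om \<longrightarrow> x \<epsilon> F n) \<longleftrightarrow> x \<epsilon> K \<and> (\<forall>n. n \<epsilon> om \<longrightarrow> x \<epsilon> F n)" for x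
    by (rule mem_sep) (intro dfn dterm_comp1[OF assms(1)])
  ultimately show ?thesis unfolding eq_emp_iff by blast
qed

lemma U_int: "a \<epsilon> U \<Longrightarrow> b \<epsilon> U \<Longrightarrow> a \<sqinter> b \<epsilon> U"
proof -
  assume ab: "a \<epsilon> U" "b \<epsilon> U"
  let ?F = "\<lambda>n. if n = \<emptyset> then a else b"
  have d: "dterm (\<lambda>e. ?F (e 0))" by (intro dfn)
  have "sep K (\<lambda>x. \<forall>n. n \<epsilon> om \<longrightarrow> x \<epsilon> ?F n) \<epsilon> U" by (rule U_Inter[OF d]) (use ab in auto)
  also have "sep K (\<lambda>x. \<forall>n. n \<epsilon> om \<longrightarrow> x \<epsilon> ?F n) = a \<sqinter> b"
  proof (rule ext)
    fix x
    have 1: "x \<epsilon> a \<and> x \<epsilon> b" if "\<forall>n. n \<epsilon> om \<longrightarrow> x \<epsilon> ?F n"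
    proof -
      have "x \<epsilon> ?F \<emptyset>" "x \<epsilon> ?F (suc \<emptyset>)" by (rule that[THEN spec, THEN mp], rule zero_om, rule that[THEN spec, THEN mp], rule suc_om, rule zero_om)
      then show ?thesis by (simp only: suc_ne_emp if_True if_False simp_thms)
    qed
    have 2: "\<forall>n. n \<epsilon> om \<longrightarrow> x \<epsilon> ?F n" if "x \<epsilon> a \<and> x \<epsilon> b"
      using that by (simp split: if_split)
    have "(\<forall>n. n \<epsilon> om \<longrightarrow> x \<epsilon> ?F n) \<longleftrightarrow> x \<epsilon> a \<and> x \<epsilon> b" by (rule iffI) (erule 1, erule 2)
    moreover have "x \<epsilon> a \<Longrightarrow> x \<epsilon> K" using U_sub[OF ab(1)] subD by blast
    ultimately show "x \<epsilon> sep K (\<lambda>x. \<forall>n. n \<epsilon> om \<longrightarrow> x \<epsilon> ?F n) \<longleftrightarrow> x \<epsilon> a \<sqinter> b"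
      by (subst mem_sep) (intro dfn, auto)
  qed
  finally show ?thesis .
qed

text \<open>If all fibres were null, their complements would be countably many measure one sets
  without a common element.\<close>

lemma U_pigeonhole:
  assumes F: "dterm (\<lambda>e. F (e 0))" and "cnt S" and FS: "\<And>x. x \<epsilon> K \<Longrightarrow> F x \<epsilon> S"
  shows "\<exists>u. u \<epsilon> S \<and> sep K (\<lambda>x. F x = u) \<epsilon> U"
proof (rule ccontr)
  note [dfn] = dterm_comp1[OF F]
  assume neg: "\<not> ?thesis"
  obtain \<sigma> where \<sigma>: "\<And>u. u \<epsilon> S \<Longrightarrow> \<exists>n. n \<epsilon> om \<and> u = \<sigma> \<cdot> n" using \<open>cnt S\<close> unfolding cnt_def by blast
  have m: "x \<epsilon> sep K (\<lambda>x. F x = u) \<longleftrightarrow> x \<epsilon> K \<and> F x = u" for x u by (rule mem_sep) (intro dfn)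
  let ?G = "\<lambda>n. K \<ominus> sep K (\<lambda>x. F x = \<sigma> \<cdot> n)"
  have "\<exists>x. x \<epsilon> K \<and> (\<forall>n. n \<epsilon> om \<longrightarrow> x \<epsilon> ?G n)"
  proof (rule U_Inter_ex)
    show "dterm (\<lambda>e. ?G (e 0))" by (intro dfn)
    fix n
    show "?G n \<epsilon> U"
    proof (rule U_ultra)
      show "sep K (\<lambda>x. F x = \<sigma> \<cdot> n) \<sqsubseteq> K" using m by (auto intro: subI)
      show "\<not> sep K (\<lambda>x. F x = \<sigma> \<cdot> n) \<epsilon> U"
      proof
        assume *: "sep K (\<lambda>x. F x = \<sigma> \<cdot> n) \<epsilon> U"
        then obtain x where "x \<epsilon> K" "F x = \<sigma> \<cdot> n" using U_nonempty m eq_emp_iff by metis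
        then show False using neg * FS by metis
      qed
    qed
  qed
  then obtain x where x: "x \<epsilon> K" "\<And>n. n \<epsilon> om \<Longrightarrow> F x \<noteq> \<sigma> \<cdot> n" unfolding mem_diff m by blast
  then show False using \<sigma>[OF FS[OF x(1)]] by blast
qed

end

section \<open>Maxima of finite linear orders\<close>

context zfc begin

definition lin_order :: "'a \<Rightarrow> 'a \<Rightarrow> bool" where
  "lin_order l d \<longleftrightarrow> (\<forall>i. i \<epsilon> d \<longrightarrow> \<not> \<langle>i, i\<rangle> \<epsilon> l) \<and>
     (\<forall>i j k. i \<epsilon> d \<longrightarrow> j \<epsilon> d \<longrightarrow> k \<epsilon> d \<longrightarrow> \<langle>i, j\<rangle> \<epsilon> l \<longrightarrow> \<langle>j, k\<rangle> \<epsilon> l \<longrightarrow> \<langle>i, k\<rangle> \<epsilon> l) \<and>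
     (\<forall>i j. i \<epsilon> d \<longrightarrow> j \<epsilon> d \<longrightarrow> \<langle>i, j\<rangle> \<epsilon> l \<or> i = j \<or> \<langle>j, i\<rangle> \<epsilon> l)"

lemma definable_lin_order [dfn]: "dterm t \<Longrightarrow> dterm u \<Longrightarrow> definable (\<lambda>e. lin_order (t e) (u e))"
  by (rule definable_comp2) (unfold lin_order_def, intro dfn)

text \<open>Seen from outside \<open>n\<close> may be infinite, so the maximum comes from an
  induction inside the model over the initial segments of \<open>n\<close>. Applied to the reversed
  relation it yields minima.\<close>

lemma finite_max:
  assumes r: "definable (\<lambda>e. r (e 0) (e 1))" and n: "n \<epsilon> om"
    and trans: "\<And>i j k. i \<epsilon> n \<Longrightarrow> j \<epsilon> n \<Longrightarrow> k \<epsilon> n \<Longrightarrow> r i j \<Longrightarrow> r j k \<Longrightarrow> r i k"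
    and total: "\<And>i j. i \<epsilon> n \<Longrightarrow> j \<epsilon> n \<Longrightarrow> r i j \<or> i = j \<or> r j i"
    and s: "s \<sqsubseteq> n" "s \<noteq> \<emptyset>"
  shows "\<exists>m. m \<epsilon> s \<and> (\<forall>j. j \<epsilon> s \<longrightarrow> j = m \<or> r j m)"
proof -
  note [dfn] = definable_comp2[OF r]
  have "k \<sqsubseteq> n \<longrightarrow> (\<forall>s. s \<sqsubseteq> k \<longrightarrow> s \<noteq> \<emptyset> \<longrightarrow> (\<exists>m. m \<epsilon> s \<and> (\<forall>j. j \<epsilon> s \<longrightarrow> j = m \<or> r j m)))"
    if "k \<epsilon> om" for k
  proof (rule om_induct[OF _ that])
    show "\<emptyset> \<sqsubseteq> n \<longrightarrow> (\<forall>s. s \<sqsubseteq> \<emptyset> \<longrightarrow> s \<noteq> \<emptyset> \<longrightarrow> (\<exists>m. m \<epsilon> s \<and> (\<forall>j. j \<epsilon> s \<longrightarrow> j = m \<or> r j m)))"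
      unfolding subset_of_def eq_emp_iff by auto
    fix k assume k: "k \<epsilon> om"
      and IH: "k \<sqsubseteq> n \<longrightarrow> (\<forall>s. s \<sqsubseteq> k \<longrightarrow> s \<noteq> \<emptyset> \<longrightarrow> (\<exists>m. m \<epsilon> s \<and> (\<forall>j. j \<epsilon> s \<longrightarrow> j = m \<or> r j m)))"
    show "suc k \<sqsubseteq> n \<longrightarrow> (\<forall>s. s \<sqsubseteq> suc k \<longrightarrow> s \<noteq> \<emptyset> \<longrightarrow> (\<exists>m. m \<epsilon> s \<and> (\<forall>j. j \<epsilon> s \<longrightarrow> j = m \<or> r j m)))"
    proof (intro allI impI)
      fix s assume kn: "suc k \<sqsubseteq> n" and s: "s \<sqsubseteq> suc k" "s \<noteq> \<emptyset>"
      have k_n: "k \<sqsubseteq> n" "k \<epsilon> n" using kn unfolding subset_of_def by auto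
      have in_s: "j \<epsilon> s \<Longrightarrow> j \<epsilon> k \<or> j = k" for j using s(1) unfolding subset_of_def by auto
      show "\<exists>m. m \<epsilon> s \<and> (\<forall>j. j \<epsilon> s \<longrightarrow> j = m \<or> r j m)"
      proof (cases "s \<sqinter> k = \<emptyset>")
        case True
        then have "j = k" if "j \<epsilon> s" for j using in_s[OF that] that mem_int eq_emp_iff by metis
        then show ?thesis using s(2) eq_emp_iff by metis
      next
        case False
        have "s \<sqinter> k \<sqsubseteq> k" by (auto intro: subI)
        then obtain m where m: "m \<epsilon> s \<sqinter> k" "\<And>j. j \<epsilon> s \<sqinter> k \<Longrightarrow> j = m \<or> r j m"
          using IH k_n(1) False by blast
        have mn: "m \<epsilon> n" using m(1) k_n(1) unfolding subset_of_def by auto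
        show ?thesis
        proof (cases "k \<epsilon> s \<and> r m k")
          case True
          have "j = k \<or> r j k" if "j \<epsilon> s" for j
            using in_s[OF that] m(2)[of j] that True trans[of j m k] mn k_n unfolding subset_of_def by auto
          then show ?thesis using True by blast
        next
          case False
          have "j = m \<or> r j m" if "j \<epsilon> s" for j
            using in_s[OF that] m(2)[of j] that False total[of k m] mn k_n by auto
          then show ?thesis using m(1) by auto
        qed
      qed
    qed
  qed (intro dfn)
  then show ?thesis using n s by auto
qed

end

section \<open>Finite iterations of the measure along a linear order\<close>

context zfc_measure begin

text \<open>One set that contains every partial function from numbers to \<open>K\<close>.
  Colourings and prescriptions are total on it, which makes them elements of function spaces that
  choice can handle.\<close>

definition PF :: 'a where "PF = pow (om \<otimes> K)"

definition obeys :: "'a \<Rightarrow> 'a \<Rightarrow> 'a \<Rightarrow> 'a \<Rightarrow> bool" where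
  "obeys H f d l \<longleftrightarrow> (\<forall>i. i \<epsilon> d \<longrightarrow> f \<cdot> i \<epsilon> H \<cdot> (f \<restriction> sep d (\<lambda>j. \<langle>j, i\<rangle> \<epsilon> l)))"

lemma definable_obeys [dfn]:
  "dterm t \<Longrightarrow> dterm u \<Longrightarrow> dterm v \<Longrightarrow> dterm w \<Longrightarrow> definable (\<lambda>e. obeys (t e) (u e) (v e) (w e))"
  by (rule definable_comp4) (unfold obeys_def, intro dfn)

lemma mem_below: "j \<epsilon> sep d (\<lambda>j. \<langle>j, i\<rangle> \<epsilon> l) \<longleftrightarrow> j \<epsilon> d \<and> \<langle>j, i\<rangle> \<epsilon> l"
  by (rule mem_sep) (intro dfn)

lemma maps_PF: "maps f d K \<Longrightarrow> d \<sqsubseteq> om \<Longrightarrow> f \<epsilon> PF"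
  unfolding PF_def mem_pow by (rule subI) (auto simp: maps_def mem_func_iff subset_of_def)

text \<open>Being decided by one colour on all \<open>f\<close> obeying some \<open>H\<close> plays the role of the product
  measure \<open>U\<^sup>n\<close>: \<open>H\<close> prescribes a measure one set for each value, given the smaller ones.\<close>

definition homogeneous :: "'a \<Rightarrow> 'a \<Rightarrow> 'a \<Rightarrow> bool" where
  "homogeneous S l d \<longleftrightarrow> (\<forall>c. maps c PF S \<longrightarrow> (\<exists>u H. u \<epsilon> S \<and> maps H PF U \<and>
     (\<forall>f. maps f d K \<longrightarrow> obeys H f d l \<longrightarrow> c \<cdot> f = u)))"

lemma homogeneous_empty: "homogeneous S l \<emptyset>"
  unfolding homogeneous_def
proof (intro allI impI)
  fix c assume c: "maps c PF S"
  have "\<emptyset> \<epsilon> PF" unfolding PF_def by (auto intro: subI)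
  then have "c \<cdot> \<emptyset> \<epsilon> S" using c unfolding maps_def by blast
  moreover have "maps (lam PF (\<lambda>_. K)) PF U" by (rule maps_lam) (intro dfn, rule U_top)
  ultimately show "\<exists>u H. u \<epsilon> S \<and> maps H PF U \<and> (\<forall>f. maps f \<emptyset> K \<longrightarrow> obeys H f \<emptyset> l \<longrightarrow> c \<cdot> f = u)"
    unfolding maps_def func_empty_iff by blast
qed

text \<open>The Fubini step for a new top element \<open>i\<close>. Given a history
  \<open>h\<close>, one colour is taken at almost all values for \<open>i\<close>; call it
  \<open>c' \<cdot> h\<close>. Homogeneity for this colouring of the functions on \<open>d\<close>
  gives a prescription, which is intersected with the sets where that colour is attained.\<close>

lemma homogeneous_adj:
  assumes S: "cnt S" and d: "adj d i \<sqsubseteq> om" "\<not> i \<epsilon> d" and hom: "homogeneous S l d"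
    and l: "\<not> \<langle>i, i\<rangle> \<epsilon> l" "\<And>j. j \<epsilon> d \<Longrightarrow> \<langle>j, i\<rangle> \<epsilon> l" "\<And>j. j \<epsilon> d \<Longrightarrow> \<not> \<langle>i, j\<rangle> \<epsilon> l"
  shows "homogeneous S l (adj d i)"
  unfolding homogeneous_def
proof (intro allI impI)
  fix c assume c: "maps c PF S"
  let ?B = "\<lambda>h u. sep K (\<lambda>x. c \<cdot> adj h \<langle>i, x\<rangle> = u)"
  have mB: "x \<epsilon> ?B h u \<longleftrightarrow> x \<epsilon> K \<and> c \<cdot> adj h \<langle>i, x\<rangle> = u" for x h u by (rule mem_sep) (intro dfn)
  have "\<exists>u. u \<epsilon> S \<and> ?B h u \<epsilon> U" if h: "h \<epsilon> PF" for h
  proof (rule U_pigeonhole[OF _ S])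
    show "dterm (\<lambda>e. c \<cdot> adj h \<langle>i, e 0\<rangle>)" by (intro dfn)
    fix x assume "x \<epsilon> K"
    then have "adj h \<langle>i, x\<rangle> \<epsilon> PF" using h d(1) unfolding PF_def by (auto simp: subset_of_def)
    then show "c \<cdot> adj h \<langle>i, x\<rangle> \<epsilon> S" using c unfolding maps_def by blast
  qed
  moreover have "definable (\<lambda>e. ?B (e 0) (e 1) \<epsilon> U)" by (intro dfn)
  ultimately obtain c' where c': "maps c' PF S" "\<And>h. h \<epsilon> PF \<Longrightarrow> ?B h (c' \<cdot> h) \<epsilon> U"
    using set_choice[of "\<lambda>h u. ?B h u \<epsilon> U" PF S] by blast
  obtain u H where u: "u \<epsilon> S" and H: "maps H PF U"
    and mono: "\<And>f. maps f d K \<Longrightarrow> obeys H f d l \<Longrightarrow> c' \<cdot> f = u"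
    using hom c'(1) unfolding homogeneous_def by blast
  have dH: "dterm (\<lambda>e. H \<cdot> e 0 \<sqinter> ?B (e 0) (c' \<cdot> e 0))" by (intro dfn)
  let ?H = "lam PF (\<lambda>h. H \<cdot> h \<sqinter> ?B h (c' \<cdot> h))"
  have "maps ?H PF U" by (rule maps_lam[OF dH]) (use H c' in \<open>auto simp: maps_def intro: U_int\<close>)
  moreover have "c \<cdot> f = u" if f: "maps f (adj d i) K" "obeys ?H f (adj d i) l" for f
  proof -
    have sub: "d \<sqsubseteq> adj d i" by (auto intro: subI)
    have fd: "maps (f \<restriction> d) d K" by (rule maps_res[OF f(1) sub])
    have d_om: "d \<sqsubseteq> om" using d(1) sub sub_trans by blast
    \<comment> \<open>As \<open>i\<close> is on top, its history is all of
      \<open>f \<restriction> d\<close>, and the histories of the other elements are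
      unchanged.\<close>
    have below_i: "sep (adj d i) (\<lambda>j. \<langle>j, i\<rangle> \<epsilon> l) = d"
      by (rule ext) (use l in \<open>auto simp: mem_below\<close>)
    have below: "sep (adj d i) (\<lambda>j. \<langle>j, k\<rangle> \<epsilon> l) = sep d (\<lambda>j. \<langle>j, k\<rangle> \<epsilon> l)" if "k \<epsilon> d" for k
      by (rule ext) (use l that in \<open>auto simp: mem_below\<close>)
    have inH: "f \<cdot> k \<epsilon> H \<cdot> h \<sqinter> ?B h (c' \<cdot> h)"
      if "k \<epsilon> adj d i" "h = f \<restriction> sep (adj d i) (\<lambda>j. \<langle>j, k\<rangle> \<epsilon> l)" for k h
    proof -
      have s: "sep (adj d i) (\<lambda>j. \<langle>j, k\<rangle> \<epsilon> l) \<sqsubseteq> adj d i" by (rule subI) (simp add: mem_below)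
      have "h \<epsilon> PF" unfolding that(2) by (rule maps_PF[OF maps_res[OF f(1) s] sub_trans[OF s d(1)]])
      from app_lam[OF dH this] have "?H \<cdot> h = H \<cdot> h \<sqinter> ?B h (c' \<cdot> h)" .
      moreover have "f \<cdot> k \<epsilon> ?H \<cdot> h" using f(2) that unfolding obeys_def by blast
      ultimately show ?thesis by simp
    qed
    have "obeys H (f \<restriction> d) d l" unfolding obeys_def
    proof (intro allI impI)
      fix k assume k: "k \<epsilon> d"
      have "f \<restriction> d \<restriction> sep d (\<lambda>j. \<langle>j, k\<rangle> \<epsilon> l) = f \<restriction> sep (adj d i) (\<lambda>j. \<langle>j, k\<rangle> \<epsilon> l)"
        unfolding below[OF k] by (rule res_res) (auto intro: subI simp: mem_below)
      then show "f \<restriction> d \<cdot> k \<epsilon> H \<cdot> (f \<restriction> d \<restriction> sep d (\<lambda>j. \<langle>j, k\<rangle> \<epsilon> l))"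
        using inH[OF _ refl, of k] k by simp
    qed
    then have "c' \<cdot> (f \<restriction> d) = u" using mono fd by blast
    moreover have "f \<cdot> i \<epsilon> ?B (f \<restriction> d) (c' \<cdot> (f \<restriction> d))"
      using inH[OF _ refl, of i] unfolding below_i by simp
    moreover have "f = adj (f \<restriction> d) \<langle>i, f \<cdot> i\<rangle>"
    proof (rule func_eqI)
      show "func f (adj d i)" using f(1) unfolding maps_def by blast
      have r: "func (f \<restriction> d) d" using fd unfolding maps_def by blast
      show "func (adj (f \<restriction> d) \<langle>i, f \<cdot> i\<rangle>) (adj d i)" by (rule func_adj[OF r d(2)])
      show "f \<cdot> x = adj (f \<restriction> d) \<langle>i, f \<cdot> i\<rangle> \<cdot> x" if "x \<epsilon> adj d i" for x
        using that func_adj(2,3)[OF r d(2)] by auto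
    qed
    ultimately show "c \<cdot> f = u" unfolding mB by simp
  qed
  ultimately show "\<exists>u H. u \<epsilon> S \<and> maps H PF U \<and>
     (\<forall>f. maps f (adj d i) K \<longrightarrow> obeys H f (adj d i) l \<longrightarrow> c \<cdot> f = u)" using u by blast
qed

lemma homogeneous_nat:
  assumes S: "cnt S" and n: "n \<epsilon> om" and l: "lin_order l n"
  shows "homogeneous S l n"
proof -
  let ?d = "\<lambda>i. sep n (\<lambda>j. \<langle>j, i\<rangle> \<epsilon> l)"
  let ?r = "\<lambda>i j. \<langle>i, j\<rangle> \<epsilon> l"
  have r: "definable (\<lambda>e. ?r (e 0) (e 1))" and r': "definable (\<lambda>e. ?r (e 1) (e 0))" by (intro dfn)+
  have irr: "\<And>i. i \<epsilon> n \<Longrightarrow> \<not> ?r i i"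
    and trans: "\<And>i j k. i \<epsilon> n \<Longrightarrow> j \<epsilon> n \<Longrightarrow> k \<epsilon> n \<Longrightarrow> ?r i j \<Longrightarrow> ?r j k \<Longrightarrow> ?r i k"
    and total: "\<And>i j. i \<epsilon> n \<Longrightarrow> j \<epsilon> n \<Longrightarrow> ?r i j \<or> i = j \<or> ?r j i"
    using l unfolding lin_order_def by blast+
  \<comment> \<open>A nonempty downward closed set consists of its maximum and the predecessors of
    that maximum, so \<open>homogeneous_adj\<close> applies.\<close>
  have step: "homogeneous S l d"
    if d: "d \<sqsubseteq> n" "d \<noteq> \<emptyset>" "\<And>i j. i \<epsilon> d \<Longrightarrow> j \<epsilon> n \<Longrightarrow> ?r j i \<Longrightarrow> j \<epsilon> d"
      and hom: "\<And>m. m \<epsilon> d \<Longrightarrow> homogeneous S l (?d m)" for d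
  proof -
    obtain m where m: "m \<epsilon> d" "\<And>j. j \<epsilon> d \<Longrightarrow> j = m \<or> ?r j m"
      using finite_max[where r = ?r, OF r n _ _ d(1,2)] trans total by blast
    have mn: "m \<epsilon> n" using m(1) d(1) subD by blast
    have eq: "d = adj (?d m) m"
      by (rule ext) (use m d in \<open>auto simp: mem_below dest: subD\<close>)
    have "homogeneous S l (adj (?d m) m)"
    proof (rule homogeneous_adj[OF S _ _ hom[OF m(1)]])
      show "adj (?d m) m \<sqsubseteq> om" using d(1) om_sub[OF n] sub_trans unfolding eq[symmetric] by blast
    qed (use irr[OF mn] trans[of m _ m] mn in \<open>auto simp: mem_below\<close>)
    then show ?thesis using eq by simp
  qed
  \<comment> \<open>Linear orders that are finite in the model are wellfounded, which permits an
    induction along \<open>l\<close> itself.\<close>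
  have wf: "wf_on n ?r" unfolding wf_on_def
  proof (intro allI impI)
    fix s assume s: "s \<sqsubseteq> n" "s \<noteq> \<emptyset>"
    obtain m where m: "m \<epsilon> s" "\<And>j. j \<epsilon> s \<Longrightarrow> j = m \<or> ?r m j"
      using finite_max[where r = "\<lambda>i j. ?r j i", OF r' n _ _ s] trans total by blast
    then show "\<exists>m. m \<epsilon> s \<and> (\<forall>y. y \<epsilon> s \<longrightarrow> \<not> ?r y m)"
      using irr trans[of m _ m] s(1) by (metis subD)
  qed
  have "homogeneous S l (?d i)" if "i \<epsilon> n" for i
  proof (rule wf_on_induct[OF wf _ _ that])
    show "definable (\<lambda>e. homogeneous S l (?d (e 0)))" unfolding homogeneous_def by (intro dfn)
    fix i assume i: "i \<epsilon> n" and IH: "\<And>j. j \<epsilon> n \<Longrightarrow> ?r j i \<Longrightarrow> homogeneous S l (?d j)"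
    show "homogeneous S l (?d i)"
    proof (cases "?d i = \<emptyset>")
      case False
      show ?thesis
      proof (rule step[OF _ False])
        show "?d i \<sqsubseteq> n" by (rule subI) (simp add: mem_below)
        show "j \<epsilon> ?d i" if "k \<epsilon> ?d i" "j \<epsilon> n" "?r j k" for j k
          using that trans[of j k i] i by (simp add: mem_below)
        show "homogeneous S l (?d m)" if "m \<epsilon> ?d i" for m
          using that IH by (simp add: mem_below)
      qed
    qed (simp add: homogeneous_empty)
  qed
  then show ?thesis using step[of n] homogeneous_empty by (cases "n = \<emptyset>") auto
qed

end

section \<open>Open games\<close>

context zfc begin

text \<open>A state game: at \<open>q\<close> one player chooses \<open>u\<close> with \<open>ok q u\<close>, then the opponent \<open>q'\<close> with
  \<open>mv q u q'\<close>; infinite plays are won by the opponent. \<open>W\<close> is the least fixed point of the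
  one-step winning operator; the stages leading to it form the least family closed under this
  operator and unions, which replaces an ordinal rank.\<close>

lemma open_game:
  assumes ok: "definable (\<lambda>e. ok (e 0) (e 1))" and mv: "definable (\<lambda>e. mv (e 0) (e 1) (e 2))"
  shows "\<exists>W \<tau>. W \<sqsubseteq> S \<and>
    (\<forall>q u. q \<epsilon> S \<longrightarrow> \<not> q \<epsilon> W \<longrightarrow> u \<epsilon> M \<longrightarrow> ok q u \<longrightarrow> (\<exists>q'. q' \<epsilon> S \<and> \<not> q' \<epsilon> W \<and> mv q u q')) \<and>
    maps \<tau> W M \<and> (\<forall>q. q \<epsilon> W \<longrightarrow> ok q (\<tau> \<cdot> q)) \<and>
    (\<forall>q q'. q \<epsilon> W \<longrightarrow> q' \<epsilon> S \<longrightarrow> mv q (\<tau> \<cdot> q) q' \<longrightarrow> q' \<epsilon> W) \<and>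
    (\<forall>X. X \<sqsubseteq> W \<longrightarrow> X \<noteq> \<emptyset> \<longrightarrow> (\<exists>q. q \<epsilon> X \<and> (\<forall>q'. q' \<epsilon> X \<longrightarrow> \<not> mv q (\<tau> \<cdot> q) q')))"
proof -
  note [dfn] = definable_comp2[OF ok] definable_comp3[OF mv]
  define \<Phi> where "\<Phi> X = sep S (\<lambda>q. q \<epsilon> X \<or> (\<exists>u. u \<epsilon> M \<and> ok q u \<and> (\<forall>q'. q' \<epsilon> S \<longrightarrow> mv q u q' \<longrightarrow> q' \<epsilon> X)))" for X
  have m\<Phi>: "q \<epsilon> \<Phi> X \<longleftrightarrow> q \<epsilon> S \<and> (q \<epsilon> X \<or> (\<exists>u. u \<epsilon> M \<and> ok q u \<and> (\<forall>q'. q' \<epsilon> S \<longrightarrow> mv q u q' \<longrightarrow> q' \<epsilon> X)))" for q X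
    unfolding \<Phi>_def by (rule mem_sep) (intro dfn)
  have d\<Phi>: "dterm (\<lambda>e. \<Phi> (e 0))" unfolding \<Phi>_def by (intro dfn)
  note [dfn] = dterm_comp1[OF d\<Phi>]
  have \<Phi>_mono: "\<Phi> X \<sqsubseteq> \<Phi> Y" if "X \<sqsubseteq> Y" for X Y
    using that unfolding subset_of_def m\<Phi> by blast
  \<comment> \<open>Unions of all subfamilies are included, the empty one too, so every closed
    family starts with \<open>\<emptyset>\<close>.\<close>
  define clos where "clos F \<longleftrightarrow> (\<forall>X. X \<epsilon> F \<longrightarrow> \<Phi> X \<epsilon> F) \<and> (\<forall>G. G \<sqsubseteq> F \<longrightarrow> uni G \<epsilon> F)" for F
  define CC where "CC = sep (pow S) (\<lambda>X. \<forall>F. clos F \<longrightarrow> X \<epsilon> F)"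
  have dclos: "definable (\<lambda>e. clos (e 0))" unfolding clos_def by (intro dfn)
  note [dfn] = definable_comp1[OF dclos]
  have "clos (pow S)" unfolding clos_def by (auto simp: m\<Phi> subset_of_def)
  have mCC: "X \<epsilon> CC \<longleftrightarrow> (\<forall>F. clos F \<longrightarrow> X \<epsilon> F)" for X
    unfolding CC_def using \<open>clos (pow S)\<close> by (subst mem_sep) (intro dfn, auto)
  have CC_\<Phi>: "\<Phi> X \<epsilon> CC" if "X \<epsilon> CC" for X using that unfolding mCC clos_def by blast
  have CC_uni: "uni G \<epsilon> CC" if "G \<sqsubseteq> CC" for G
    using that unfolding mCC subset_of_def clos_def by blast
  have CC_S: "X \<sqsubseteq> S" if "X \<epsilon> CC" for X using that \<open>clos (pow S)\<close> unfolding mCC by auto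
  have CC_\<Phi>_ge: "X \<sqsubseteq> \<Phi> X" if "X \<epsilon> CC" for X using CC_S[OF that] unfolding subset_of_def m\<Phi> by blast
  have CC_induct: "P X" if P: "definable (\<lambda>e. P (e 0))" and X: "X \<epsilon> CC"
    and 1: "\<And>X. X \<epsilon> CC \<Longrightarrow> P X \<Longrightarrow> P (\<Phi> X)"
    and 2: "\<And>G. G \<sqsubseteq> CC \<Longrightarrow> (\<And>X. X \<epsilon> G \<Longrightarrow> P X) \<Longrightarrow> P (uni G)" for P X
  proof -
    have m: "X \<epsilon> sep CC P \<longleftrightarrow> X \<epsilon> CC \<and> P X" for X by (rule mem_sep[OF P])
    have "clos (sep CC P)" unfolding clos_def m
    proof (intro conjI allI impI)
      show "\<Phi> X \<epsilon> CC" "P (\<Phi> X)" if "X \<epsilon> CC \<and> P X" for X using that CC_\<Phi> 1 by blast+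
      show "uni G \<epsilon> CC" "P (uni G)" if "G \<sqsubseteq> sep CC P" for G
        using that CC_uni[of G] 2[of G] unfolding subset_of_def m by blast+
    qed
    then show ?thesis using X mCC m by blast
  qed
  \<comment> \<open>Comparability of the stages in the strong form that none lies strictly between
    \<open>C\<close> and \<open>\<Phi> C\<close>; a double induction in the manner of Zermelo's
    second proof of the wellordering theorem.\<close>
  have lin: "\<forall>D. D \<epsilon> CC \<longrightarrow> D \<sqsubseteq> C \<or> \<Phi> C \<sqsubseteq> D" if "C \<epsilon> CC" for C
  proof (rule CC_induct[OF _ that])
    show "definable (\<lambda>e. \<forall>D. D \<epsilon> CC \<longrightarrow> D \<sqsubseteq> e 0 \<or> \<Phi> (e 0) \<sqsubseteq> D)" by (intro dfn)
    fix C assume C: "C \<epsilon> CC" and IH: "\<forall>D. D \<epsilon> CC \<longrightarrow> D \<sqsubseteq> C \<or> \<Phi> C \<sqsubseteq> D"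
    have "D \<sqsubseteq> \<Phi> C \<or> \<Phi> (\<Phi> C) \<sqsubseteq> D" if "D \<epsilon> CC" for D
    proof (rule CC_induct[OF _ that])
      show "definable (\<lambda>e. e 0 \<sqsubseteq> \<Phi> C \<or> \<Phi> (\<Phi> C) \<sqsubseteq> e 0)" by (intro dfn)
      fix D assume D: "D \<epsilon> CC" "D \<sqsubseteq> \<Phi> C \<or> \<Phi> (\<Phi> C) \<sqsubseteq> D"
      show "\<Phi> D \<sqsubseteq> \<Phi> C \<or> \<Phi> (\<Phi> C) \<sqsubseteq> \<Phi> D"
      proof (cases "\<Phi> (\<Phi> C) \<sqsubseteq> D")
        case True
        then show ?thesis using CC_\<Phi>_ge[OF D(1)] sub_trans by blast
      next
        case False
        then have "D \<sqsubseteq> \<Phi> C" using D by blast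
        moreover have "D \<sqsubseteq> C \<or> \<Phi> C \<sqsubseteq> D" using IH D by blast
        ultimately show ?thesis using \<Phi>_mono by blast
      qed
    next
      fix G assume G: "G \<sqsubseteq> CC" "\<And>D. D \<epsilon> G \<Longrightarrow> D \<sqsubseteq> \<Phi> C \<or> \<Phi> (\<Phi> C) \<sqsubseteq> D"
      show "uni G \<sqsubseteq> \<Phi> C \<or> \<Phi> (\<Phi> C) \<sqsubseteq> uni G"
        using G(2) unfolding subset_of_def mem_uni by blast
    qed
    then show "\<forall>D. D \<epsilon> CC \<longrightarrow> D \<sqsubseteq> \<Phi> C \<or> \<Phi> (\<Phi> C) \<sqsubseteq> D" by blast
  next
    fix H assume H: "H \<sqsubseteq> CC" and IH: "\<And>C. C \<epsilon> H \<Longrightarrow> \<forall>D. D \<epsilon> CC \<longrightarrow> D \<sqsubseteq> C \<or> \<Phi> C \<sqsubseteq> D"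
    have H_CC: "uni H \<epsilon> CC" by (rule CC_uni[OF H])
    have dich: "(\<exists>C. C \<epsilon> H \<and> D \<sqsubseteq> C) \<or> uni H \<sqsubseteq> D" if "D \<epsilon> CC" for D
    proof (rule disjCI)
      assume no: "\<not> uni H \<sqsubseteq> D"
      then obtain C x where C: "C \<epsilon> H" "x \<epsilon> C" "\<not> x \<epsilon> D" unfolding subset_of_def mem_uni by blast
      have "C \<sqsubseteq> \<Phi> C" using CC_\<Phi>_ge C(1) H subD by blast
      then have "D \<sqsubseteq> C" using IH[OF C(1)] that C(2,3) subD by blast
      then show "\<exists>C. C \<epsilon> H \<and> D \<sqsubseteq> C" using C(1) by blast
    qed
    have "D \<sqsubseteq> uni H \<or> \<Phi> (uni H) \<sqsubseteq> D" if "D \<epsilon> CC" for D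
    proof (rule CC_induct[OF _ that])
      show "definable (\<lambda>e. e 0 \<sqsubseteq> uni H \<or> \<Phi> (uni H) \<sqsubseteq> e 0)" by (intro dfn)
      fix D assume D: "D \<epsilon> CC" "D \<sqsubseteq> uni H \<or> \<Phi> (uni H) \<sqsubseteq> D"
      show "\<Phi> D \<sqsubseteq> uni H \<or> \<Phi> (uni H) \<sqsubseteq> \<Phi> D"
      proof (cases "\<Phi> (uni H) \<sqsubseteq> D \<or> uni H \<sqsubseteq> D")
        case True
        then show ?thesis using CC_\<Phi>_ge[OF D(1)] \<Phi>_mono sub_trans by blast
      next
        case False
        then obtain C where C: "C \<epsilon> H" "D \<sqsubseteq> C" using dich[OF D(1)] by blast
        have CH: "C \<sqsubseteq> uni H" using C(1) by (auto intro!: subI)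
        have C_CC: "C \<epsilon> CC" using C(1) H subD by blast
        show ?thesis
        proof (cases "\<Phi> C \<sqsubseteq> uni H")
          case True
          then show ?thesis using \<Phi>_mono[OF C(2)] sub_trans by blast
        next
          case False
          then have "uni H \<sqsubseteq> C" using IH[OF C(1)] H_CC by blast
          then have "uni H = C" using CH sub_antisym by blast
          moreover have "\<Phi> D \<sqsubseteq> C \<or> \<Phi> C \<sqsubseteq> \<Phi> D" using IH[OF C(1)] CC_\<Phi>[OF D(1)] by blast
          ultimately show ?thesis by simp
        qed
      qed
    next
      fix G assume G: "G \<sqsubseteq> CC" "\<And>D. D \<epsilon> G \<Longrightarrow> D \<sqsubseteq> uni H \<or> \<Phi> (uni H) \<sqsubseteq> D"
      show "uni G \<sqsubseteq> uni H \<or> \<Phi> (uni H) \<sqsubseteq> uni G"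
        using G(2) unfolding subset_of_def mem_uni by blast
    qed
    then show "\<forall>D. D \<epsilon> CC \<longrightarrow> D \<sqsubseteq> uni H \<or> \<Phi> (uni H) \<sqsubseteq> D" by blast
  qed
  let ?W = "uni CC"
  have W_CC: "?W \<epsilon> CC" by (rule CC_uni) simp
  have W_fix: "\<Phi> ?W \<sqsubseteq> ?W" using CC_\<Phi>[OF W_CC] by (auto intro!: subI)
  \<comment> \<open>The last stage before \<open>q\<close> enters; it plays the part of the
    predecessor of the rank of \<open>q\<close>.\<close>
  define cq where "cq q = uni (sep CC (\<lambda>X. \<not> q \<epsilon> X))" for q
  have dcq: "dterm (\<lambda>e. cq (e 0))" unfolding cq_def by (intro dfn)
  note [dfn] = dterm_comp1[OF dcq]
  have mcq: "x \<epsilon> cq q \<longleftrightarrow> (\<exists>X. X \<epsilon> CC \<and> \<not> q \<epsilon> X \<and> x \<epsilon> X)" for x q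
    unfolding cq_def mem_uni by (subst mem_sep) (intro dfn, blast)
  have cq_CC: "cq q \<epsilon> CC" for q unfolding cq_def
    by (rule CC_uni, rule subI) (subst (asm) mem_sep; (intro dfn)?; blast)
  have cq_\<Phi>: "q \<epsilon> \<Phi> (cq q)" if "q \<epsilon> ?W" for q
  proof (rule ccontr)
    assume "\<not> q \<epsilon> \<Phi> (cq q)"
    \<comment> \<open>Otherwise \<open>\<Phi> (cq q)\<close> is one more stage without
      \<open>q\<close>, hence included in \<open>cq q\<close>; then \<open>cq q\<close> absorbs all
      stages, even those containing \<open>q\<close>.\<close>
    then have closed: "\<Phi> (cq q) \<sqsubseteq> cq q" using CC_\<Phi>[OF cq_CC] mcq by (blast intro: subI)
    have "X \<sqsubseteq> cq q" if "X \<epsilon> CC" for X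
    proof (rule CC_induct[OF _ that])
      show "definable (\<lambda>e. e 0 \<sqsubseteq> cq q)" by (intro dfn)
      show "\<Phi> X \<sqsubseteq> cq q" if "X \<sqsubseteq> cq q" for X using \<Phi>_mono[OF that] closed sub_trans by blast
      show "uni G \<sqsubseteq> cq q" if "\<And>X. X \<epsilon> G \<Longrightarrow> X \<sqsubseteq> cq q" for G
        using that unfolding subset_of_def mem_uni by blast
    qed
    then have "q \<epsilon> cq q" using that unfolding subset_of_def mem_uni by blast
    then show False unfolding mcq by blast
  qed
  \<comment> \<open>The move is chosen so that all replies fall into \<open>cq q\<close>: each round
    lowers the stage.\<close>
  have "definable (\<lambda>e. ok (e 0) (e 1) \<and> (\<forall>q'. q' \<epsilon> S \<longrightarrow> mv (e 0) (e 1) q' \<longrightarrow> q' \<epsilon> cq (e 0)))" by (intro dfn)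
  from set_choice[where Q = "\<lambda>q u. ok q u \<and> (\<forall>q'. q' \<epsilon> S \<longrightarrow> mv q u q' \<longrightarrow> q' \<epsilon> cq q)" and a = ?W and b = M, OF this]
  obtain \<tau> where \<tau>: "maps \<tau> ?W M"
    "\<And>q. q \<epsilon> ?W \<Longrightarrow> ok q (\<tau> \<cdot> q) \<and> (\<forall>q'. q' \<epsilon> S \<longrightarrow> mv q (\<tau> \<cdot> q) q' \<longrightarrow> q' \<epsilon> cq q)"
    using cq_\<Phi> unfolding m\<Phi> using mcq by blast
  have "\<exists>q'. q' \<epsilon> S \<and> \<not> q' \<epsilon> ?W \<and> mv q u q'" if "q \<epsilon> S" "\<not> q \<epsilon> ?W" "u \<epsilon> M" "ok q u" for q u
    using that W_fix m\<Phi> subD by blast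
  moreover have "q' \<epsilon> ?W" if "q \<epsilon> ?W" "q' \<epsilon> S" "mv q (\<tau> \<cdot> q) q'" for q q'
    using \<tau>(2) that cq_CC by (metis mem_uni)
  moreover have "\<exists>q. q \<epsilon> X \<and> (\<forall>q'. q' \<epsilon> X \<longrightarrow> \<not> mv q (\<tau> \<cdot> q) q')" if X: "X \<sqsubseteq> ?W" "X \<noteq> \<emptyset>" for X
  proof (rule ccontr)
    assume neg: "\<not> ?thesis"
    have "\<forall>q. q \<epsilon> C \<longrightarrow> \<not> q \<epsilon> X" if "C \<epsilon> CC" for C
    proof (rule CC_induct[OF _ that])
      show "definable (\<lambda>e. \<forall>q. q \<epsilon> e 0 \<longrightarrow> \<not> q \<epsilon> X)" by (intro dfn)
      show "\<forall>q. q \<epsilon> uni G \<longrightarrow> \<not> q \<epsilon> X" if "\<And>C. C \<epsilon> G \<Longrightarrow> \<forall>q. q \<epsilon> C \<longrightarrow> \<not> q \<epsilon> X" for G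
        using that unfolding mem_uni by blast
      fix C assume C: "C \<epsilon> CC" "\<forall>q. q \<epsilon> C \<longrightarrow> \<not> q \<epsilon> X"
      show "\<forall>q. q \<epsilon> \<Phi> C \<longrightarrow> \<not> q \<epsilon> X"
      proof (intro allI impI notI)
        fix q assume q: "q \<epsilon> \<Phi> C" "q \<epsilon> X"
        then obtain q' where q': "q' \<epsilon> X" "mv q (\<tau> \<cdot> q) q'" using neg by blast
        then have "q' \<epsilon> cq q" using \<tau>(2) q(2) X(1) CC_S[OF W_CC] subD by metis
        then obtain D where D: "D \<epsilon> CC" "\<not> q \<epsilon> D" "q' \<epsilon> D" unfolding mcq by blast
        \<comment> \<open>The stage \<open>D\<close> misses \<open>q\<close>, so it cannot include
          \<open>\<Phi> C\<close>; comparability puts it inside \<open>C\<close>, which has no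
          elements in \<open>X\<close>.\<close>
        then show False using lin[OF C(1)] C(2) q(1) q'(1) subD by blast
      qed
    qed
    then show False using X unfolding subset_of_def mem_uni eq_emp_iff by blast
  qed
  ultimately show ?thesis using \<tau> CC_S[OF W_CC] by blast
qed

subsection \<open>Finite strings and reals\<close>

text \<open>Reals are subsets of \<open>om\<close>; the string \<open>\<langle>n, u\<rangle>\<close> with \<open>u \<sqsubseteq> n\<close> is an initial segment of length \<open>n\<close>.\<close>

definition str :: 'a where "str = sep (om \<otimes> finpow) (\<lambda>s. p2 s \<sqsubseteq> p1 s)"

lemma mem_str: "s \<epsilon> str \<longleftrightarrow> (\<exists>n u. n \<epsilon> om \<and> u \<sqsubseteq> n \<and> s = \<langle>n, u\<rangle>)"
  unfolding str_def by (subst mem_sep) (intro dfn, auto simp: mem_prod mem_finpow)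

lemma pair_str [simp]: "\<langle>n, u\<rangle> \<epsilon> str \<longleftrightarrow> n \<epsilon> om \<and> u \<sqsubseteq> n"
  unfolding mem_str by auto

lemma str_len: "s \<epsilon> str \<Longrightarrow> p1 s \<epsilon> om" and str_sub: "s \<epsilon> str \<Longrightarrow> p2 s \<sqsubseteq> p1 s"
  and str_eta: "s \<epsilon> str \<Longrightarrow> \<langle>p1 s, p2 s\<rangle> = s"
  unfolding mem_str by auto

lemma cnt_str: "cnt str"
  by (rule cnt_sub[OF cnt_prod[OF cnt_om cnt_finpow]])
     (rule subI, unfold mem_str mem_prod mem_finpow, blast)

definition sext :: "'a \<Rightarrow> 'a \<Rightarrow> bool" where
  "sext s t \<longleftrightarrow> p1 s \<sqsubseteq> p1 t \<and> (\<forall>m. m \<epsilon> p2 s \<longleftrightarrow> m \<epsilon> p2 t \<and> m \<epsilon> p1 s)"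

definition init :: "'a \<Rightarrow> 'a \<Rightarrow> bool" where
  "init a s \<longleftrightarrow> (\<forall>m. m \<epsilon> p2 s \<longleftrightarrow> m \<epsilon> a \<and> m \<epsilon> p1 s)"

lemma definable_sext [dfn]: "dterm t \<Longrightarrow> dterm u \<Longrightarrow> definable (\<lambda>e. sext (t e) (u e))"
  by (rule definable_comp2) (unfold sext_def, intro dfn)

lemma definable_init [dfn]: "dterm t \<Longrightarrow> dterm u \<Longrightarrow> definable (\<lambda>e. init (t e) (u e))"
  by (rule definable_comp2) (unfold init_def, intro dfn)

lemma sext_refl: "s \<epsilon> str \<Longrightarrow> sext s s"
  unfolding sext_def using str_sub[of s] by (auto simp: subset_of_def)

lemma sext_trans: "sext s t \<Longrightarrow> sext t u \<Longrightarrow> sext s u"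
  unfolding sext_def subset_of_def by blast

lemma init_sext: "init a t \<Longrightarrow> sext s t \<Longrightarrow> init a s"
  unfolding sext_def init_def subset_of_def by blast

lemma sext_chain:
  assumes G: "dterm (\<lambda>e. G (e 0))" and str: "\<And>n. n \<epsilon> om \<Longrightarrow> G n \<epsilon> str"
    and ext: "\<And>n. n \<epsilon> om \<Longrightarrow> sext (G n) (G (suc n))"
  shows "\<exists>a. a \<sqsubseteq> om \<and> (\<forall>n. n \<epsilon> om \<longrightarrow> init a (G n))"
proof -
  note [dfn] = dterm_comp1[OF G]
  have mono: "i \<epsilon> suc j \<longrightarrow> sext (G i) (G j)" if "i \<epsilon> om" "j \<epsilon> om" for i j
  proof (rule om_induct[OF _ that(2)])
    show "i \<epsilon> suc \<emptyset> \<longrightarrow> sext (G i) (G \<emptyset>)" using sext_refl[OF str] that by auto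
    show "i \<epsilon> suc (suc j) \<longrightarrow> sext (G i) (G (suc j))" if "j \<epsilon> om" "i \<epsilon> suc j \<longrightarrow> sext (G i) (G j)" for j
      using that ext[OF that(1)] sext_refl[OF str] sext_trans \<open>i \<epsilon> om\<close> by auto
  qed (intro dfn)
  have d: "dterm (\<lambda>e. p2 (G (e 0)))" by (intro dfn)
  let ?a = "uni (repl om (\<lambda>n. p2 (G n)))"
  have m: "x \<epsilon> ?a \<longleftrightarrow> (\<exists>n. n \<epsilon> om \<and> x \<epsilon> p2 (G n))" for x by (auto simp: mem_repl[OF d])
  have "?a \<sqsubseteq> om" using str_sub[OF str] str_len[OF str] om_mem unfolding subset_of_def m by blast
  moreover have "init ?a (G n)" if n: "n \<epsilon> om" for n
  proof -
    have "x \<epsilon> p2 (G n)" if j: "j \<epsilon> om" and x: "x \<epsilon> p2 (G j)" "x \<epsilon> p1 (G n)" for x j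
    proof -
      consider "n \<epsilon> suc j" | "j \<epsilon> suc n" using om_linear[OF n j] by auto
      then show ?thesis
      proof cases
        case 1
        then have "sext (G n) (G j)" using mono[OF n j] by blast
        then show ?thesis using x unfolding sext_def by blast
      next
        case 2
        then have "sext (G j) (G n)" using mono[OF j n] by blast
        then show ?thesis using x unfolding sext_def by blast
      qed
    qed
    then show ?thesis using n str_sub[OF str[OF n]] unfolding init_def m subset_of_def by blast
  qed
  ultimately show ?thesis by blast
qed

text \<open>The Rasiowa--Sikorski construction for countably many dense sets. The enumeration may
  leave \<open>R\<close>, and at such stages nothing is demanded.\<close>

lemma generic_real:
  assumes R: "cnt R" and D: "definable (\<lambda>e. D (e 0) (e 1))"
    and dense: "\<And>r b. r \<epsilon> R \<Longrightarrow> b \<epsilon> str \<Longrightarrow> \<exists>b'. b' \<epsilon> str \<and> sext b b' \<and> D r b'"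
  shows "\<exists>a. a \<sqsubseteq> om \<and> (\<forall>r. r \<epsilon> R \<longrightarrow> (\<exists>b. b \<epsilon> str \<and> init a b \<and> D r b))"
proof -
  note [dfn] = definable_comp2[OF D]
  obtain \<sigma> where \<sigma>: "\<And>r. r \<epsilon> R \<Longrightarrow> \<exists>n. n \<epsilon> om \<and> r = \<sigma> \<cdot> n" using R unfolding cnt_def by blast
  have "definable (\<lambda>e. sext (e 1) (e 2) \<and> (\<sigma> \<cdot> e 0 \<epsilon> R \<longrightarrow> D (\<sigma> \<cdot> e 0) (e 2)))" by (intro dfn)
  moreover have "\<langle>\<emptyset>, \<emptyset>\<rangle> \<epsilon> str" by simp
  moreover have "\<exists>w. w \<epsilon> str \<and> (sext v w \<and> (\<sigma> \<cdot> n \<epsilon> R \<longrightarrow> D (\<sigma> \<cdot> n) w))" if "v \<epsilon> str" for n v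
    using dense[OF _ that, of "\<sigma> \<cdot> n"] sext_refl[OF that] that by blast
  ultimately obtain g where g: "maps g om str"
    "\<And>n. n \<epsilon> om \<Longrightarrow> sext (g \<cdot> n) (g \<cdot> suc n) \<and> (\<sigma> \<cdot> n \<epsilon> R \<longrightarrow> D (\<sigma> \<cdot> n) (g \<cdot> suc n))"
    using om_choice[where Q = "\<lambda>n v w. sext v w \<and> (\<sigma> \<cdot> n \<epsilon> R \<longrightarrow> D (\<sigma> \<cdot> n) w)"] by blast
  have "dterm (\<lambda>e. g \<cdot> e 0)" by (intro dfn)
  from sext_chain[where G = "\<lambda>n. g \<cdot> n", OF this] obtain a where a: "a \<sqsubseteq> om" "\<And>n. n \<epsilon> om \<Longrightarrow> init a (g \<cdot> n)"
    using g unfolding maps_def by blast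
  have "\<exists>b. b \<epsilon> str \<and> init a b \<and> D r b" if r: "r \<epsilon> R" for r
  proof -
    obtain n where "n \<epsilon> om" "r = \<sigma> \<cdot> n" using \<sigma>[OF r] by blast
    then show ?thesis using g a(2) r unfolding maps_def by (intro exI[of _ "g \<cdot> suc n"]) auto
  qed
  then show ?thesis using a(1) by blast
qed

text \<open>Ensures that strings growing at every stage exhaust the real.\<close>

lemma increasing_ge:
  assumes H: "dterm (\<lambda>e. H (e 0))" "\<And>n. n \<epsilon> om \<Longrightarrow> H n \<epsilon> om" "\<And>n. n \<epsilon> om \<Longrightarrow> H n \<epsilon> H (suc n)" and n: "n \<epsilon> om"
  shows "n \<epsilon> suc (H n)"
proof (rule om_induct[OF _ n])
  show "definable (\<lambda>e. e 0 \<epsilon> suc (H (e 0)))" by (intro dfn dterm_comp1[OF H(1)])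
  show "\<emptyset> \<epsilon> suc (H \<emptyset>)" using om_zero_sub[OF H(2)[OF zero_om]] by auto
  fix n assume n: "n \<epsilon> om" "n \<epsilon> suc (H n)"
  have "n \<epsilon> H (suc n)" by (rule suc_mem_trans[OF n(2) H(3)[OF n(1)]]) (use H(2) n in simp)
  then show "suc n \<epsilon> suc (H (suc n))" by (rule om_suc_mem_iff[rotated]) (use H(2) n in simp)
qed

section \<open>Finite changes of reals and strings\<close>

definition flip :: "'a \<Rightarrow> 'a \<Rightarrow> 'a" where "flip n b = (b \<ominus> upr n n) \<squnion> (upr n n \<ominus> b)"

lemma dterm_flip [dfn]: "dterm t \<Longrightarrow> dterm u \<Longrightarrow> dterm (\<lambda>e. flip (t e) (u e))"
  unfolding flip_def by (intro dfn)

lemma mem_flip [simp]: "m \<epsilon> flip n b \<longleftrightarrow> m \<epsilon> b \<and> m \<noteq> n \<or> \<not> m \<epsilon> b \<and> m = n"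
  unfolding flip_def by auto

definition flips :: "'a \<Rightarrow> 'a \<Rightarrow> 'a" where "flips n s = \<langle>p1 s, flip n (p2 s)\<rangle>"

lemma dterm_flips [dfn]: "dterm t \<Longrightarrow> dterm u \<Longrightarrow> dterm (\<lambda>e. flips (t e) (u e))"
  unfolding flips_def by (intro dfn)

lemma flips_str: "s \<epsilon> str \<Longrightarrow> n \<epsilon> p1 s \<Longrightarrow> flips n s \<epsilon> str"
  unfolding flips_def using str_len[of s] str_sub[of s] by (auto simp: subset_of_def)

lemma flips_flips: "s \<epsilon> str \<Longrightarrow> flips n (flips n s) = s"
proof -
  have "flip n (flip n b) = b" for b by (rule ext) auto
  then show "s \<epsilon> str \<Longrightarrow> ?thesis" by (simp add: flips_def str_eta)
qed

lemma sext_flips: "sext s t \<Longrightarrow> n \<epsilon> p1 s \<Longrightarrow> sext (flips n s) (flips n t)"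
  unfolding sext_def flips_def by (auto simp: subset_of_def)

text \<open>\<open>var a v\<close> is the real \<open>a\<close> with its initial segment overwritten by the string \<open>v\<close>; these are
  the representatives of the class of \<open>a\<close> modulo finite changes.\<close>

definition var :: "'a \<Rightarrow> 'a \<Rightarrow> 'a" where "var a v = p2 v \<squnion> (a \<ominus> p1 v)"
definition vars :: "'a \<Rightarrow> 'a \<Rightarrow> 'a" where "vars b v = \<langle>p1 b, var (p2 b) v\<rangle>"

lemma dterm_var_string [dfn]: "dterm t \<Longrightarrow> dterm u \<Longrightarrow> dterm (\<lambda>e. var (t e) (u e))"
  unfolding var_def by (intro dfn)

lemma dterm_vars [dfn]: "dterm t \<Longrightarrow> dterm u \<Longrightarrow> dterm (\<lambda>e. vars (t e) (u e))"
  unfolding vars_def by (intro dfn)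

lemma mem_var [simp]: "m \<epsilon> var a v \<longleftrightarrow> m \<epsilon> p2 v \<or> m \<epsilon> a \<and> \<not> m \<epsilon> p1 v"
  unfolding var_def by auto

end

section \<open>A homogeneous game\<close>

text \<open>\<open>C_closed\<close> is closedness in the product topology, phrased by finite
  approximations. Projections of such relations along a wellfounded \<open>L\<close> are
  \<open>\<Sigma>\<^sup>1\<^sub>2\<close>, and wellfoundedness is the only clause that is not
  closed.\<close>

locale closed_game = zfc_measure +
  fixes C :: "'a \<Rightarrow> 'a \<Rightarrow> 'a \<Rightarrow> bool"
  assumes C_definable: "definable (\<lambda>e. C (e 0) (e 1) (e 2))"
    and C_dom: "C a y L \<Longrightarrow> a \<sqsubseteq> om \<and> maps y om om \<and> L \<sqsubseteq> om \<otimes> om \<and> lin_order L om"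
    and C_closed: "a \<sqsubseteq> om \<Longrightarrow> maps y om om \<Longrightarrow> L \<sqsubseteq> om \<otimes> om \<Longrightarrow>
      (\<And>k. k \<epsilon> om \<Longrightarrow> \<exists>a' y' L'. C a' y' L' \<and> a' \<sqinter> k = a \<sqinter> k \<and> y' \<restriction> k = y \<restriction> k \<and>
        (\<forall>i j. i \<epsilon> k \<longrightarrow> j \<epsilon> k \<longrightarrow> (\<langle>i, j\<rangle> \<epsilon> L' \<longleftrightarrow> \<langle>i, j\<rangle> \<epsilon> L))) \<Longrightarrow> C a y L"
begin

lemmas [dfn] = definable_comp3[OF C_definable]

definition projection :: "'a \<Rightarrow> bool" where
  "projection a \<longleftrightarrow> (\<exists>y L. C a y L \<and> wf_on om (\<lambda>i j. \<langle>i, j\<rangle> \<epsilon> L))"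

definition sq :: "'a \<Rightarrow> 'a" where "sq q = p1 q"
definition yq :: "'a \<Rightarrow> 'a" where "yq q = p1 (p2 q)"
definition fq :: "'a \<Rightarrow> 'a" where "fq q = p2 (p2 q)"

lemma dterm_sq [dfn]: "dterm t \<Longrightarrow> dterm (\<lambda>e. sq (t e))" unfolding sq_def by (intro dfn)
lemma dterm_yq [dfn]: "dterm t \<Longrightarrow> dterm (\<lambda>e. yq (t e))" unfolding yq_def by (intro dfn)
lemma dterm_fq [dfn]: "dterm t \<Longrightarrow> dterm (\<lambda>e. fq (t e))" unfolding fq_def by (intro dfn)

lemma sq_simp [simp]: "sq \<langle>s, \<langle>y, f\<rangle>\<rangle> = s" and yq_simp [simp]: "yq \<langle>s, \<langle>y, f\<rangle>\<rangle> = y"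
  and fq_simp [simp]: "fq \<langle>s, \<langle>y, f\<rangle>\<rangle> = f"
  unfolding sq_def yq_def fq_def by simp_all

text \<open>The player who builds a real with a witness \<open>y\<close> also plays an embedding \<open>f\<close> of \<open>L\<close> into the
  ordinal \<open>K\<close>, which certifies wellfoundedness and makes the game closed for that player.\<close>

definition legal :: "'a \<Rightarrow> bool" where
  "legal q \<longleftrightarrow> (\<exists>k a y L. k \<epsilon> om \<and> func (yq q) k \<and> maps (fq q) k K \<and> C a y L \<and> init a (sq q) \<and>
     y \<restriction> k = yq q \<and> (\<forall>i j. i \<epsilon> k \<longrightarrow> j \<epsilon> k \<longrightarrow> (fq q \<cdot> i \<epsilon> fq q \<cdot> j \<longleftrightarrow> \<langle>i, j\<rangle> \<epsilon> L)))"

definition St :: 'a where "St = sep (str \<otimes> (seqs om \<otimes> seqs K)) legal"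

lemma mem_St: "q \<epsilon> St \<longleftrightarrow> q \<epsilon> str \<otimes> (seqs om \<otimes> seqs K) \<and> legal q"
  unfolding St_def legal_def by (rule mem_sep) (intro dfn)

lemma St_sq: "q \<epsilon> St \<Longrightarrow> sq q \<epsilon> str"
  unfolding mem_St mem_prod sq_def by auto

text \<open>Every round adds one entry to \<open>y\<close> and one ordinal to \<open>f\<close>, so
  that infinitely many rounds define both on all of \<open>om\<close>; the growth of the strings is
  regulated separately.\<close>

definition cont :: "'a \<Rightarrow> 'a \<Rightarrow> bool" where
  "cont q q' \<longleftrightarrow> (\<exists>k. k \<epsilon> om \<and> func (fq q) k \<and> func (fq q') (suc k) \<and> yq q' \<restriction> k = yq q \<and> fq q' \<restriction> k = fq q)"

lemma definable_cont [dfn]: "dterm t \<Longrightarrow> dterm u \<Longrightarrow> definable (\<lambda>e. cont (t e) (u e))"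
  by (rule definable_comp2) (unfold cont_def, intro dfn)

text \<open>An infinite play is won by the builder. The limiting order is read off from the ordinals
  and is wellfounded for this reason, while legality of the single positions supplies the
  approximations for \<open>C_closed\<close>.\<close>

lemma play_limit:
  assumes G: "dterm (\<lambda>e. G (e 0))" and St: "\<And>n. n \<epsilon> om \<Longrightarrow> G n \<epsilon> St"
    and grow: "\<And>n. n \<epsilon> om \<Longrightarrow> sext (sq (G n)) (sq (G (suc n)))"
    and len: "\<And>n. n \<epsilon> om \<Longrightarrow> p1 (sq (G n)) \<epsilon> p1 (sq (G (suc n)))"
    and cont: "\<And>n. n \<epsilon> om \<Longrightarrow> cont (G n) (G (suc n))"
  shows "\<exists>a. projection a \<and> (\<forall>n. n \<epsilon> om \<longrightarrow> init a (sq (G n)))"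
proof -
  note [dfn] = dterm_comp1[OF G]
  have legal: "legal (G n)" if "n \<epsilon> om" for n using St[OF that] mem_St by blast
  have str: "sq (G n) \<epsilon> str" if "n \<epsilon> om" for n using St[OF that] St_sq by blast
  have "dterm (\<lambda>e. sq (G (e 0)))" by (intro dfn)
  from sext_chain[where G = "\<lambda>n. sq (G n)", OF this str grow] obtain a
    where a: "a \<sqsubseteq> om" "\<And>n. n \<epsilon> om \<Longrightarrow> init a (sq (G n))" by blast
  define val where "val q m \<longleftrightarrow> (\<exists>k. k \<epsilon> om \<and> func (fq q) k \<and> m \<epsilon> k)" for q m
  have long: "n \<epsilon> suc (p1 (sq (G n)))" if "n \<epsilon> om" for n
    by (rule increasing_ge[where H = "\<lambda>n. p1 (sq (G n))", OF _ _ len that]) (intro dfn, use str_len[OF str] in blast)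
  have dom: "\<exists>k. k \<epsilon> om \<and> func (fq (G n)) k \<and> n \<epsilon> suc k" if "n \<epsilon> om" for n
  proof (rule om_induct[OF _ that])
    show "\<exists>k. k \<epsilon> om \<and> func (fq (G \<emptyset>)) k \<and> \<emptyset> \<epsilon> suc k"
      using cont[OF zero_om] om_zero_sub unfolding cont_def by auto
    fix n assume n: "n \<epsilon> om" "\<exists>k. k \<epsilon> om \<and> func (fq (G n)) k \<and> n \<epsilon> suc k"
    then obtain k where k: "k \<epsilon> om" "func (fq (G n)) k" "n \<epsilon> suc k" by blast
    then have "func (fq (G (suc n))) (suc k)"
      using cont[OF n(1)] func_dom_unique unfolding cont_def by blast
    moreover have "suc n \<epsilon> suc (suc k)" by (rule om_suc_mem_iff) (use k in auto)
    ultimately show "\<exists>k. k \<epsilon> om \<and> func (fq (G (suc n))) k \<and> suc n \<epsilon> suc k" using k(1) suc_om by blast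
  qed (intro dfn)
  have valI: "val (G (suc m)) m" if m: "m \<epsilon> om" for m
  proof -
    obtain k where k: "k \<epsilon> om" "func (fq (G (suc m))) k" "suc m \<epsilon> suc k" using dom[OF suc_om[OF m]] by blast
    have "m \<epsilon> k" using k(3) om_trans[of m "suc m" k] k(1) by auto
    then show ?thesis using k unfolding val_def by blast
  qed
  have step: "val (G (suc n)) m \<and> yq (G (suc n)) \<cdot> m = yq (G n) \<cdot> m \<and> fq (G (suc n)) \<cdot> m = fq (G n) \<cdot> m"
    if n: "n \<epsilon> om" "val (G n) m" for n m
  proof -
    obtain k where k: "k \<epsilon> om" "func (fq (G n)) k" "func (fq (G (suc n))) (suc k)"
      "yq (G (suc n)) \<restriction> k = yq (G n)" "fq (G (suc n)) \<restriction> k = fq (G n)"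
      using cont[OF n(1)] unfolding cont_def by blast
    then have "m \<epsilon> k" using n(2) func_dom_unique unfolding val_def by blast
    then show ?thesis using k app_res[of m k] unfolding val_def by (metis mem_suc suc_om)
  qed
  have agree: "n \<epsilon> suc j \<longrightarrow> val (G j) m \<and> yq (G j) \<cdot> m = yq (G n) \<cdot> m \<and> fq (G j) \<cdot> m = fq (G n) \<cdot> m"
    if n: "n \<epsilon> om" "j \<epsilon> om" "val (G n) m" for n j m
  proof (rule om_induct[OF _ n(2)])
    show "definable (\<lambda>e. n \<epsilon> suc (e 0) \<longrightarrow> val (G (e 0)) m \<and> yq (G (e 0)) \<cdot> m = yq (G n) \<cdot> m \<and> fq (G (e 0)) \<cdot> m = fq (G n) \<cdot> m)"
      unfolding val_def by (intro dfn)
    show "n \<epsilon> suc \<emptyset> \<longrightarrow> val (G \<emptyset>) m \<and> yq (G \<emptyset>) \<cdot> m = yq (G n) \<cdot> m \<and> fq (G \<emptyset>) \<cdot> m = fq (G n) \<cdot> m"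
      using n(3) by auto
    fix j assume j: "j \<epsilon> om" and IH: "n \<epsilon> suc j \<longrightarrow> val (G j) m \<and> yq (G j) \<cdot> m = yq (G n) \<cdot> m \<and> fq (G j) \<cdot> m = fq (G n) \<cdot> m"
    show "n \<epsilon> suc (suc j) \<longrightarrow> val (G (suc j)) m \<and> yq (G (suc j)) \<cdot> m = yq (G n) \<cdot> m \<and> fq (G (suc j)) \<cdot> m = fq (G n) \<cdot> m"
    proof
      assume "n \<epsilon> suc (suc j)"
      then consider "n \<epsilon> suc j" | "n = suc j" by auto
      then show "val (G (suc j)) m \<and> yq (G (suc j)) \<cdot> m = yq (G n) \<cdot> m \<and> fq (G (suc j)) \<cdot> m = fq (G n) \<cdot> m"
      proof cases
        case 1
        then show ?thesis using IH step[OF j, of m] by simp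
      next
        case 2
        then show ?thesis using n(3) by simp
      qed
    qed
  qed
  \<comment> \<open>Stage \<open>n\<close> has at least \<open>n\<close> entries, so
    \<open>suc m\<close> is the first stage at which an entry at \<open>m\<close> is
    guaranteed.\<close>
  define y where "y = lam om (\<lambda>m. yq (G (suc m)) \<cdot> m)"
  define f where "f = lam om (\<lambda>m. fq (G (suc m)) \<cdot> m)"
  have dy: "dterm (\<lambda>e. yq (G (suc (e 0))) \<cdot> e 0)" and df: "dterm (\<lambda>e. fq (G (suc (e 0))) \<cdot> e 0)" by (intro dfn)+
  have yf: "y \<cdot> m = yq (G n) \<cdot> m \<and> f \<cdot> m = fq (G n) \<cdot> m" if "m \<epsilon> om" "n \<epsilon> om" "val (G n) m" for m n
  proof -
    have e: "y \<cdot> m = yq (G (suc m)) \<cdot> m" "f \<cdot> m = fq (G (suc m)) \<cdot> m"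
      unfolding y_def f_def using app_lam[OF dy that(1)] app_lam[OF df that(1)] by blast+
    have "n \<epsilon> suc (suc m) \<or> suc m \<epsilon> suc n" using om_linear[OF that(2) suc_om[OF that(1)]] by auto
    then show ?thesis
      using e agree[OF that(2) suc_om[OF that(1)] that(3)] agree[OF suc_om[OF that(1)] that(2) valI[OF that(1)]] by auto
  qed
  have approx: "\<exists>k a' y' L'. k \<epsilon> om \<and> n \<sqsubseteq> k \<and> C a' y' L' \<and> init a' (sq (G n)) \<and> maps (fq (G n)) k K \<and>
    (\<forall>m. m \<epsilon> k \<longrightarrow> y' \<cdot> m = y \<cdot> m) \<and> (\<forall>m. m \<epsilon> k \<longrightarrow> fq (G n) \<cdot> m = f \<cdot> m) \<and>
    (\<forall>i j. i \<epsilon> k \<longrightarrow> j \<epsilon> k \<longrightarrow> (f \<cdot> i \<epsilon> f \<cdot> j \<longleftrightarrow> \<langle>i, j\<rangle> \<epsilon> L'))" if n: "n \<epsilon> om" for n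
  proof -
    obtain k a' y' L' where k: "k \<epsilon> om" "func (yq (G n)) k" "maps (fq (G n)) k K" "C a' y' L'"
      "init a' (sq (G n))" "y' \<restriction> k = yq (G n)"
      "\<And>i j. i \<epsilon> k \<Longrightarrow> j \<epsilon> k \<Longrightarrow> fq (G n) \<cdot> i \<epsilon> fq (G n) \<cdot> j \<longleftrightarrow> \<langle>i, j\<rangle> \<epsilon> L'"
      using legal[OF n] unfolding legal_def by blast
    have fk: "func (fq (G n)) k" using k(3) unfolding maps_def by blast
    have v: "y \<cdot> m = yq (G n) \<cdot> m \<and> f \<cdot> m = fq (G n) \<cdot> m" if "m \<epsilon> k" for m
      by (rule yf[OF om_mem[OF k(1) that] n]) (use that fk k(1) in \<open>auto simp: val_def\<close>)
    have "n \<epsilon> suc k" using dom[OF n] func_dom_unique[OF fk] by blast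
    then have "n \<sqsubseteq> k" using ord_mem_sub[OF om_ord[OF k(1)]] by auto
    then show ?thesis using k v app_res[of _ k y'] by (intro exI[of _ k] exI[of _ a'] exI[of _ y'] exI[of _ L']) simp
  qed
  have maps_y: "maps y om om" unfolding y_def
  proof (rule maps_lam[OF dy])
    fix m assume m: "m \<epsilon> om"
    obtain k a' y' L' where k: "suc m \<sqsubseteq> k" "C a' y' L'" "\<forall>m. m \<epsilon> k \<longrightarrow> y' \<cdot> m = y \<cdot> m"
      using approx[OF suc_om[OF m]] by blast
    then have "y \<cdot> m \<epsilon> om" using C_dom[OF k(2)] m unfolding maps_def subset_of_def by auto
    then show "yq (G (suc m)) \<cdot> m \<epsilon> om" unfolding y_def app_lam[OF dy m] .
  qed
  have maps_f: "maps f om K" unfolding f_def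
  proof (rule maps_lam[OF df])
    fix m assume m: "m \<epsilon> om"
    obtain k where k: "suc m \<sqsubseteq> k" "maps (fq (G (suc m))) k K" using approx[OF suc_om[OF m]] by blast
    then show "fq (G (suc m)) \<cdot> m \<epsilon> K" unfolding maps_def subset_of_def by auto
  qed
  \<comment> \<open>The orders that witness legality may vary with the stage; on the entries played
    so far each of them is determined by \<open>f\<close>, and therefore agrees with this
    one.\<close>
  define L where "L = sep (om \<otimes> om) (\<lambda>p. f \<cdot> p1 p \<epsilon> f \<cdot> p2 p)"
  have mL: "p \<epsilon> L \<longleftrightarrow> p \<epsilon> om \<otimes> om \<and> f \<cdot> p1 p \<epsilon> f \<cdot> p2 p" for p
    unfolding L_def by (rule mem_sep) (intro dfn)
  have L_iff: "\<langle>i, j\<rangle> \<epsilon> L \<longleftrightarrow> i \<epsilon> om \<and> j \<epsilon> om \<and> f \<cdot> i \<epsilon> f \<cdot> j" for i j unfolding mL by simp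
  have "C a y L"
  proof (rule C_closed[OF a(1) maps_y])
    show "L \<sqsubseteq> om \<otimes> om" by (rule subI) (simp add: mL)
    fix n assume n: "n \<epsilon> om"
    obtain k a' y' L' where k: "k \<epsilon> om" "n \<sqsubseteq> k" "C a' y' L'" "init a' (sq (G n))"
      "\<And>m. m \<epsilon> k \<Longrightarrow> y' \<cdot> m = y \<cdot> m"
      "\<And>i j. i \<epsilon> k \<Longrightarrow> j \<epsilon> k \<Longrightarrow> f \<cdot> i \<epsilon> f \<cdot> j \<longleftrightarrow> \<langle>i, j\<rangle> \<epsilon> L'" using approx[OF n] by blast
    have "n \<sqsubseteq> p1 (sq (G n))"
      using long[OF n] ord_mem_sub[OF om_ord[OF str_len[OF str[OF n]]]] by auto
    then have "a' \<sqinter> n = a \<sqinter> n"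
      using k(4) a(2)[OF n] by (intro ext) (auto simp: init_def subset_of_def)
    moreover have "y' \<restriction> n = y \<restriction> n"
    proof (rule func_eqI)
      show "func (y' \<restriction> n) n" "func (y \<restriction> n) n"
        using C_dom[OF k(3)] maps_y om_sub[OF n] unfolding maps_def by (auto intro: func_res)
    qed (use k(2,5) in \<open>auto simp: subset_of_def\<close>)
    moreover have "\<langle>i, j\<rangle> \<epsilon> L' \<longleftrightarrow> \<langle>i, j\<rangle> \<epsilon> L" if "i \<epsilon> n" "j \<epsilon> n" for i j
      unfolding L_iff using k(6)[of i j] that k(2) om_mem[OF n] by (auto simp: subset_of_def)
    ultimately show "\<exists>a' y' L'. C a' y' L' \<and> a' \<sqinter> n = a \<sqinter> n \<and> y' \<restriction> n = y \<restriction> n \<and>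
        (\<forall>i j. i \<epsilon> n \<longrightarrow> j \<epsilon> n \<longrightarrow> (\<langle>i, j\<rangle> \<epsilon> L' \<longleftrightarrow> \<langle>i, j\<rangle> \<epsilon> L))" using k(3) by blast
  qed
  moreover have "wf_on om (\<lambda>i j. \<langle>i, j\<rangle> \<epsilon> L)" unfolding wf_on_def
  proof (intro allI impI)
    fix s assume s: "s \<sqsubseteq> om" "s \<noteq> \<emptyset>"
    have d: "dterm (\<lambda>e. f \<cdot> e 0)" by (intro dfn)
    obtain i where "i \<epsilon> s" using s(2) eq_emp_iff by blast
    then have "f \<cdot> i \<epsilon> repl s (\<lambda>i. f \<cdot> i)" unfolding mem_repl[OF d] by blast
    from foundation[OF this] obtain m where "m \<epsilon> s" "\<And>j. j \<epsilon> s \<Longrightarrow> \<not> f \<cdot> j \<epsilon> f \<cdot> m"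
      unfolding mem_repl[OF d] by blast
    then show "\<exists>m. m \<epsilon> s \<and> (\<forall>j. j \<epsilon> s \<longrightarrow> \<not> \<langle>j, m\<rangle> \<epsilon> L)" unfolding L_iff by blast
  qed
  ultimately show ?thesis using a(2) unfolding projection_def by blast
qed

text \<open>Two plays feed each other: the string reached in one, with bit \<open>n\<close> flipped,
  becomes the opponent's move in the other. In the limit the two reals differ exactly at
  \<open>n\<close>.\<close>

lemma copied_play:
  assumes N: "N \<sqsubseteq> St" "q0 \<epsilon> N"
    and stay: "\<And>q u. q \<epsilon> N \<Longrightarrow> u \<epsilon> str \<Longrightarrow> sext (sq q) u \<Longrightarrow> \<exists>q'. q' \<epsilon> N \<and> sext u (sq q') \<and> cont q q'"
  shows "\<exists>n a. n \<epsilon> om \<and> projection a \<and> projection (flip n a)"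
proof -
  have str: "sq q \<epsilon> str" if "q \<epsilon> N" for q using that N(1) St_sq subD by blast
  \<comment> \<open>The first bit not decided by the common position \<open>q0\<close>, so that both
    plays can start there.\<close>
  define n where "n = p1 (sq q0)"
  have n: "n \<epsilon> om" unfolding n_def using str_len str N(2) by blast
  \<comment> \<open>One appended bit makes the strings grow strictly even when the builder adds
    nothing.\<close>
  define lng where "lng t = \<langle>suc (p1 t), p2 t\<rangle>" for t
  have lng_str: "lng t \<epsilon> str" if "t \<epsilon> str" for t
    unfolding lng_def using str_len[OF that] str_sub[OF that] by (auto simp: subset_of_def)
  have lng_ext: "sext t (lng t)" if "t \<epsilon> str" for t
    unfolding lng_def sext_def using str_sub[OF that] by (auto simp: subset_of_def)
  have lng_mem: "p1 t \<epsilon> p1 s" if "sext (lng t) s" for t s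
    using that unfolding lng_def sext_def by (auto simp: subset_of_def)
  \<comment> \<open>The invariant after a full round: bit \<open>n\<close> is decided, and the
    second play extends the flipped string of the first.\<close>
  define B where "B = sep (N \<otimes> N) (\<lambda>p. n \<epsilon> p1 (sq (p1 p)) \<and> sext (flips n (sq (p1 p))) (sq (p2 p)))"
  have mB: "\<langle>q, r\<rangle> \<epsilon> B \<longleftrightarrow> q \<epsilon> N \<and> r \<epsilon> N \<and> n \<epsilon> p1 (sq q) \<and> sext (flips n (sq q)) (sq r)" for q r
    unfolding B_def by (subst mem_sep) (intro dfn, auto)
  have B_pair: "\<exists>q r. p = \<langle>q, r\<rangle>" if "p \<epsilon> B" for p
    using that unfolding B_def by (subst (asm) mem_sep) (intro dfn, auto simp: mem_prod)
  have flips_sext: "sext s (flips n t)" if "sext (flips n s) t" "s \<epsilon> str" "n \<epsilon> p1 s" for s t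
    using sext_flips[OF that(1), of n] flips_flips[OF that(2), of n] that(3) unfolding flips_def by simp
  obtain q1 where q1: "q1 \<epsilon> N" "sext (lng (sq q0)) (sq q1)"
    using stay[OF N(2) lng_str[OF str[OF N(2)]] lng_ext[OF str[OF N(2)]]] by blast
  have n1: "n \<epsilon> p1 (sq q1)" using lng_mem[OF q1(2)] unfolding n_def .
  have "\<not> n \<epsilon> p1 (sq q0)" unfolding n_def by simp
  then have "sext (sq q0) (flips n (sq q1))"
    using sext_trans[OF lng_ext[OF str[OF N(2)]] q1(2)] unfolding sext_def flips_def by auto
  then obtain r1 where r1: "r1 \<epsilon> N" "sext (flips n (sq q1)) (sq r1)"
    using stay[OF N(2) flips_str[OF str[OF q1(1)] n1]] by blast
  define rel where "rel q q' \<longleftrightarrow> sext (sq q) (sq q') \<and> p1 (sq q) \<epsilon> p1 (sq q') \<and> cont q q'" for q q'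
  have "definable (\<lambda>e. rel (p1 (e 1)) (p1 (e 2)) \<and> rel (p2 (e 1)) (p2 (e 2)))"
    unfolding rel_def by (intro dfn)
  moreover have "\<langle>q1, r1\<rangle> \<epsilon> B" unfolding mB using q1 r1 n1 by blast
  moreover have "\<exists>w. w \<epsilon> B \<and> (rel (p1 v) (p1 w) \<and> rel (p2 v) (p2 w))" if vB: "v \<epsilon> B" for v
  proof -
    obtain q r where v: "v = \<langle>q, r\<rangle>" using B_pair[OF vB] by blast
    then have q: "q \<epsilon> N" "r \<epsilon> N" "n \<epsilon> p1 (sq q)" "sext (flips n (sq q)) (sq r)" using vB mB by blast+
    have len_qr: "p1 (sq q) \<sqsubseteq> p1 (sq r)" using q(4) unfolding sext_def flips_def by simp
    then have nr: "n \<epsilon> p1 (sq r)" using q(3) subD by blast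
    let ?u = "flips n (sq r)"
    have u: "?u \<epsilon> str" by (rule flips_str[OF str[OF q(2)] nr])
    have "sext (sq q) ?u" by (rule flips_sext[OF q(4) str[OF q(1)] q(3)])
    then obtain q' where q': "q' \<epsilon> N" "sext (lng ?u) (sq q')" "cont q q'"
      using stay[OF q(1) lng_str[OF u]] sext_trans[OF _ lng_ext[OF u]] by blast
    have uq': "sext ?u (sq q')" by (rule sext_trans[OF lng_ext[OF u] q'(2)])
    have len1: "p1 (sq r) \<epsilon> p1 (sq q')" using lng_mem[OF q'(2)] unfolding flips_def by simp
    then have nq': "n \<epsilon> p1 (sq q')" using om_trans[OF nr _ str_len[OF str[OF q'(1)]]] by blast
    have "p1 (sq q) \<epsilon> suc (p1 (sq r))"
      using ord_sub_iff[OF om_ord om_ord] len_qr str_len str q(1,2) by auto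
    then have len2: "p1 (sq q) \<epsilon> p1 (sq q')" by (rule suc_mem_trans[OF _ len1 str_len[OF str[OF q'(1)]]])
    have "sext (sq r) (flips n (sq q'))" by (rule flips_sext[OF uq' str[OF q(2)] nr])
    then obtain r' where r': "r' \<epsilon> N" "sext (flips n (sq q')) (sq r')" "cont r r'"
      using stay[OF q(2) flips_str[OF str[OF q'(1)] nq']] by blast
    have "sext (sq r) (sq r')" by (rule sext_trans[OF \<open>sext (sq r) (flips n (sq q'))\<close> r'(2)])
    moreover have "p1 (sq r) \<epsilon> p1 (sq r')" using len1 r'(2) unfolding sext_def flips_def by (auto simp: subset_of_def)
    moreover have "sext (sq q) (sq q')" by (rule sext_trans[OF \<open>sext (sq q) ?u\<close> uq'])
    ultimately show ?thesis using q' r' len2 nq' v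
      by (intro exI[of _ "\<langle>q', r'\<rangle>"]) (simp add: mB rel_def)
  qed
  ultimately obtain g where g: "maps g om B"
    "\<And>i. i \<epsilon> om \<Longrightarrow> rel (p1 (g \<cdot> i)) (p1 (g \<cdot> suc i)) \<and> rel (p2 (g \<cdot> i)) (p2 (g \<cdot> suc i))"
    using om_choice[where Q = "\<lambda>n v w. rel (p1 v) (p1 w) \<and> rel (p2 v) (p2 w)"] by blast
  have gB: "p1 (g \<cdot> i) \<epsilon> N \<and> p2 (g \<cdot> i) \<epsilon> N \<and> sext (flips n (sq (p1 (g \<cdot> i)))) (sq (p2 (g \<cdot> i)))" if "i \<epsilon> om" for i
  proof -
    have gi: "g \<cdot> i \<epsilon> B" using g(1) that unfolding maps_def by blast
    moreover obtain q r where "g \<cdot> i = \<langle>q, r\<rangle>" using B_pair[OF gi] by blast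
    ultimately show ?thesis by (simp add: mB)
  qed
  have "dterm (\<lambda>e. p1 (g \<cdot> e 0))" by (intro dfn)
  from play_limit[where G = "\<lambda>i. p1 (g \<cdot> i)", OF this] obtain a
    where a: "projection a" "\<And>i. i \<epsilon> om \<Longrightarrow> init a (sq (p1 (g \<cdot> i)))"
    using gB g(2) N(1) unfolding rel_def subset_of_def by blast
  have "dterm (\<lambda>e. p2 (g \<cdot> e 0))" by (intro dfn)
  from play_limit[where G = "\<lambda>i. p2 (g \<cdot> i)", OF this] obtain b
    where b: "projection b" "\<And>i. i \<epsilon> om \<Longrightarrow> init b (sq (p2 (g \<cdot> i)))"
    using gB g(2) N(1) unfolding rel_def subset_of_def by blast
  have long: "i \<epsilon> suc (p1 (sq (p1 (g \<cdot> i))))" if "i \<epsilon> om" for i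
  proof (rule increasing_ge[where H = "\<lambda>i. p1 (sq (p1 (g \<cdot> i)))", OF _ _ _ that])
    show "dterm (\<lambda>e. p1 (sq (p1 (g \<cdot> e 0))))" by (intro dfn)
    show "p1 (sq (p1 (g \<cdot> i))) \<epsilon> om" if "i \<epsilon> om" for i using str_len str gB that by blast
    show "p1 (sq (p1 (g \<cdot> i))) \<epsilon> p1 (sq (p1 (g \<cdot> suc i)))" if "i \<epsilon> om" for i
      using g(2)[OF that] unfolding rel_def by blast
  qed
  have "b = flip n a"
  proof (rule ext)
    fix m
    have sub: "a \<sqsubseteq> om" "b \<sqsubseteq> om" using a(1) b(1) C_dom unfolding projection_def by blast+
    show "m \<epsilon> b \<longleftrightarrow> m \<epsilon> flip n a"
    proof (cases "m \<epsilon> om")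
      case True
      let ?q = "p1 (g \<cdot> suc m)" and ?r = "p2 (g \<cdot> suc m)"
      note s = suc_om[OF True]
      have "p1 (sq ?q) \<epsilon> om" using str_len str gB[OF s] by blast
      then have mq: "m \<epsilon> p1 (sq ?q)" using long[OF s] om_trans[of m "suc m"] by auto
      have e: "sext (flips n (sq ?q)) (sq ?r)" using gB[OF s] by blast
      then have mr: "m \<epsilon> p1 (sq ?r)" using mq unfolding sext_def flips_def by (auto simp: subset_of_def)
      have "m \<epsilon> b \<longleftrightarrow> m \<epsilon> p2 (sq ?r)" using b(2)[OF s] mr unfolding init_def by blast
      also have "\<dots> \<longleftrightarrow> m \<epsilon> flip n (p2 (sq ?q))" using e mq unfolding sext_def flips_def by auto
      also have "\<dots> \<longleftrightarrow> m \<epsilon> flip n a" using a(2)[OF s] mq unfolding init_def by auto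
      finally show ?thesis .
    next
      case False
      then show ?thesis using sub n by (auto simp: subset_of_def)
    qed
  qed
  then show ?thesis using n a(1) b(1) by blast
qed

text \<open>The strategy colours the ordinals \<open>f\<close> by the strings extending
  \<open>s\<close>, of which there are only countably many, so one reply is given almost everywhere.
  Positions outside \<open>W\<close> receive the default colour \<open>s\<close>.\<close>

lemma integrated_move:
  assumes \<tau>: "maps \<tau> W str" "\<And>q. q \<epsilon> W \<Longrightarrow> sext (sq q) (\<tau> \<cdot> q)"
    and s: "s \<epsilon> str" and k: "k \<epsilon> om" "lin_order l k"
  shows "\<exists>u H. u \<epsilon> str \<and> maps H PF U \<and> sext s u \<and>
    (\<forall>f. maps f k K \<longrightarrow> obeys H f k l \<longrightarrow> \<langle>s, \<langle>y, f\<rangle>\<rangle> \<epsilon> W \<longrightarrow> \<tau> \<cdot> \<langle>s, \<langle>y, f\<rangle>\<rangle> = u)"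
proof -
  have mS: "t \<epsilon> sep str (sext s) \<longleftrightarrow> t \<epsilon> str \<and> sext s t" for t by (rule mem_sep) (intro dfn)
  let ?c = "\<lambda>f. if \<langle>s, \<langle>y, f\<rangle>\<rangle> \<epsilon> W then \<tau> \<cdot> \<langle>s, \<langle>y, f\<rangle>\<rangle> else s"
  have d: "dterm (\<lambda>e. ?c (e 0))" by (intro dfn)
  have "maps (lam PF ?c) PF (sep str (sext s))"
  proof (rule maps_lam[OF d])
    fix f
    have "?c f \<epsilon> str \<and> sext s (?c f)"
      using \<tau>(2)[of "\<langle>s, \<langle>y, f\<rangle>\<rangle>"] \<tau>(1) s sext_refl[OF s] unfolding maps_def by simp
    then show "?c f \<epsilon> sep str (sext s)" unfolding mS .
  qed
  moreover have "cnt (sep str (sext s))"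
    by (rule cnt_sub[OF cnt_str]) (rule subI, simp add: mS)
  ultimately obtain u H where u: "u \<epsilon> sep str (sext s)" "maps H PF U"
    "\<And>f. maps f k K \<Longrightarrow> obeys H f k l \<Longrightarrow> lam PF ?c \<cdot> f = u"
    using homogeneous_nat[OF _ k] unfolding homogeneous_def by blast
  have "\<tau> \<cdot> \<langle>s, \<langle>y, f\<rangle>\<rangle> = u" if "maps f k K" "obeys H f k l" "\<langle>s, \<langle>y, f\<rangle>\<rangle> \<epsilon> W" for f
    using u(3)[OF that(1,2)] app_lam[OF d maps_PF[OF that(1) om_sub[OF k(1)]]] that(3) by simp
  then show ?thesis using u(1,2) unfolding mS by blast
qed

section \<open>Countability of the finite relations\<close>

definition fin_rel :: 'a where "fin_rel = sep (pow (om \<otimes> om)) (\<lambda>l. \<exists>k. k \<epsilon> om \<and> l \<sqsubseteq> k \<otimes> k)"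

lemma mem_fin_rel: "l \<epsilon> fin_rel \<longleftrightarrow> (\<exists>k. k \<epsilon> om \<and> l \<sqsubseteq> k \<otimes> k)"
proof -
  have "k \<otimes> k \<sqsubseteq> om \<otimes> om" if "k \<epsilon> om" for k
    using om_sub[OF that] unfolding subset_of_def mem_prod by blast
  then show ?thesis unfolding fin_rel_def
    by (subst mem_sep) (intro dfn, use sub_trans in auto)
qed

text \<open>A relation on \<open>k\<close> is recovered from the finite sequence of its sections,
  each of which is a finite set.\<close>

lemma cnt_fin_rel: "cnt fin_rel"
proof (rule cnt_image[OF cnt_seqs[OF cnt_finpow], where F = "\<lambda>s. sep (om \<otimes> om) (\<lambda>p. p1 p \<epsilon> s \<cdot> p2 p)"])
  show "dterm (\<lambda>e. sep (om \<otimes> om) (\<lambda>p. p1 p \<epsilon> e 0 \<cdot> p2 p))" by (intro dfn)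
  fix l assume "l \<epsilon> fin_rel"
  then obtain k where k: "k \<epsilon> om" "l \<sqsubseteq> k \<otimes> k" unfolding mem_fin_rel by blast
  let ?r = "\<lambda>i. sep k (\<lambda>j. \<langle>j, i\<rangle> \<epsilon> l)"
  have mr: "j \<epsilon> ?r i \<longleftrightarrow> j \<epsilon> k \<and> \<langle>j, i\<rangle> \<epsilon> l" for i j by (rule mem_sep) (intro dfn)
  have d: "dterm (\<lambda>e. ?r (e 0))" by (intro dfn)
  have s: "maps (lam k ?r) k finpow"
    by (rule maps_lam[OF d]) (unfold mem_finpow subset_of_def mr, use k(1) in blast)
  have "l = sep (om \<otimes> om) (\<lambda>p. p1 p \<epsilon> lam k ?r \<cdot> p2 p)"
  proof (rule ext)
    fix p
    have m: "p \<epsilon> sep (om \<otimes> om) (\<lambda>p. p1 p \<epsilon> lam k ?r \<cdot> p2 p) \<longleftrightarrow> p \<epsilon> om \<otimes> om \<and> p1 p \<epsilon> lam k ?r \<cdot> p2 p"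
      by (rule mem_sep) (intro dfn)
    \<comment> \<open>Beyond \<open>k\<close> the default value of application codes an empty
      section, so the decoded relation has no stray pairs.\<close>
    have junk: "lam k ?r \<cdot> i = \<emptyset>" if "\<not> i \<epsilon> k" for i
    proof -
      have "\<not> (\<exists>!y. \<langle>i, y\<rangle> \<epsilon> lam k ?r)" using that unfolding mem_lam[OF d] by auto
      then show ?thesis unfolding app_def the1_def by simp
    qed
    show "p \<epsilon> l \<longleftrightarrow> p \<epsilon> sep (om \<otimes> om) (\<lambda>p. p1 p \<epsilon> lam k ?r \<cdot> p2 p)"
    proof
      assume p: "p \<epsilon> l"
      then obtain i j where ij: "p = \<langle>i, j\<rangle>" "i \<epsilon> k" "j \<epsilon> k" using k(2) unfolding subset_of_def mem_prod by blast
      then show "p \<epsilon> sep (om \<otimes> om) (\<lambda>p. p1 p \<epsilon> lam k ?r \<cdot> p2 p)"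
        unfolding m using p om_mem[OF k(1)] app_lam[OF d ij(3)] by (simp add: mr)
    next
      assume "p \<epsilon> sep (om \<otimes> om) (\<lambda>p. p1 p \<epsilon> lam k ?r \<cdot> p2 p)"
      then obtain i j where ij: "p = \<langle>i, j\<rangle>" "i \<epsilon> lam k ?r \<cdot> j" unfolding m mem_prod by auto
      then have "j \<epsilon> k" using junk[of j] by (cases "j \<epsilon> k") auto
      then show "p \<epsilon> l" using ij app_lam[OF d] by (simp add: mr)
    qed
  qed
  then show "\<exists>s. s \<epsilon> seqs finpow \<and> l = sep (om \<otimes> om) (\<lambda>p. p1 p \<epsilon> s \<cdot> p2 p)"
    using s k(1) unfolding mem_seqs by blast
qed

text \<open>A winning strategy of the opponent can be made independent of the ordinals \<open>f\<close>; a generic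
  real then lies outside the projection, together with all its finite variants.\<close>

lemma lost_game:
  assumes W: "\<And>q. q \<epsilon> St \<Longrightarrow> fq q = \<emptyset> \<Longrightarrow> q \<epsilon> W"
    and \<tau>: "maps \<tau> W str" "\<And>q. q \<epsilon> W \<Longrightarrow> sext (sq q) (\<tau> \<cdot> q)"
    and stay: "\<And>q q'. q \<epsilon> W \<Longrightarrow> q' \<epsilon> St \<Longrightarrow> sext (\<tau> \<cdot> q) (sq q') \<Longrightarrow> cont q q' \<Longrightarrow> q' \<epsilon> W"
    and wf: "\<And>X. X \<sqsubseteq> W \<Longrightarrow> X \<noteq> \<emptyset> \<Longrightarrow> \<exists>q. q \<epsilon> X \<and> (\<forall>q'. q' \<epsilon> X \<longrightarrow> \<not> (sext (\<tau> \<cdot> q) (sq q') \<and> cont q q'))"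
  shows "\<exists>a. a \<sqsubseteq> om \<and> (\<forall>v. v \<epsilon> str \<longrightarrow> \<not> projection (var a v))"
proof -
  \<comment> \<open>Positions with an order pattern in place of the ordinals: this leaves only
    countably many.\<close>
  define I where "I = sep (str \<otimes> (seqs om \<otimes> fin_rel)) (\<lambda>p. \<exists>k. k \<epsilon> om \<and> func (yq p) k \<and> lin_order (fq p) k)"
  have mI: "\<langle>s, \<langle>y, l\<rangle>\<rangle> \<epsilon> I \<longleftrightarrow> s \<epsilon> str \<and> y \<epsilon> seqs om \<and> l \<epsilon> fin_rel \<and> (\<exists>k. k \<epsilon> om \<and> func y k \<and> lin_order l k)" for s y l
    unfolding I_def by (subst mem_sep) (intro dfn, simp)
  have I_form: "\<exists>s y l. p = \<langle>s, \<langle>y, l\<rangle>\<rangle>" if "p \<epsilon> I" for p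
    using that unfolding I_def by (subst (asm) mem_sep) (intro dfn, auto simp: mem_prod)
  have cntI: "cnt I"
    by (rule cnt_sub[OF cnt_prod[OF cnt_str cnt_prod[OF cnt_seqs[OF cnt_om] cnt_fin_rel]]])
       (rule subI, unfold I_def, subst (asm) mem_sep, intro dfn, blast)
  define good where "good p v \<longleftrightarrow> sext (sq p) (p1 v) \<and> (\<forall>k f. k \<epsilon> om \<longrightarrow> func (yq p) k \<longrightarrow> maps f k K \<longrightarrow>
    obeys (p2 v) f k (fq p) \<longrightarrow> \<langle>sq p, \<langle>yq p, f\<rangle>\<rangle> \<epsilon> W \<longrightarrow> \<tau> \<cdot> \<langle>sq p, \<langle>yq p, f\<rangle>\<rangle> = p1 v)" for p v
  have dgood: "definable (\<lambda>e. good (e 0) (e 1))" unfolding good_def by (intro dfn)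
  have "\<exists>v. v \<epsilon> str \<otimes> fspace PF U \<and> good p v" if pI: "p \<epsilon> I" for p
  proof -
    obtain s y l where p: "p = \<langle>s, \<langle>y, l\<rangle>\<rangle>" using I_form[OF pI] by blast
    then obtain k where k: "s \<epsilon> str" "k \<epsilon> om" "func y k" "lin_order l k" using pI mI by blast
    obtain u H where u: "u \<epsilon> str" "maps H PF U" "sext s u"
      "\<And>f. maps f k K \<Longrightarrow> obeys H f k l \<Longrightarrow> \<langle>s, \<langle>y, f\<rangle>\<rangle> \<epsilon> W \<Longrightarrow> \<tau> \<cdot> \<langle>s, \<langle>y, f\<rangle>\<rangle> = u"
      using integrated_move[OF \<tau> k(1,2,4), where y = y] by blast
    have "good p \<langle>u, H\<rangle>" unfolding good_def p using u(3,4) func_dom_unique[OF k(3)] by auto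
    then show ?thesis using u(1,2) by (intro exI[of _ "\<langle>u, H\<rangle>"]) simp
  qed
  then obtain T where "maps T I (str \<otimes> fspace PF U)" "\<forall>p. p \<epsilon> I \<longrightarrow> good p (T \<cdot> p)"
    using set_choice[OF dgood, of I "str \<otimes> fspace PF U"] by blast
  then have T: "\<And>p. p \<epsilon> I \<Longrightarrow> T \<cdot> p \<epsilon> str \<otimes> fspace PF U \<and> good p (T \<cdot> p)"
    unfolding maps_def by blast
  \<comment> \<open>\<open>ts p\<close> is the reply common to almost all ordinals compatible with
    \<open>p\<close>, and \<open>Hs p\<close> prescribes which ordinals count.\<close>
  define ts where "ts p = p1 (T \<cdot> p)" for p
  define Hs where "Hs p = p2 (T \<cdot> p)" for p
  have [dfn]: "dterm (\<lambda>e. ts (t e))" "dterm (\<lambda>e. Hs (t e))" if "dterm t" for t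
    unfolding ts_def Hs_def by (intro dfn that)+
  have ts: "ts p \<epsilon> str" "sext (sq p) (ts p)" and Hs: "maps (Hs p) PF U" if "p \<epsilon> I" for p
    using T[OF that] unfolding ts_def Hs_def good_def mem_prod by auto
  have decided: "\<tau> \<cdot> \<langle>s, \<langle>y, f\<rangle>\<rangle> = ts \<langle>s, \<langle>y, l\<rangle>\<rangle>"
    if "\<langle>s, \<langle>y, l\<rangle>\<rangle> \<epsilon> I" "k \<epsilon> om" "func y k" "maps f k K" "obeys (Hs \<langle>s, \<langle>y, l\<rangle>\<rangle>) f k l" "\<langle>s, \<langle>y, f\<rangle>\<rangle> \<epsilon> W" for s y l k f
    using T[OF that(1)] that(2-) unfolding good_def ts_def Hs_def by auto
  \<comment> \<open>Here \<open>r\<close> consists of a variant \<open>v\<close>, a string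
    \<open>u\<close> and the remaining data of a position. If \<open>u\<close> lies on the variant,
    some extension of \<open>u\<close> must have its decided reply on the variant too. The length
    conditions make \<open>b\<close> long enough to settle whether \<open>u\<close> lies on
    it.\<close>
  define D where "D r b \<longleftrightarrow> p1 (p1 r) \<sqsubseteq> p1 b \<and> p1 (sq (p2 r)) \<sqsubseteq> p1 b \<and> (sext (sq (p2 r)) (vars b (p1 r)) \<longrightarrow>
    (\<exists>s'. s' \<epsilon> str \<and> sext (sq (p2 r)) s' \<and> sext (ts \<langle>s', p2 (p2 r)\<rangle>) (vars b (p1 r))))" for r b
  have dD: "definable (\<lambda>e. D (e 0) (e 1))" unfolding D_def by (intro dfn)
  have D: "D \<langle>v, \<langle>u, z\<rangle>\<rangle> b \<longleftrightarrow> p1 v \<sqsubseteq> p1 b \<and> p1 u \<sqsubseteq> p1 b \<and> (sext u (vars b v) \<longrightarrow>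
    (\<exists>s'. s' \<epsilon> str \<and> sext u s' \<and> sext (ts \<langle>s', z\<rangle>) (vars b v)))" for v u z b
    unfolding D_def sq_def by simp
  have dense: "\<exists>b'. b' \<epsilon> str \<and> sext b b' \<and> D r b'" if r: "r \<epsilon> str \<otimes> I" and b: "b \<epsilon> str" for r b
  proof -
    obtain v u y l where r_eq: "r = \<langle>v, \<langle>u, \<langle>y, l\<rangle>\<rangle>\<rangle>" and v: "v \<epsilon> str" and I: "\<langle>u, \<langle>y, l\<rangle>\<rangle> \<epsilon> I"
      using r I_form unfolding mem_prod by blast
    have u: "u \<epsilon> str" using I mI by blast
    let ?b = "\<langle>p1 b \<squnion> p1 v \<squnion> p1 u, p2 b\<rangle>"
    have b1: "?b \<epsilon> str" using str_sub[OF b] om_un str_len b v u by (auto simp: subset_of_def)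
    have b2: "sext b ?b" using str_sub[OF b] unfolding sext_def by (auto simp: subset_of_def)
    have vars_str: "vars ?b v \<epsilon> str"
      using str_sub[OF v] str_sub[OF b1] b1 unfolding vars_def by (auto simp: subset_of_def)
    show ?thesis
    proof (cases "sext u (vars ?b v)")
      case False
      then have "D r ?b" unfolding r_eq D by (auto intro: subI)
      then show ?thesis using b1 b2 by blast
    next
      case True
      let ?s = "vars ?b v"
      let ?t = "ts \<langle>?s, \<langle>y, l\<rangle>\<rangle>"
      have "\<langle>?s, \<langle>y, l\<rangle>\<rangle> \<epsilon> I" using I vars_str unfolding mI by blast
      from ts[OF this] have t: "?t \<epsilon> str" "sext ?s ?t" by simp_all
      have len: "p1 ?b \<sqsubseteq> p1 ?t" using t(2) unfolding sext_def vars_def by simp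
      \<comment> \<open>Bits below \<open>p1 v\<close> are hidden by the variant and kept from
        \<open>b\<close>, all others come from the reply; the variant of the new string is then
        exactly \<open>?t\<close>.\<close>
      let ?b' = "\<langle>p1 ?t, (p2 b \<sqinter> p1 v) \<squnion> (p2 ?t \<ominus> p1 v)\<rangle>"
      have t_iff: "m \<epsilon> p2 ?t \<longleftrightarrow> m \<epsilon> p2 v \<or> m \<epsilon> p2 b \<and> \<not> m \<epsilon> p1 v" if "m \<epsilon> p1 ?b" for m
        using t(2) that unfolding sext_def vars_def by simp
      have b'1: "?b' \<epsilon> str"
        using str_len[OF t(1)] str_sub[OF t(1)] len by (auto simp: subset_of_def)
      have pb: "p2 b \<sqsubseteq> p1 b" "p2 v \<sqsubseteq> p1 v" using str_sub b v by blast+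
      have b'2: "sext ?b ?b'" unfolding sext_def
        using len t_iff pb by (auto simp: subset_of_def)
      have "var (p2 ?b') v = p2 ?t"
        by (rule ext) (use t_iff pb in \<open>auto simp: subset_of_def\<close>)
      moreover have "vars ?b' v = \<langle>p1 ?t, var (p2 ?b') v\<rangle>" unfolding vars_def p1_opair ..
      ultimately have eq: "vars ?b' v = ?t" by (simp only: str_eta[OF t(1)])
      have "D r ?b'" unfolding r_eq D eq
        using len True vars_str sext_refl[OF t(1)] by (auto simp: subset_of_def)
      then show ?thesis using b'1 sext_trans[OF b2 b'2] by blast
    qed
  qed
  obtain a where a: "a \<sqsubseteq> om" "\<And>r. r \<epsilon> str \<otimes> I \<Longrightarrow> \<exists>b. b \<epsilon> str \<and> init a b \<and> D r b"
    using generic_real[OF cnt_prod[OF cnt_str cntI] dD dense] by blast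
  have "\<not> projection (var a v)" if v: "v \<epsilon> str" for v
  proof
    let ?a = "var a v"
    assume "projection ?a"
    then obtain y L where C: "C ?a y L" and wfL: "wf_on om (\<lambda>i j. \<langle>i, j\<rangle> \<epsilon> L)" unfolding projection_def by blast
    have y: "maps y om om" and L: "L \<sqsubseteq> om \<otimes> om" "lin_order L om" using C_dom[OF C] by blast+
    define P where "P k s = \<langle>s, \<langle>y \<restriction> k, L \<sqinter> (k \<otimes> k)\<rangle>\<rangle>" for k s
    have [dfn]: "dterm (\<lambda>e. P (t e) (u e))" if "dterm t" "dterm u" for t u
      unfolding P_def by (intro dfn that)
    have y_res: "func (y \<restriction> k) k" if "k \<epsilon> om" for k
      using y om_sub[OF that] unfolding maps_def by (blast intro: func_res)
    have L_res: "lin_order (L \<sqinter> (k \<otimes> k)) k" if "k \<epsilon> om" for k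
    proof -
      have *: "i \<epsilon> k \<Longrightarrow> i \<epsilon> om" for i using om_mem[OF that] .
      have iff: "\<langle>i, j\<rangle> \<epsilon> L \<sqinter> (k \<otimes> k) \<longleftrightarrow> \<langle>i, j\<rangle> \<epsilon> L \<and> i \<epsilon> k \<and> j \<epsilon> k" for i j by simp
      show ?thesis using L(2) unfolding lin_order_def iff by (meson *)
    qed
    have PI: "P k s \<epsilon> I" if k: "k \<epsilon> om" and s: "s \<epsilon> str" for k s
      unfolding P_def mI mem_seqs mem_fin_rel
      using s k maps_res[OF y om_sub[OF k]] y_res[OF k] L_res[OF k]
      by (auto intro!: exI[of _ k] subI)
    have Psq: "sq (P k s) = s" for k s unfolding P_def by simp
    have find: "\<exists>s'. s' \<epsilon> str \<and> sext u s' \<and> init ?a (ts (P k s'))"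
      if k: "k \<epsilon> om" and u: "u \<epsilon> str" "init ?a u" for k u
    proof -
      have "\<langle>v, P k u\<rangle> \<epsilon> str \<otimes> I" using v PI[OF k u(1)] by simp
      from a(2)[OF this] obtain b where b: "b \<epsilon> str" "init a b" "D \<langle>v, P k u\<rangle> b" by blast
      have len: "p1 v \<sqsubseteq> p1 b" "p1 u \<sqsubseteq> p1 b" using b(3) unfolding P_def D by blast+
      have ib: "init ?a (vars b v)"
        using b(2) len(1) str_sub[OF v] unfolding init_def vars_def by (auto simp: subset_of_def)
      have "sext u (vars b v)"
        using ib u(2) len(2) unfolding sext_def init_def vars_def by (auto simp: subset_of_def)
      then obtain s' where "s' \<epsilon> str" "sext u s'" "sext (ts (P k s')) (vars b v)"
        using b(3) unfolding P_def D by blast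
      then show ?thesis using init_sext[OF ib] by blast
    qed
    \<comment> \<open>The decided reply, and with it \<open>s\<close>, is an initial segment of the
      variant. Strings with this property are found by genericity without any reference to
      ordinals.\<close>
    define J where "J k s \<longleftrightarrow> s \<epsilon> str \<and> init ?a (ts (P k s))" for k s
    have "init ?a \<langle>\<emptyset>, \<emptyset>\<rangle>" "\<langle>\<emptyset>, \<emptyset>\<rangle> \<epsilon> str" unfolding init_def by simp_all
    from find[OF zero_om this(2,1)] obtain s0 where s0: "J \<emptyset> s0" unfolding J_def by blast
    have "definable (\<lambda>e. J (e 0) (e 1) \<longrightarrow> sext (ts (P (e 0) (e 1))) (e 2) \<and> J (suc (e 0)) (e 2))"
      unfolding J_def by (intro dfn)
    moreover have "\<exists>w. w \<epsilon> str \<and> (J n s \<longrightarrow> sext (ts (P n s)) w \<and> J (suc n) w)"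
      if "n \<epsilon> om" "s \<epsilon> str" for n s
    proof (cases "J n s")
      case True
      then show ?thesis using find[OF suc_om[OF that(1)] ts(1)[OF PI[OF that]]] unfolding J_def by blast
    qed (use that in blast)
    moreover have "s0 \<epsilon> str" using s0 unfolding J_def by blast
    ultimately obtain g where g: "maps g om str" "g \<cdot> \<emptyset> = s0"
      "\<And>n. n \<epsilon> om \<Longrightarrow> J n (g \<cdot> n) \<longrightarrow> sext (ts (P n (g \<cdot> n))) (g \<cdot> suc n) \<and> J (suc n) (g \<cdot> suc n)"
      using om_choice[where Q = "\<lambda>n s w. J n s \<longrightarrow> sext (ts (P n s)) w \<and> J (suc n) w" and b = str and v = s0] by blast
    have Jg: "J n (g \<cdot> n)" if "n \<epsilon> om" for n
    proof (rule om_induct[OF _ that])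
      show "definable (\<lambda>e. J (e 0) (g \<cdot> e 0))" unfolding J_def by (intro dfn)
    qed (use g s0 in auto)
    have gs: "g \<cdot> n \<epsilon> str" if "n \<epsilon> om" for n using Jg[OF that] unfolding J_def by blast
    let ?p = "\<lambda>n. P n (g \<cdot> n)"
    have pI: "?p n \<epsilon> I" if "n \<epsilon> om" for n by (rule PI[OF that gs[OF that]])
    \<comment> \<open>Only now, with the strings \<open>g\<close> fixed, are the ordinals chosen.
      The value at \<open>i\<close> has to exceed the values at its predecessors in \<open>L\<close>
      and to obey the prescriptions of all stages that have an entry at \<open>i\<close>.\<close>
    define Q where "Q i h x \<longleftrightarrow> (\<forall>j. j \<epsilon> om \<longrightarrow> \<langle>j, i\<rangle> \<epsilon> L \<longrightarrow> h \<cdot> j \<epsilon> x) \<and>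
      (\<forall>n. n \<epsilon> om \<longrightarrow> i \<epsilon> n \<longrightarrow> x \<epsilon> Hs (?p n) \<cdot> (h \<restriction> sep n (\<lambda>j. \<langle>j, i\<rangle> \<epsilon> L)))" for i h x
    have mL: "j \<epsilon> sep om (\<lambda>j. \<langle>j, i\<rangle> \<epsilon> L) \<longleftrightarrow> j \<epsilon> om \<and> \<langle>j, i\<rangle> \<epsilon> L" for i j by (rule mem_sep) (intro dfn)
    have "\<exists>f. maps f om K \<and> (\<forall>i. i \<epsilon> om \<longrightarrow> Q i (f \<restriction> sep om (\<lambda>j. \<langle>j, i\<rangle> \<epsilon> L)) (f \<cdot> i))"
    proof (rule wf_choice[OF wfL])
      show "definable (\<lambda>e. \<langle>e 0, e 1\<rangle> \<epsilon> L)" by (intro dfn)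
      show "definable (\<lambda>e. Q (e 0) (e 1) (e 2))" unfolding Q_def by (intro dfn)
      fix i h assume i: "i \<epsilon> om" and h: "maps h (sep om (\<lambda>j. \<langle>j, i\<rangle> \<epsilon> L)) K"
      \<comment> \<open>Both kinds of conditions are indexed by the same \<open>n\<close>: obeying
        stage \<open>n\<close>, and lying above the value at \<open>n\<close>. Where a condition is
        void the set is \<open>K\<close>, so countable completeness applies to one family.\<close>
      let ?F = "\<lambda>n. (if i \<epsilon> n then Hs (?p n) \<cdot> (h \<restriction> sep n (\<lambda>j. \<langle>j, i\<rangle> \<epsilon> L)) else K) \<sqinter>
        (if \<langle>n, i\<rangle> \<epsilon> L then K \<ominus> suc (h \<cdot> n) else K)"
      have "\<exists>x. x \<epsilon> K \<and> (\<forall>n. n \<epsilon> om \<longrightarrow> x \<epsilon> ?F n)"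
      proof (rule U_Inter_ex)
        show "dterm (\<lambda>e. ?F (e 0))" by (intro dfn)
        fix n assume n: "n \<epsilon> om"
        have "(if i \<epsilon> n then Hs (?p n) \<cdot> (h \<restriction> sep n (\<lambda>j. \<langle>j, i\<rangle> \<epsilon> L)) else K) \<epsilon> U"
        proof (cases "i \<epsilon> n")
          case True
          have s1: "sep n (\<lambda>j. \<langle>j, i\<rangle> \<epsilon> L) \<sqsubseteq> sep om (\<lambda>j. \<langle>j, i\<rangle> \<epsilon> L)"
            unfolding subset_of_def mem_below mL using om_mem[OF n] by blast
          have s2: "sep om (\<lambda>j. \<langle>j, i\<rangle> \<epsilon> L) \<sqsubseteq> om" unfolding subset_of_def mL by blast
          have "h \<restriction> sep n (\<lambda>j. \<langle>j, i\<rangle> \<epsilon> L) \<epsilon> PF"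
            by (rule maps_PF[OF maps_res[OF h s1] sub_trans[OF s1 s2]])
          then show ?thesis using True Hs[OF pI[OF n]] unfolding maps_def by simp
        qed (simp add: U_top)
        moreover have "(if \<langle>n, i\<rangle> \<epsilon> L then K \<ominus> suc (h \<cdot> n) else K) \<epsilon> U"
          using U_final U_top h n mL unfolding maps_def by simp
        ultimately show "?F n \<epsilon> U" by (rule U_int)
      qed
      then obtain x where x: "x \<epsilon> K" "\<And>n. n \<epsilon> om \<Longrightarrow> x \<epsilon> ?F n" by blast
      have "h \<cdot> j \<epsilon> x" if j: "j \<epsilon> om" "\<langle>j, i\<rangle> \<epsilon> L" for j
      proof -
        have "h \<cdot> j \<epsilon> K" using h j mL unfolding maps_def by blast
        moreover have "x \<epsilon> K \<ominus> suc (h \<cdot> j)" using x(2)[OF j(1)] j(2) by simp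
        ultimately show ?thesis using ord_linear[of x "h \<cdot> j"] ord_mem_ord[OF K_ord] by auto
      qed
      moreover have "x \<epsilon> Hs (?p n) \<cdot> (h \<restriction> sep n (\<lambda>j. \<langle>j, i\<rangle> \<epsilon> L))" if "n \<epsilon> om" "i \<epsilon> n" for n
        using x(2)[OF that(1)] that(2) by simp
      ultimately show "\<exists>x. x \<epsilon> K \<and> Q i h x" using x(1) unfolding Q_def by blast
    qed
    then obtain f where f: "maps f om K"
      and Qf: "\<And>i. i \<epsilon> om \<Longrightarrow> Q i (f \<restriction> sep om (\<lambda>j. \<langle>j, i\<rangle> \<epsilon> L)) (f \<cdot> i)" by blast
    have f_mono: "f \<cdot> j \<epsilon> f \<cdot> i" if "j \<epsilon> om" "i \<epsilon> om" "\<langle>j, i\<rangle> \<epsilon> L" for i j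
      using Qf[OF that(2)] that mL[of j i] unfolding Q_def by auto
    have f_iff: "f \<cdot> i \<epsilon> f \<cdot> j \<longleftrightarrow> \<langle>i, j\<rangle> \<epsilon> L" if "i \<epsilon> om" "j \<epsilon> om" for i j
      using f_mono that L(2) mem_asym[of "f \<cdot> i" "f \<cdot> j"] unfolding lin_order_def by (metis mem_irrefl)
    have f_obeys: "obeys (Hs (?p n)) (f \<restriction> n) n (L \<sqinter> (n \<otimes> n))" if n: "n \<epsilon> om" for n
      unfolding obeys_def
    proof (intro allI impI)
      fix i assume i: "i \<epsilon> n"
      have io: "i \<epsilon> om" by (rule om_mem[OF n i])
      have e1: "sep n (\<lambda>j. \<langle>j, i\<rangle> \<epsilon> L \<sqinter> (n \<otimes> n)) = sep n (\<lambda>j. \<langle>j, i\<rangle> \<epsilon> L)"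
        by (rule ext, unfold mem_below) (use i in auto)
      have "f \<cdot> i \<epsilon> Hs (?p n) \<cdot> (f \<restriction> sep om (\<lambda>j. \<langle>j, i\<rangle> \<epsilon> L) \<restriction> sep n (\<lambda>j. \<langle>j, i\<rangle> \<epsilon> L))"
        using Qf[OF io] n i unfolding Q_def by blast
      also have "f \<restriction> sep om (\<lambda>j. \<langle>j, i\<rangle> \<epsilon> L) \<restriction> sep n (\<lambda>j. \<langle>j, i\<rangle> \<epsilon> L) = f \<restriction> sep n (\<lambda>j. \<langle>j, i\<rangle> \<epsilon> L)"
        by (rule res_res) (unfold subset_of_def mem_below mL, use om_mem[OF n] in blast)
      also have "\<dots> = f \<restriction> n \<restriction> sep n (\<lambda>j. \<langle>j, i\<rangle> \<epsilon> L)"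
        by (rule res_res[symmetric]) (unfold subset_of_def mem_below, blast)
      finally show "f \<restriction> n \<cdot> i \<epsilon> Hs (?p n) \<cdot> (f \<restriction> n \<restriction> sep n (\<lambda>j. \<langle>j, i\<rangle> \<epsilon> L \<sqinter> (n \<otimes> n)))"
        unfolding e1 using i by simp
    qed
    define q where "q n = \<langle>g \<cdot> n, \<langle>y \<restriction> n, f \<restriction> n\<rangle>\<rangle>" for n
    have q: "sq (q n) = g \<cdot> n" "yq (q n) = y \<restriction> n" "fq (q n) = f \<restriction> n" for n unfolding q_def by simp_all
    have f_res: "maps (f \<restriction> n) n K" if "n \<epsilon> om" for n by (rule maps_res[OF f om_sub[OF that]])
    have qSt: "q n \<epsilon> St" if n: "n \<epsilon> om" for n
    proof -
      have "init ?a (g \<cdot> n)" using Jg[OF n] init_sext ts(2)[OF pI[OF n]] unfolding J_def Psq by blast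
      then have "legal (q n)" unfolding legal_def q
        using n y_res[OF n] f_res[OF n] C f_iff om_mem[OF n]
        by (intro exI[of _ n] exI[of _ ?a] exI[of _ y] exI[of _ L]) simp
      then show ?thesis unfolding mem_St
        using gs[OF n] n f_res[OF n] maps_res[OF y om_sub[OF n]] by (auto simp: q_def mem_seqs)
    qed
    have qcont: "cont (q n) (q (suc n))" if n: "n \<epsilon> om" for n
    proof -
      have "n \<sqsubseteq> suc n" by (auto intro: subI)
      then show ?thesis unfolding cont_def q
        using n f_res[OF n] f_res[OF suc_om[OF n]] by (intro exI[of _ n]) (auto simp: maps_def res_res)
    qed
    have q\<tau>: "\<tau> \<cdot> q n = ts (?p n)" if "n \<epsilon> om" "q n \<epsilon> W" for n
      using decided[where k = n and l = "L \<sqinter> (n \<otimes> n)", OF _ that(1) y_res[OF that(1)] f_res[OF that(1)]]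
        pI[OF that(1)] f_obeys[OF that(1)] that(2) unfolding q_def P_def by blast
    have qext: "sext (\<tau> \<cdot> q n) (sq (q (suc n)))" if "n \<epsilon> om" "q n \<epsilon> W" for n
      unfolding q\<tau>[OF that] q using g(3)[OF that(1)] Jg[OF that(1)] by blast
    have dq: "dterm (\<lambda>e. q (e 0))" unfolding q_def by (intro dfn)
    have qW: "q n \<epsilon> W" if "n \<epsilon> om" for n
    proof (rule om_induct[OF _ that])
      show "definable (\<lambda>e. q (e 0) \<epsilon> W)" by (intro dfn dq)
      have "f \<restriction> \<emptyset> = \<emptyset>" using f_res[OF zero_om] func_empty_iff unfolding maps_def by blast
      then show "q \<emptyset> \<epsilon> W" by (intro W qSt) (simp_all add: q)
      show "q (suc n) \<epsilon> W" if "n \<epsilon> om" "q n \<epsilon> W" for n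
        by (rule stay[OF that(2) qSt[OF suc_om[OF that(1)]] qext[OF that] qcont[OF that(1)]])
    qed
    \<comment> \<open>An infinite play inside \<open>W\<close> according to \<open>\<tau>\<close>
      contradicts the wellfoundedness of the winning positions.\<close>
    have "repl om q \<sqsubseteq> W" by (rule subI) (use qW mem_repl[OF dq] in auto)
    moreover have "repl om q \<noteq> \<emptyset>" unfolding eq_emp_iff mem_repl[OF dq] using zero_om by blast
    ultimately obtain n where "n \<epsilon> om" "\<And>m. m \<epsilon> om \<Longrightarrow> \<not> (sext (\<tau> \<cdot> q n) (sq (q m)) \<and> cont (q n) (q m))"
      using wf[of "repl om q"] unfolding mem_repl[OF dq] by blast
    then show False using qext qcont qW suc_om by blast
  qed
  then show ?thesis using a(1) by blast
qed

text \<open>Openings are positions without ordinals. If all of them are in \<open>W\<close>, the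
  opponent wins and a generic real has no variant in the projection. If one is not, the builder can
  stay outside \<open>W\<close> forever, even in two coupled plays.\<close>

theorem no_transversal:
  assumes "\<And>a n. n \<epsilon> om \<Longrightarrow> projection a \<Longrightarrow> \<not> projection (flip n a)"
    and "\<And>a. a \<sqsubseteq> om \<Longrightarrow> \<exists>v. v \<epsilon> str \<and> projection (var a v)"
  shows False
proof -
  have ok: "definable (\<lambda>e. sext (sq (e 0)) (e 1))" by (intro dfn)
  have mv: "definable (\<lambda>e. sext (e 1) (sq (e 2)) \<and> cont (e 0) (e 2))" by (intro dfn)
  obtain W \<tau> where W: "W \<sqsubseteq> St"
    "\<And>q u. q \<epsilon> St \<Longrightarrow> \<not> q \<epsilon> W \<Longrightarrow> u \<epsilon> str \<Longrightarrow> sext (sq q) u \<Longrightarrow>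
      \<exists>q'. q' \<epsilon> St \<and> \<not> q' \<epsilon> W \<and> sext u (sq q') \<and> cont q q'"
    "maps \<tau> W str" "\<And>q. q \<epsilon> W \<Longrightarrow> sext (sq q) (\<tau> \<cdot> q)"
    "\<And>q q'. q \<epsilon> W \<Longrightarrow> q' \<epsilon> St \<Longrightarrow> sext (\<tau> \<cdot> q) (sq q') \<Longrightarrow> cont q q' \<Longrightarrow> q' \<epsilon> W"
    "\<And>X. X \<sqsubseteq> W \<Longrightarrow> X \<noteq> \<emptyset> \<Longrightarrow> \<exists>q. q \<epsilon> X \<and> (\<forall>q'. q' \<epsilon> X \<longrightarrow> \<not> (sext (\<tau> \<cdot> q) (sq q') \<and> cont q q'))"
    using open_game[where ok = "\<lambda>q u. sext (sq q) u" and mv = "\<lambda>q u q'. sext u (sq q') \<and> cont q q'" and S = St and M = str, OF ok mv]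
    by blast
  show False
  proof (cases "\<forall>q. q \<epsilon> St \<longrightarrow> fq q = \<emptyset> \<longrightarrow> q \<epsilon> W")
    case True
    have "\<exists>a. a \<sqsubseteq> om \<and> (\<forall>v. v \<epsilon> str \<longrightarrow> \<not> projection (var a v))"
      by (rule lost_game[OF _ W(3)]) (use True W(4-6) in blast)+
    then show ?thesis using assms(2) by blast
  next
    case False
    then obtain q0 where q0: "q0 \<epsilon> St" "\<not> q0 \<epsilon> W" by blast
    have m: "q \<epsilon> St \<ominus> W \<longleftrightarrow> q \<epsilon> St \<and> \<not> q \<epsilon> W" for q by simp
    have "\<exists>n a. n \<epsilon> om \<and> projection a \<and> projection (flip n a)"
    proof (rule copied_play)
      show "St \<ominus> W \<sqsubseteq> St" by (auto intro: subI)
      show "q0 \<epsilon> St \<ominus> W" using q0 by simp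
      show "\<exists>q'. q' \<epsilon> St \<ominus> W \<and> sext u (sq q') \<and> cont q q'"
        if "q \<epsilon> St \<ominus> W" "u \<epsilon> str" "sext (sq q) u" for q u
        using W(2)[of q u] that unfolding m by blast
    qed
    then show ?thesis using assms(1) by blast
  qed
qed

end

section \<open>Coding witnesses of a \<open>\<Sigma>\<^sub>1\<close>-formula by reals\<close>

text \<open>The quantifier block survives only as the set \<open>I\<close> of variables that it may
  change; this covers empty blocks and repeated variables uniformly.\<close>

lemma Sigma1_prenex:
  fixes E :: "'a \<Rightarrow> 'a \<Rightarrow> bool"
  assumes "Sigma1 \<phi>"
  shows "\<exists>\<psi> I. Delta0 \<psi> \<and> finite I \<and> fv \<psi> \<subseteq> fv \<phi> \<union> I \<and>
    (\<forall>e. sat E e \<phi> \<longleftrightarrow> (\<exists>e'. (\<forall>i. i \<notin> I \<longrightarrow> e' i = e i) \<and> sat E e' \<psi>))"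
  using assms
proof induction
  case (1 \<phi>)
  have "(\<forall>i. e' i = e i) \<longleftrightarrow> e' = e" for e e' :: "nat \<Rightarrow> 'a" by (simp add: fun_eq_iff)
  then show ?case using 1 by (intro exI[of _ \<phi>] exI[of _ "{}"]) simp
next
  case (2 \<phi> i)
  then obtain \<psi> I where \<psi>: "Delta0 \<psi>" "finite I" "fv \<psi> \<subseteq> fv \<phi> \<union> I"
    "\<And>e. sat E e \<phi> \<longleftrightarrow> (\<exists>e'. (\<forall>i. i \<notin> I \<longrightarrow> e' i = e i) \<and> sat E e' \<psi>)" by blast
  have "sat E e (Ex i \<phi>) \<longleftrightarrow> (\<exists>e'. (\<forall>j. j \<notin> insert i I \<longrightarrow> e' j = e j) \<and> sat E e' \<psi>)" for e
  proof
    assume "sat E e (Ex i \<phi>)"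
    then obtain a e' where "\<forall>j. j \<notin> I \<longrightarrow> e' j = (e(i := a)) j" "sat E e' \<psi>" by (auto simp: \<psi>(4))
    then show "\<exists>e'. (\<forall>j. j \<notin> insert i I \<longrightarrow> e' j = e j) \<and> sat E e' \<psi>"
      by (intro exI[of _ e']) auto
  next
    assume "\<exists>e'. (\<forall>j. j \<notin> insert i I \<longrightarrow> e' j = e j) \<and> sat E e' \<psi>"
    then obtain e' where "\<forall>j. j \<notin> insert i I \<longrightarrow> e' j = e j" "sat E e' \<psi>" by blast
    then have "sat E (e(i := e' i)) \<phi>" unfolding \<psi>(4) by (intro exI[of _ e']) auto
    then show "sat E e (Ex i \<phi>)" by auto
  qed
  then show ?case using \<psi>(1-3) by (intro exI[of _ \<psi>] exI[of _ "insert i I"]) auto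
qed

section \<open>A bounded formula for ordered pairs\<close>

definition ExB :: "nat \<Rightarrow> nat \<Rightarrow> fm \<Rightarrow> fm" where "ExB i j \<phi> = Ex i (And (Mem i j) \<phi>)"
definition AllB :: "nat \<Rightarrow> nat \<Rightarrow> fm \<Rightarrow> fm" where "AllB i j \<phi> = Neg (ExB i j (Neg \<phi>))"
definition Or :: "fm \<Rightarrow> fm \<Rightarrow> fm" where "Or \<phi> \<psi> = Neg (And (Neg \<phi>) (Neg \<psi>))"

lemma sat_derived [simp]:
  "sat E e (ExB i j \<phi>) \<longleftrightarrow> (\<exists>a. E a ((e(i := a)) j) \<and> sat E (e(i := a)) \<phi>)"
  "sat E e (AllB i j \<phi>) \<longleftrightarrow> (\<forall>a. E a ((e(i := a)) j) \<longrightarrow> sat E (e(i := a)) \<phi>)"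
  "sat E e (Or \<phi> \<psi>) \<longleftrightarrow> sat E e \<phi> \<or> sat E e \<psi>"
  unfolding ExB_def AllB_def Or_def by auto

lemma Delta0_derived:
  "Delta0 \<phi> \<Longrightarrow> i \<noteq> j \<Longrightarrow> Delta0 (ExB i j \<phi>)" "Delta0 \<phi> \<Longrightarrow> i \<noteq> j \<Longrightarrow> Delta0 (AllB i j \<phi>)"
  "Delta0 \<phi> \<Longrightarrow> Delta0 \<psi> \<Longrightarrow> Delta0 (Or \<phi> \<psi>)"
  unfolding ExB_def AllB_def Or_def by (auto intro!: Delta0.intros)

text \<open>\<open>s\<close> and \<open>t\<close> are the two members of Kuratowski's pair. All
  quantifiers are bounded by \<open>p\<close>, \<open>s\<close> or \<open>t\<close>, so the matrix
  stays \<open>Delta0\<close>.\<close>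

definition pair_fm :: "nat \<Rightarrow> nat \<Rightarrow> nat \<Rightarrow> nat \<Rightarrow> nat \<Rightarrow> nat \<Rightarrow> fm" where
  "pair_fm p a b s t z = ExB s p (ExB t p (And (And (Mem a s) (AllB z s (Eq z a)))
    (And (And (Mem a t) (And (Mem b t) (AllB z t (Or (Eq z a) (Eq z b))))) (AllB z p (Or (Eq z s) (Eq z t))))))"

lemma Delta0_pair_fm: "distinct [p, a, b, s, t, z] \<Longrightarrow> Delta0 (pair_fm p a b s t z)"
  unfolding pair_fm_def by (intro Delta0_derived Delta0.intros) auto

lemma fv_pair_fm: "fv (pair_fm p a b s t z) \<subseteq> {p, a, b, s, t, z}"
  unfolding pair_fm_def ExB_def AllB_def Or_def by auto

lemma (in zfc) sat_pair_fm:
  assumes "distinct [p, a, b, s, t, z]"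
  shows "sat E e (pair_fm p a b s t z) \<longleftrightarrow> e p = \<langle>e a, e b\<rangle>"
proof -
  have "sat E e (pair_fm p a b s t z) \<longleftrightarrow> (\<exists>s. s \<epsilon> e p \<and> (\<exists>t. t \<epsilon> e p \<and> (e a \<epsilon> s \<and> (\<forall>z. z \<epsilon> s \<longrightarrow> z = e a)) \<and>
    (e a \<epsilon> t \<and> e b \<epsilon> t \<and> (\<forall>z. z \<epsilon> t \<longrightarrow> z = e a \<or> z = e b)) \<and> (\<forall>z. z \<epsilon> e p \<longrightarrow> z = s \<or> z = t)))"
    unfolding pair_fm_def using assms by simp
  also have "\<dots> \<longleftrightarrow> (\<exists>s. s \<epsilon> e p \<and> (\<exists>t. t \<epsilon> e p \<and> s = upr (e a) (e a) \<and> t = upr (e a) (e b) \<and>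
      (\<forall>z. z \<epsilon> e p \<longrightarrow> z = s \<or> z = t)))"
  proof -
    have 1: "(e a \<epsilon> s \<and> (\<forall>z. z \<epsilon> s \<longrightarrow> z = e a)) \<longleftrightarrow> s = upr (e a) (e a)" for s
      by (rule iffI, rule ext, auto)
    have 2: "(e a \<epsilon> t \<and> e b \<epsilon> t \<and> (\<forall>z. z \<epsilon> t \<longrightarrow> z = e a \<or> z = e b)) \<longleftrightarrow> t = upr (e a) (e b)" for t
      by (rule iffI, rule ext, auto)
    show ?thesis unfolding 1 2 ..
  qed
  also have "\<dots> \<longleftrightarrow> e p = \<langle>e a, e b\<rangle>"
  proof
    assume "\<exists>s. s \<epsilon> e p \<and> (\<exists>t. t \<epsilon> e p \<and> s = upr (e a) (e a) \<and> t = upr (e a) (e b) \<and>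
      (\<forall>z. z \<epsilon> e p \<longrightarrow> z = s \<or> z = t))"
    then have "z \<epsilon> e p \<longleftrightarrow> z = upr (e a) (e a) \<or> z = upr (e a) (e b)" for z by blast
    then show "e p = \<langle>e a, e b\<rangle>" unfolding opair_def by (intro ext) simp
  qed (simp add: opair_def)
  finally show ?thesis .
qed

text \<open>The definition speaks of a pair, the argument of two reals. The pair is made one more
  witness, so that a bounded matrix relates \<open>a\<close>, \<open>b\<close> and \<open>x\<close>
  directly; all variables except \<open>u\<close>, \<open>v\<close>, \<open>w\<close> hold
  witnesses.\<close>

lemma (in zfc) Sigma1_relation:
  assumes "Sigma1_definable E x R"
  shows "\<exists>\<chi> u v w N. Delta0 \<chi> \<and> fv \<chi> \<subseteq> {..<N} \<and> distinct [u, v, w] \<and> u < N \<and> v < N \<and> w < N \<and>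
    (\<forall>a b. \<langle>a, b\<rangle> \<epsilon> R \<longleftrightarrow> (\<exists>e. e u = a \<and> e v = b \<and> e w = x \<and> sat E e \<chi>))"
proof -
  obtain \<phi> where \<phi>: "Sigma1 \<phi>" "fv \<phi> \<subseteq> {0, 1}" "\<And>z. z \<epsilon> R \<longleftrightarrow> sat E (\<lambda>i. if i = 0 then z else x) \<phi>"
    using assms unfolding Sigma1_definable_def by blast
  obtain \<psi> I where \<psi>: "Delta0 \<psi>" "finite I" "fv \<psi> \<subseteq> fv \<phi> \<union> I"
    "\<And>e. sat E e \<phi> \<longleftrightarrow> (\<exists>e'. (\<forall>i. i \<notin> I \<longrightarrow> e' i = e i) \<and> sat E e' \<psi>)"
    using Sigma1_prenex[OF \<phi>(1), of E] by blast
  obtain M where "\<forall>i\<in>I \<union> {0, 1}. i \<le> M" using \<psi>(2) finite_nat_set_iff_bounded_le[of "I \<union> {0, 1}"] by auto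
  then have M: "\<And>i. i \<in> I \<union> {0, 1} \<Longrightarrow> i \<le> M" by blast
  have M1: "1 \<le> M" using M[of 1] by simp
  define p u v w s t z where defs: "p = M + 1" "u = M + 2" "v = M + 3" "w = M + 4" "s = M + 5" "t = M + 6" "z = M + 7"
  have fvM: "i \<le> M" if "i \<in> fv \<psi>" for i using that \<psi>(3) \<phi>(2) M by blast
  have dist: "distinct [p, u, v, s, t, z]" by (simp add: defs)
  \<comment> \<open>If the block quantifies variable 0 or 1 again, that variable is itself a witness
    and must not be tied to the pair or to \<open>x\<close>; \<open>Eq w w\<close> is then a true
    filler.\<close>
  define \<chi> where "\<chi> = And \<psi> (And (pair_fm p u v s t z)
    (And (if 0 \<in> I then Eq w w else Eq 0 p) (if 1 \<in> I then Eq w w else Eq 1 w)))"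
  have "Delta0 \<chi>" unfolding \<chi>_def by (auto intro!: Delta0.intros \<psi> Delta0_pair_fm dist)
  moreover have "fv \<chi> \<subseteq> {..<M + 8}" unfolding \<chi>_def
    using fv_pair_fm[of p u v s t z] by (auto simp: defs dest!: fvM)
  moreover have "\<langle>a, b\<rangle> \<epsilon> R \<longleftrightarrow> (\<exists>e. e u = a \<and> e v = b \<and> e w = x \<and> sat E e \<chi>)" for a b
  proof
    assume "\<langle>a, b\<rangle> \<epsilon> R"
    then obtain e' where e': "\<And>i. i \<notin> I \<Longrightarrow> e' i = (if i = 0 then \<langle>a, b\<rangle> else x)" "sat E e' \<psi>"
      unfolding \<phi>(3) \<psi>(4) by blast
    let ?e = "e'(p := \<langle>a, b\<rangle>, u := a, v := b, w := x)"
    have "sat E ?e \<psi>" using e'(2) by (subst sat_fv_cong[of \<psi> ?e e']) (auto dest!: fvM simp: defs)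
    moreover have "sat E ?e (pair_fm p u v s t z)" unfolding sat_pair_fm[OF dist] by (simp add: defs)
    ultimately have "sat E ?e \<chi>" unfolding \<chi>_def using e'(1)[of 0] e'(1)[of 1] M1 by (auto simp: defs)
    then show "\<exists>e. e u = a \<and> e v = b \<and> e w = x \<and> sat E e \<chi>"
      by (intro exI[of _ ?e]) (simp add: defs)
  next
    assume "\<exists>e. e u = a \<and> e v = b \<and> e w = x \<and> sat E e \<chi>"
    then obtain e where e: "e u = a" "e v = b" "e w = x" "sat E e \<chi>" by blast
    have ep: "e p = \<langle>a, b\<rangle>" using e(4) unfolding \<chi>_def by (simp add: sat_pair_fm[OF dist] e)
    have e01: "0 \<notin> I \<Longrightarrow> e 0 = \<langle>a, b\<rangle>" "1 \<notin> I \<Longrightarrow> e 1 = x"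
      using e(3,4) ep unfolding \<chi>_def by auto
    let ?e = "\<lambda>i. if i \<in> I then e i else if i = 0 then \<langle>a, b\<rangle> else x"
    have "sat E ?e \<psi>"
      by (subst sat_fv_cong[of \<psi> ?e e]) (use e(4) e01 \<psi>(3) \<phi>(2) in \<open>auto simp: \<chi>_def\<close>)
    then show "\<langle>a, b\<rangle> \<epsilon> R" unfolding \<phi>(3) \<psi>(4) by (intro exI[of _ ?e]) auto
  qed
  ultimately show ?thesis
    by (intro exI[of _ \<chi>] exI[of _ u] exI[of _ v] exI[of _ w] exI[of _ "M + 8"]) (auto simp: defs)
qed

context zfc begin

subsection \<open>Codes for assignments\<close>

primrec num :: "nat \<Rightarrow> 'a" where
  "num 0 = \<emptyset>"
| "num (Suc i) = suc (num i)"

lemma num_om [simp]: "num i \<epsilon> om" by (induction i) auto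

lemma num_inject [simp]: "num i = num j \<longleftrightarrow> i = j"
proof (induction i arbitrary: j)
  case 0
  show ?case by (cases j) auto
next
  case (Suc i)
  then show ?case by (cases j) auto
qed

text \<open>Iterated unpairing lets every number code a value for each variable. A whole assignment
  is thus a single argument, and all Skolem functions become unary.\<close>

primrec nthc :: "nat \<Rightarrow> 'a \<Rightarrow> 'a" where
  "nthc 0 c = prl c"
| "nthc (Suc i) c = nthc i (prr c)"

primrec updc :: "nat \<Rightarrow> 'a \<Rightarrow> 'a \<Rightarrow> 'a" where
  "updc 0 m c = pr m (prr c)"
| "updc (Suc i) m c = pr (prl c) (updc i m (prr c))"

primrec mkc :: "nat \<Rightarrow> (nat \<Rightarrow> 'a) \<Rightarrow> 'a" where
  "mkc 0 \<nu> = \<emptyset>"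
| "mkc (Suc n) \<nu> = updc n (\<nu> n) (mkc n \<nu>)"

lemma dterm_nthc [dfn]: "dterm t \<Longrightarrow> dterm (\<lambda>e. nthc i (t e))"
  by (induction i arbitrary: t) (auto intro!: dfn)

lemma dterm_updc [dfn]: "dterm s \<Longrightarrow> dterm t \<Longrightarrow> dterm (\<lambda>e. updc i (s e) (t e))"
  by (induction i arbitrary: t) (auto intro!: dfn)

lemma nthc_om [simp]: "c \<epsilon> om \<Longrightarrow> nthc i c \<epsilon> om"
  by (induction i arbitrary: c) auto

lemma nthc_le: "c \<epsilon> om \<Longrightarrow> nthc i c \<epsilon> suc c"
proof (induction i arbitrary: c)
  case (Suc i)
  then have "nthc i (prr c) \<epsilon> suc (prr c)" by simp
  then show ?case using prr_le[OF Suc.prems] om_trans[of "nthc i (prr c)" "prr c" c] Suc.prems by auto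
qed (auto dest: prl_le)

lemma updc_om [simp]: "c \<epsilon> om \<Longrightarrow> m \<epsilon> om \<Longrightarrow> updc i m c \<epsilon> om"
  by (induction i arbitrary: c) auto

lemma nthc_updc [simp]: "c \<epsilon> om \<Longrightarrow> m \<epsilon> om \<Longrightarrow> nthc j (updc i m c) = (if j = i then m else nthc j c)"
proof (induction i arbitrary: c j)
  case 0
  then show ?case by (cases j) auto
next
  case (Suc i)
  then show ?case by (cases j) auto
qed

lemma mkc_om: "(\<And>i. i < n \<Longrightarrow> \<nu> i \<epsilon> om) \<Longrightarrow> mkc n \<nu> \<epsilon> om"
  by (induction n) auto

lemma nthc_mkc: "(\<And>i. i < n \<Longrightarrow> \<nu> i \<epsilon> om) \<Longrightarrow> i < n \<Longrightarrow> nthc i (mkc n \<nu>) = \<nu> i"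
  by (induction n) (auto simp: mkc_om less_Suc_eq)

lemma comp_updc:
  assumes "c \<epsilon> om" "m \<epsilon> om"
  shows "(\<lambda>j. f \<cdot> nthc j (updc i m c)) = (\<lambda>j. f \<cdot> nthc j c)(i := f \<cdot> m)"
  using assms by auto

text \<open>The index set of the Skolem functions.\<close>

primrec exs :: "fm \<Rightarrow> (nat \<times> fm) set" where
  "exs (Mem i j) = {}"
| "exs (Eq i j) = {}"
| "exs (Neg \<phi>) = exs \<phi>"
| "exs (And \<phi> \<psi>) = exs \<phi> \<union> exs \<psi>"
| "exs (Ex i \<phi>) = insert (i, \<phi>) (exs \<phi>)"

lemma finite_exs: "finite (exs \<phi>)" by (induction \<phi>) auto

subsection \<open>Transitive closure and rank\<close>

lemma transitive_superset: "\<exists>T. transitive_set E T \<and> X \<sqsubseteq> T"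
proof -
  have "dterm (\<lambda>e. uni (e 1))" by (intro dfn)
  from om_rec[where H = "\<lambda>n y. uni y", OF this, of X] obtain f
    where f: "f \<cdot> \<emptyset> = X" "\<And>n. n \<epsilon> om \<Longrightarrow> f \<cdot> suc n = uni (f \<cdot> n)" by blast
  have d: "dterm (\<lambda>e. f \<cdot> e 0)" by (intro dfn)
  let ?T = "uni (repl om (\<lambda>n. f \<cdot> n))"
  have m: "y \<epsilon> ?T \<longleftrightarrow> (\<exists>n. n \<epsilon> om \<and> y \<epsilon> f \<cdot> n)" for y by (auto simp: mem_repl[OF d])
  have "X \<sqsubseteq> ?T" unfolding subset_of_def m using f(1) zero_om by metis
  moreover have "transitive_set E ?T" unfolding transitive_set_def subset_of_def m
    using f(2) suc_om mem_uni by metis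
  ultimately show ?thesis by blast
qed

text \<open>Membership is not linear; ranks provide the linear order on a coded structure that the
  game requires.\<close>

lemma rank_function:
  assumes T: "transitive_set E T"
  shows "\<exists>\<rho>. (\<forall>z. z \<epsilon> T \<longrightarrow> is_ordinal E (\<rho> \<cdot> z)) \<and> (\<forall>y z. z \<epsilon> T \<longrightarrow> y \<epsilon> z \<longrightarrow> \<rho> \<cdot> y \<epsilon> \<rho> \<cdot> z)"
proof -
  let ?G = "\<lambda>z h. uni (repl z (\<lambda>y. suc (h \<cdot> y)))"
  have "definable (\<lambda>e. e 0 \<epsilon> e 1)" "dterm (\<lambda>e. ?G (e 0) (e 1))" by (intro dfn)+
  from wf_recursion[where r = "(\<epsilon>)" and G = ?G, OF wf_on_mem[of T] this] obtain \<rho>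
    where \<rho>: "\<And>z. z \<epsilon> T \<Longrightarrow> \<rho> \<cdot> z = ?G z (\<rho> \<restriction> sep T (\<lambda>y. y \<epsilon> z))" by blast
  have ms: "y \<epsilon> sep T (\<lambda>y. y \<epsilon> z) \<longleftrightarrow> y \<epsilon> T \<and> y \<epsilon> z" for y z by (rule mem_sep) (intro dfn)
  have in_T: "y \<epsilon> T" if "z \<epsilon> T" "y \<epsilon> z" for y z using T that unfolding transitive_set_def subset_of_def by blast
  have m: "v \<epsilon> \<rho> \<cdot> z \<longleftrightarrow> (\<exists>y. y \<epsilon> z \<and> v \<epsilon> suc (\<rho> \<cdot> y))" if z: "z \<epsilon> T" for z v
  proof -
    have d: "dterm (\<lambda>e. suc (\<rho> \<restriction> sep T (\<lambda>y. y \<epsilon> z) \<cdot> e 0))" by (intro dfn)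
    have "v \<epsilon> \<rho> \<cdot> z \<longleftrightarrow> (\<exists>y. y \<epsilon> z \<and> v \<epsilon> suc (\<rho> \<restriction> sep T (\<lambda>y. y \<epsilon> z) \<cdot> y))"
      unfolding \<rho>[OF z] mem_uni mem_repl[OF d] by blast
    also have "\<dots> \<longleftrightarrow> (\<exists>y. y \<epsilon> z \<and> v \<epsilon> suc (\<rho> \<cdot> y))"
      using in_T[OF z] ms app_res[of _ "sep T (\<lambda>y. y \<epsilon> z)" \<rho>] by metis
    finally show ?thesis .
  qed
  have "is_ordinal E (\<rho> \<cdot> z)" if "z \<epsilon> T" for z
  proof (rule wf_on_induct[OF wf_on_mem[of T] _ _ that])
    show "definable (\<lambda>e. is_ordinal E (\<rho> \<cdot> e 0))" by (intro dfn)
    fix z assume z: "z \<epsilon> T" and IH: "\<And>y. y \<epsilon> T \<Longrightarrow> y \<epsilon> z \<Longrightarrow> is_ordinal E (\<rho> \<cdot> y)"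
    have d: "dterm (\<lambda>e. suc (\<rho> \<cdot> e 0))" by (intro dfn)
    have "\<rho> \<cdot> z = uni (repl z (\<lambda>y. suc (\<rho> \<cdot> y)))"
      by (rule ext, unfold m[OF z] mem_uni mem_repl[OF d]) blast
    moreover have "is_ordinal E \<dots>"
      by (rule ord_uni) (use IH in_T[OF z] ord_suc mem_repl[OF d] in auto)
    ultimately show "is_ordinal E (\<rho> \<cdot> z)" by simp
  qed
  moreover have "\<rho> \<cdot> y \<epsilon> \<rho> \<cdot> z" if "z \<epsilon> T" "y \<epsilon> z" for y z
    unfolding m[OF that(1)] using that(2) by auto
  ultimately show ?thesis by blast
qed

lemma cnt_enum: "cnt X \<Longrightarrow> x \<epsilon> X \<Longrightarrow> \<exists>f. maps f om X \<and> (\<forall>x. x \<epsilon> X \<longrightarrow> (\<exists>n. n \<epsilon> om \<and> x = f \<cdot> n))"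
proof -
  assume "cnt X" and x: "x \<epsilon> X"
  then obtain f where f: "\<And>x. x \<epsilon> X \<Longrightarrow> \<exists>n. n \<epsilon> om \<and> x = f \<cdot> n" unfolding cnt_def by blast
  have d: "dterm (\<lambda>e. if f \<cdot> e 0 \<epsilon> X then f \<cdot> e 0 else x)" by (intro dfn)
  let ?g = "lam om (\<lambda>n. if f \<cdot> n \<epsilon> X then f \<cdot> n else x)"
  have "maps ?g om X" by (rule maps_lam[OF d]) (simp add: x)
  moreover have "\<exists>n. n \<epsilon> om \<and> z = ?g \<cdot> n" if z: "z \<epsilon> X" for z
  proof -
    obtain n where "n \<epsilon> om" "z = f \<cdot> n" using f[OF z] by blast
    then show ?thesis using z app_lam[OF d, of n om] by (intro exI[of _ n]) simp
  qed
  ultimately show ?thesis by blast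
qed

end

subsection \<open>Structures on the natural numbers\<close>

text \<open>A structure \<open>e\<close> on \<open>om\<close> is to have a transitive collapse containing \<open>a\<close>, \<open>b\<close>, \<open>x\<close> and
  witnesses for \<open>\<chi>\<close>. Its elements are numbers with fixed roles: names for the elements of a
  countable transitive set enumerated by \<open>t\<close>, for \<open>a\<close>, for \<open>b\<close>, for a difference of two
  elements, for the witnesses and for values of Skolem functions. Together with a function \<open>g\<close>
  that locates the members of named sets this makes all requirements on \<open>e\<close> universal.\<close>

locale coding = zfc +
  fixes t :: 'a and x :: 'a and kx :: 'a and \<chi> :: fm and u v w N :: nat and idx :: "nat \<times> fm \<Rightarrow> nat"
  assumes t_trans: "k \<epsilon> om \<Longrightarrow> y \<epsilon> t \<cdot> k \<Longrightarrow> \<exists>j. j \<epsilon> om \<and> y = t \<cdot> j"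
    and t_om: "n \<epsilon> om \<Longrightarrow> \<exists>j. j \<epsilon> om \<and> n = t \<cdot> j"
    and kx: "kx \<epsilon> om" "t \<cdot> kx = x"
    and \<chi>: "Delta0 \<chi>" "fv \<chi> \<subseteq> {..<N}"
    and vars: "distinct [u, v, w]" "u < N" "v < N" "w < N"
    and idx: "inj_on idx (exs \<chi>)"
begin

text \<open>The first coordinate is the kind of the node. For kinds above 0 the node is larger than
  its argument, so that nodes can be interpreted by recursion on the numbers.\<close>

definition node :: "nat \<Rightarrow> 'a \<Rightarrow> 'a" where "node k c = pr (num k) c"

lemma dterm_node [dfn]: "dterm s \<Longrightarrow> dterm (\<lambda>e. node k (s e))" unfolding node_def by (intro dfn)

lemma node_om [simp]: "c \<epsilon> om \<Longrightarrow> node k c \<epsilon> om" unfolding node_def by simp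

lemma node_inject [simp]: "c \<epsilon> om \<Longrightarrow> d \<epsilon> om \<Longrightarrow> node k c = node l d \<longleftrightarrow> k = l \<and> c = d"
  unfolding node_def by simp

lemma node_gt: "c \<epsilon> om \<Longrightarrow> c \<epsilon> node (Suc k) c"
  unfolding node_def by (simp del: pr_suc add: pr_suc_gt2)

abbreviation rn :: "'a \<Rightarrow> 'a" where "rn k \<equiv> node 0 k"
abbreviation nA :: 'a where "nA \<equiv> node 1 \<emptyset>"
abbreviation nB :: 'a where "nB \<equiv> node 2 \<emptyset>"
abbreviation dn :: "'a \<Rightarrow> 'a \<Rightarrow> 'a" where "dn m n \<equiv> node 3 (pr m n)"
abbreviation wn :: "nat \<Rightarrow> 'a" where "wn i \<equiv> node 4 (num i)"
text \<open>Kinds 0 to 4 are taken by the other roles; injectivity of \<open>idx\<close> keeps the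
  Skolem functions apart.\<close>

abbreviation sn :: "nat \<Rightarrow> fm \<Rightarrow> 'a \<Rightarrow> 'a" where "sn i \<phi> c \<equiv> node (5 + idx (i, \<phi>)) c"

text \<open>In a good structure this is equality of collapsed values, expressed without a
  quantifier: \<open>dn m n\<close> has the duty to tell \<open>m\<close> and \<open>n\<close> apart
  whenever they differ. It is needed because one set may have several names.\<close>

definition eqv :: "('a \<Rightarrow> 'a \<Rightarrow> bool) \<Rightarrow> 'a \<Rightarrow> 'a \<Rightarrow> bool" where
  "eqv e m n \<longleftrightarrow> (e (dn m n) m \<longleftrightarrow> e (dn m n) n)"

text \<open>Truth after Skolemisation. No quantifier over numbers is left, so the value depends on
  finitely many instances of \<open>e\<close> and is stable under limits of codes.\<close>

primrec Sk :: "('a \<Rightarrow> 'a \<Rightarrow> bool) \<Rightarrow> fm \<Rightarrow> 'a \<Rightarrow> bool" where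
  "Sk e (Mem i j) c = e (nthc i c) (nthc j c)"
| "Sk e (Eq i j) c = eqv e (nthc i c) (nthc j c)"
| "Sk e (Neg \<phi>) c = (\<not> Sk e \<phi> c)"
| "Sk e (And \<phi> \<psi>) c = (Sk e \<phi> c \<and> Sk e \<psi> c)"
| "Sk e (Ex i \<phi>) c = Sk e \<phi> (updc i (sn i \<phi> c) c)"

definition q0 :: 'a where
  "q0 = mkc N (\<lambda>i. if i = u then nA else if i = v then nB else if i = w then rn kx else wn i)"

lemma q0_om [simp]: "q0 \<epsilon> om" unfolding q0_def by (rule mkc_om) (use kx in simp)

lemma nthc_q0: "i < N \<Longrightarrow> nthc i q0 = (if i = u then nA else if i = v then nB else if i = w then rn kx else wn i)"
  unfolding q0_def by (rule nthc_mkc) (use kx in simp_all)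

text \<open>This forces \<open>c\<close> to collapse to the set of those \<open>t \<cdot> j\<close>
  that satisfy \<open>P\<close>. That each member has a name is an existential demand;
  \<open>g\<close> supplies the witness and leaves a universal condition.\<close>

definition names :: "('a \<Rightarrow> 'a \<Rightarrow> bool) \<Rightarrow> ('a \<Rightarrow> 'a) \<Rightarrow> 'a \<Rightarrow> ('a \<Rightarrow> bool) \<Rightarrow> bool" where
  "names e g c P \<longleftrightarrow> (\<forall>m. m \<epsilon> om \<longrightarrow> e m c \<longrightarrow> g m \<epsilon> om \<and> P (t \<cdot> g m) \<and> eqv e m (rn (g m))) \<and>
     (\<forall>j. j \<epsilon> om \<longrightarrow> P (t \<cdot> j) \<longrightarrow> e (rn j) c)"

text \<open>The game certifies wellfoundedness for linear orders, while \<open>e\<close> is in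
  general not linear; the first condition transfers wellfoundedness from \<open>l\<close> to
  \<open>e\<close>.\<close>

definition Good :: "('a \<Rightarrow> 'a \<Rightarrow> bool) \<Rightarrow> ('a \<Rightarrow> 'a) \<Rightarrow> ('a \<Rightarrow> 'a \<Rightarrow> bool) \<Rightarrow> 'a \<Rightarrow> 'a \<Rightarrow> bool" where
  "Good e g l a b \<longleftrightarrow>
     (\<forall>m n. m \<epsilon> om \<longrightarrow> n \<epsilon> om \<longrightarrow> e m n \<longrightarrow> l m n) \<and>
     (\<forall>m n k. m \<epsilon> om \<longrightarrow> n \<epsilon> om \<longrightarrow> k \<epsilon> om \<longrightarrow> eqv e m n \<longrightarrow> (e k m \<longleftrightarrow> e k n) \<and> (e m k \<longleftrightarrow> e n k)) \<and>
     (\<forall>k. k \<epsilon> om \<longrightarrow> names e g (rn k) (\<lambda>y. y \<epsilon> t \<cdot> k)) \<and>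
     names e g nA (\<lambda>y. y \<epsilon> a) \<and> names e g nB (\<lambda>y. y \<epsilon> b) \<and>
     (\<forall>p\<in>exs \<chi>. \<forall>c m. c \<epsilon> om \<longrightarrow> m \<epsilon> om \<longrightarrow> Sk e (snd p) (updc (fst p) m c) \<longrightarrow> Sk e (Ex (fst p) (snd p)) c) \<and>
     Sk e \<chi> q0"

text \<open>The collapse \<open>\<pi>\<close> has a transitive range, in which bounded formulas keep
  their truth value, and the nodes listed in \<open>q0\<close> collapse to \<open>a\<close>,
  \<open>b\<close>, \<open>x\<close> and the witnesses.\<close>

lemma Good_sound:
  assumes good: "Good e g l a b" and e: "definable (\<lambda>s. e (s 0) (s 1))" and wf: "wf_on om l"
    and ab: "a \<sqsubseteq> om" "b \<sqsubseteq> om"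
  shows "\<exists>s. s u = a \<and> s v = b \<and> s w = x \<and> sat E s \<chi>"
proof -
  note [dfn] = definable_comp2[OF e]
  have G1: "\<And>m n. m \<epsilon> om \<Longrightarrow> n \<epsilon> om \<Longrightarrow> e m n \<Longrightarrow> l m n"
    and G2: "\<And>m n k. m \<epsilon> om \<Longrightarrow> n \<epsilon> om \<Longrightarrow> k \<epsilon> om \<Longrightarrow> eqv e m n \<Longrightarrow> (e k m \<longleftrightarrow> e k n) \<and> (e m k \<longleftrightarrow> e n k)"
    and G3: "\<And>k. k \<epsilon> om \<Longrightarrow> names e g (rn k) (\<lambda>y. y \<epsilon> t \<cdot> k)"
    and G4: "names e g nA (\<lambda>y. y \<epsilon> a)" "names e g nB (\<lambda>y. y \<epsilon> b)"
    and G5: "\<And>i \<phi> c m. (i, \<phi>) \<in> exs \<chi> \<Longrightarrow> c \<epsilon> om \<Longrightarrow> m \<epsilon> om \<Longrightarrow> Sk e \<phi> (updc i m c) \<Longrightarrow> Sk e (Ex i \<phi>) c"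
    and G6: "Sk e \<chi> q0"
    using good unfolding Good_def by fastforce+
  have wf_e: "wf_on om e" unfolding wf_on_def
  proof (intro allI impI)
    fix s assume s: "s \<sqsubseteq> om" "s \<noteq> \<emptyset>"
    then obtain m where "m \<epsilon> s" "\<forall>y. y \<epsilon> s \<longrightarrow> \<not> l y m" using wf unfolding wf_on_def by blast
    then show "\<exists>m. m \<epsilon> s \<and> (\<forall>y. y \<epsilon> s \<longrightarrow> \<not> e y m)" using s(1) G1 subD by blast
  qed
  have dG: "dterm (\<lambda>s. repl (sep om (\<lambda>n. e n (s 0))) (\<lambda>n. s 1 \<cdot> n))" by (intro dfn)
  have ms: "n \<epsilon> sep om (\<lambda>n. e n m) \<longleftrightarrow> n \<epsilon> om \<and> e n m" for n m by (rule mem_sep) (intro dfn)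
  obtain \<pi> where \<pi>: "\<And>m. m \<epsilon> om \<Longrightarrow>
      \<pi> \<cdot> m = repl (sep om (\<lambda>n. e n m)) (\<lambda>n. \<pi> \<restriction> sep om (\<lambda>n. e n m) \<cdot> n)"
    using wf_recursion[where G = "\<lambda>m h. repl (sep om (\<lambda>n. e n m)) (\<lambda>n. h \<cdot> n)", OF wf_e e dG] by blast
  have m\<pi>: "y \<epsilon> \<pi> \<cdot> m \<longleftrightarrow> (\<exists>n. n \<epsilon> om \<and> e n m \<and> y = \<pi> \<cdot> n)" if m: "m \<epsilon> om" for m y
  proof -
    have d: "dterm (\<lambda>s. \<pi> \<restriction> sep om (\<lambda>n. e n m) \<cdot> s 0)" by (intro dfn)
    have "y \<epsilon> \<pi> \<cdot> m \<longleftrightarrow> (\<exists>n. n \<epsilon> sep om (\<lambda>n. e n m) \<and> y = \<pi> \<restriction> sep om (\<lambda>n. e n m) \<cdot> n)"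
      unfolding \<pi>[OF m] mem_repl[OF d] ..
    also have "\<dots> \<longleftrightarrow> (\<exists>n. n \<epsilon> sep om (\<lambda>n. e n m) \<and> y = \<pi> \<cdot> n)" by (metis app_res)
    finally show ?thesis unfolding ms by blast
  qed
  have eq1: "\<pi> \<cdot> m = \<pi> \<cdot> n" if "m \<epsilon> om" "n \<epsilon> om" "eqv e m n" for m n
    by (rule ext, unfold m\<pi>[OF that(1)] m\<pi>[OF that(2)]) (use G2[OF that(1,2) _ that(3)] in blast)
  \<comment> \<open>If two inequivalent nodes had the same value, their difference node would belong
    to only one of them. The other then has a member with the same value, by induction equivalent to
    the difference node, against the congruence of \<open>eqv\<close>.\<close>
  have eq2: "\<forall>n. n \<epsilon> om \<longrightarrow> \<pi> \<cdot> m = \<pi> \<cdot> n \<longrightarrow> eqv e m n" if "m \<epsilon> om" for m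
  proof (rule wf_on_induct[OF wf_e _ _ that])
    show "definable (\<lambda>s. \<forall>n. n \<epsilon> om \<longrightarrow> \<pi> \<cdot> s 0 = \<pi> \<cdot> n \<longrightarrow> eqv e (s 0) n)"
      unfolding eqv_def by (intro dfn)
    fix m assume m: "m \<epsilon> om"
      and IH: "\<And>k. k \<epsilon> om \<Longrightarrow> e k m \<Longrightarrow> \<forall>n. n \<epsilon> om \<longrightarrow> \<pi> \<cdot> k = \<pi> \<cdot> n \<longrightarrow> eqv e k n"
    show "\<forall>n. n \<epsilon> om \<longrightarrow> \<pi> \<cdot> m = \<pi> \<cdot> n \<longrightarrow> eqv e m n"
    proof (intro allI impI, rule ccontr)
      fix n assume n: "n \<epsilon> om" "\<pi> \<cdot> m = \<pi> \<cdot> n" "\<not> eqv e m n"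
      let ?d = "dn m n"
      have d: "?d \<epsilon> om" using m n by simp
      consider "e ?d m" "\<not> e ?d n" | "e ?d n" "\<not> e ?d m" using n(3) unfolding eqv_def by blast
      then show False
      proof cases
        case 1
        then have "\<pi> \<cdot> ?d \<epsilon> \<pi> \<cdot> n" using m\<pi>[OF m] d n(2) by metis
        then obtain k where k: "k \<epsilon> om" "e k n" "\<pi> \<cdot> ?d = \<pi> \<cdot> k" using m\<pi>[OF n(1)] by blast
        then have "eqv e ?d k" using IH[OF d 1(1)] by blast
        then show False using G2[OF d k(1) n(1)] k(2) 1(2) by blast
      next
        case 2
        then have "\<pi> \<cdot> ?d \<epsilon> \<pi> \<cdot> m" using m\<pi>[OF n(1)] d n(2) by metis
        then obtain k where k: "k \<epsilon> om" "e k m" "\<pi> \<cdot> ?d = \<pi> \<cdot> k" using m\<pi>[OF m] by blast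
        then have "eqv e k ?d" using IH[OF k(1,2)] d by metis
        then show False using G2[OF k(1) d m] k(2) 2(2) by blast
      qed
    qed
  qed
  have mem: "\<pi> \<cdot> n \<epsilon> \<pi> \<cdot> m \<longleftrightarrow> e n m" if n: "n \<epsilon> om" and m: "m \<epsilon> om" for n m
  proof
    assume "\<pi> \<cdot> n \<epsilon> \<pi> \<cdot> m"
    then obtain k where k: "k \<epsilon> om" "e k m" "\<pi> \<cdot> n = \<pi> \<cdot> k" using m\<pi>[OF m] by blast
    then have "eqv e n k" using eq2[OF n] by blast
    then show "e n m" using G2[OF n k(1) m] k(2) by blast
  qed (use m\<pi>[OF m] n in blast)
  have sat: "Sk e \<phi> c \<longleftrightarrow> sat E (\<lambda>i. \<pi> \<cdot> nthc i c) \<phi>" if "Delta0 \<phi>" "exs \<phi> \<subseteq> exs \<chi>" "c \<epsilon> om" for \<phi> c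
    using that
  proof (induction arbitrary: c)
    case (1 i j)
    then show ?case using mem by simp
  next
    case (2 i j)
    then show ?case using eq1 eq2 by (metis Sk.simps(2) nthc_om sat.simps(2))
  next
    case (5 \<phi> i j)
    let ?b = "And (Mem i j) \<phi>"
    have body: "Sk e ?b d \<longleftrightarrow> sat E (\<lambda>i. \<pi> \<cdot> nthc i d) ?b" if "d \<epsilon> om" for d
      using 5 that mem by simp
    have upd: "(\<lambda>k. \<pi> \<cdot> nthc k (updc i m c)) = (\<lambda>k. \<pi> \<cdot> nthc k c)(i := \<pi> \<cdot> m)" if "m \<epsilon> om" for m
      by (rule comp_updc[OF 5(5) that])
    have s_om: "sn i ?b c \<epsilon> om" using 5 by simp
    show ?case
    proof
      assume "Sk e (Ex i ?b) c"
      then have "sat E ((\<lambda>k. \<pi> \<cdot> nthc k c)(i := \<pi> \<cdot> sn i ?b c)) ?b"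
        unfolding Sk.simps(5) body[OF updc_om[OF 5(5) s_om]] upd[OF s_om] .
      then show "sat E (\<lambda>i. \<pi> \<cdot> nthc i c) (Ex i ?b)" unfolding sat.simps(5)[of E _ i ?b] by blast
    next
      assume "sat E (\<lambda>i. \<pi> \<cdot> nthc i c) (Ex i ?b)"
      then obtain y where y: "sat E ((\<lambda>k. \<pi> \<cdot> nthc k c)(i := y)) ?b" unfolding sat.simps(5)[of E _ i ?b] by blast
      \<comment> \<open>The bound places \<open>y\<close> in a collapsed value, so \<open>y\<close>
        comes from some node \<open>m\<close>; the Skolem condition exchanges \<open>m\<close> for
        the Skolem node.\<close>
      then have "y \<epsilon> \<pi> \<cdot> nthc j c" using 5(2) by simp
      then obtain m where m: "m \<epsilon> om" "y = \<pi> \<cdot> m" using m\<pi>[OF nthc_om[OF 5(5)]] by blast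
      have "sat E (\<lambda>k. \<pi> \<cdot> nthc k (updc i m c)) ?b" using y unfolding upd[OF m(1)] m(2) .
      then have "Sk e ?b (updc i m c)" unfolding body[OF updc_om[OF 5(5) m(1)]] .
      then show "Sk e (Ex i ?b) c" using G5[of i ?b c m] 5(4,5) m(1) by simp
    qed
  qed auto
  have named: "\<pi> \<cdot> c = y"
    if c: "c \<epsilon> om" "names e g c (\<lambda>z. z \<epsilon> y)" and y: "\<And>z. z \<epsilon> y \<Longrightarrow> \<exists>j. j \<epsilon> om \<and> z = t \<cdot> j"
      and rn: "\<And>j. j \<epsilon> om \<Longrightarrow> t \<cdot> j \<epsilon> y \<Longrightarrow> \<pi> \<cdot> rn j = t \<cdot> j" for c y
  proof (rule ext)
    fix z
    show "z \<epsilon> \<pi> \<cdot> c \<longleftrightarrow> z \<epsilon> y"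
    proof
      assume "z \<epsilon> \<pi> \<cdot> c"
      then obtain m where m: "m \<epsilon> om" "e m c" "z = \<pi> \<cdot> m" using m\<pi>[OF c(1)] by blast
      then have "g m \<epsilon> om" "t \<cdot> g m \<epsilon> y" "eqv e m (rn (g m))" using c(2) unfolding names_def by blast+
      then show "z \<epsilon> y" using eq1[of m "rn (g m)"] rn m by simp
    next
      assume z: "z \<epsilon> y"
      then obtain j where j: "j \<epsilon> om" "z = t \<cdot> j" using y by blast
      then have "e (rn j) c" using c(2) z unfolding names_def by blast
      then show "z \<epsilon> \<pi> \<cdot> c" unfolding m\<pi>[OF c(1)] using j rn z by (intro exI[of _ "rn j"]) simp
    qed
  qed
  \<comment> \<open>The values of the names \<open>rn k\<close> are determined by induction along
    membership between the sets \<open>t \<cdot> k\<close>.\<close>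
  have wf_t: "wf_on om (\<lambda>j k. t \<cdot> j \<epsilon> t \<cdot> k)" unfolding wf_on_def
  proof (intro allI impI)
    fix s assume s: "s \<noteq> \<emptyset>"
    have d: "dterm (\<lambda>s. t \<cdot> s 0)" by (intro dfn)
    obtain k where "k \<epsilon> s" using s eq_emp_iff by blast
    then have "t \<cdot> k \<epsilon> repl s (\<lambda>k. t \<cdot> k)" unfolding mem_repl[OF d] by blast
    from foundation[OF this] show "\<exists>m. m \<epsilon> s \<and> (\<forall>y. y \<epsilon> s \<longrightarrow> \<not> t \<cdot> y \<epsilon> t \<cdot> m)"
      unfolding mem_repl[OF d] by blast
  qed
  have rn: "\<pi> \<cdot> rn k = t \<cdot> k" if "k \<epsilon> om" for k
  proof (rule wf_on_induct[OF wf_t _ _ that])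
    show "definable (\<lambda>s. \<pi> \<cdot> rn (s 0) = t \<cdot> s 0)" by (intro dfn)
    fix k assume k: "k \<epsilon> om" and IH: "\<And>j. j \<epsilon> om \<Longrightarrow> t \<cdot> j \<epsilon> t \<cdot> k \<Longrightarrow> \<pi> \<cdot> rn j = t \<cdot> j"
    show "\<pi> \<cdot> rn k = t \<cdot> k" by (rule named[OF _ G3[OF k]]) (use k IH t_trans in auto)
  qed
  have "\<pi> \<cdot> nA = a" by (rule named[OF _ G4(1)]) (use ab t_om rn in \<open>auto dest: subD\<close>)
  moreover have "\<pi> \<cdot> nB = b" by (rule named[OF _ G4(2)]) (use ab t_om rn in \<open>auto dest: subD\<close>)
  moreover have "sat E (\<lambda>i. \<pi> \<cdot> nthc i q0) \<chi>" using sat[OF \<chi>(1)] G6 by simp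
  ultimately show ?thesis
    using vars rn[OF kx(1)] kx(2) by (intro exI[of _ "\<lambda>i. \<pi> \<cdot> nthc i q0"]) (auto simp: nthc_q0)
qed

text \<open>The structure is the pullback of membership along an enumeration \<open>z\<close> of a countable elementary
  part of a transitive set, chosen so that every number plays its role.\<close>

lemma Good_complete:
  assumes s: "s u = a" "s v = b" "s w = x" "sat E s \<chi>" and ab: "a \<sqsubseteq> om" "b \<sqsubseteq> om"
  shows "\<exists>e g l. e \<sqsubseteq> om \<otimes> om \<and> maps g om om \<and> l \<sqsubseteq> om \<otimes> om \<and> lin_order l om \<and>
    wf_on om (\<lambda>m n. \<langle>m, n\<rangle> \<epsilon> l) \<and> Good (\<lambda>m n. \<langle>m, n\<rangle> \<epsilon> e) (\<lambda>m. g \<cdot> m) (\<lambda>m n. \<langle>m, n\<rangle> \<epsilon> l) a b"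
proof -
  \<comment> \<open>An external induction: there are finitely many witnesses in the real sense, so
    they are contained in a set of the model although \<open>s\<close> is not one of its
    functions.\<close>
  have "\<exists>X. \<forall>i<n. s i \<epsilon> X" for n
  proof (induction n)
    case (Suc n)
    then obtain X where "\<forall>i<n. s i \<epsilon> X" by blast
    then show ?case by (intro exI[of _ "adj X (s n)"]) (auto simp: less_Suc_eq)
  qed simp
  then obtain X where X: "\<And>i. i < N \<Longrightarrow> s i \<epsilon> X" by blast
  obtain K where K: "transitive_set E K" "X \<squnion> repl om (\<lambda>k. t \<cdot> k) \<sqsubseteq> K"
    using transitive_superset by blast
  have sK: "s i \<epsilon> K" if "i < N" for i using X[OF that] K(2) subD by simp
  have dt: "dterm (\<lambda>e. t \<cdot> e 0)" by (intro dfn)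
  have tK: "t \<cdot> k \<epsilon> K" if "k \<epsilon> om" for k
    using K(2) that unfolding subset_of_def mem_un mem_repl[OF dt] by blast
  have K_trans: "y \<epsilon> K" if "z \<epsilon> K" "y \<epsilon> z" for y z
    using K(1) that unfolding transitive_set_def subset_of_def by blast
  \<comment> \<open>The duty of the number \<open>n\<close> when the smaller numbers denote the
    values of \<open>h\<close>. Arguments of difference and Skolem nodes are smaller than the node,
    so \<open>h\<close> is defined on all that is mentioned.\<close>
  define Q where "Q n h y \<longleftrightarrow>
    (\<forall>k. k \<epsilon> om \<longrightarrow> n = rn k \<longrightarrow> y = t \<cdot> k) \<and> (n = nA \<longrightarrow> y = a) \<and> (n = nB \<longrightarrow> y = b) \<and>
    (\<forall>m l. m \<epsilon> om \<longrightarrow> l \<epsilon> om \<longrightarrow> n = dn m l \<longrightarrow> h \<cdot> m \<noteq> h \<cdot> l \<longrightarrow> \<not> (y \<epsilon> h \<cdot> m \<longleftrightarrow> y \<epsilon> h \<cdot> l)) \<and>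
    (\<forall>i\<in>{..<N}. n = wn i \<longrightarrow> y = s i) \<and>
    (\<forall>p\<in>exs \<chi>. \<forall>c. c \<epsilon> om \<longrightarrow> n = sn (fst p) (snd p) c \<longrightarrow>
      (\<exists>y. y \<epsilon> K \<and> sat E (\<lambda>j. if j = fst p then y else h \<cdot> nthc j c) (snd p)) \<longrightarrow>
      sat E (\<lambda>j. if j = fst p then y else h \<cdot> nthc j c) (snd p))" for n h y
  have dQ: "definable (\<lambda>e. Q (e 0) (e 1) (e 2))" unfolding Q_def
    by (intro dfn definable_finite_ball finite_exs finite_lessThan)
  have exQ: "\<exists>y. y \<epsilon> K \<and> Q n h y" if n: "n \<epsilon> om" and h: "maps h n K" for n h
  proof -
    \<comment> \<open>Injectivity of the nodes keeps the roles from competing; a number without an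
      effective duty gets \<open>t \<cdot> \<emptyset>\<close>.\<close>
    consider (r) k where "k \<epsilon> om" "n = rn k" | (A) "n = nA" | (B) "n = nB"
      | (d) m l where "m \<epsilon> om" "l \<epsilon> om" "n = dn m l" "h \<cdot> m \<noteq> h \<cdot> l"
      | (w) i where "i < N" "n = wn i"
      | (s) i \<phi> c y where "(i, \<phi>) \<in> exs \<chi>" "c \<epsilon> om" "n = sn i \<phi> c" "y \<epsilon> K"
          "sat E (\<lambda>j. if j = i then y else h \<cdot> nthc j c) \<phi>"
      | (none) "Q n h (t \<cdot> \<emptyset>)"
      unfolding Q_def by fastforce
    then show ?thesis
    proof cases
      case r
      then have "Q n h (t \<cdot> k)" unfolding Q_def by auto
      then show ?thesis using tK r by blast
    next
      case A
      then have "Q n h a" unfolding Q_def by auto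
      then show ?thesis using sK vars(2) s(1) by blast
    next
      case B
      then have "Q n h b" unfolding Q_def by auto
      then show ?thesis using sK vars(3) s(2) by blast
    next
      case d
      have pn: "pr m l \<epsilon> n" using node_gt[of "pr m l" 2] d by (simp add: numeral_3_eq_3 numeral_2_eq_2)
      have mn: "m \<epsilon> n" "l \<epsilon> n"
        using suc_mem_trans[OF pr_ge1 pn n] suc_mem_trans[OF pr_ge2 pn n] d by blast+
      obtain y where y: "\<not> (y \<epsilon> h \<cdot> m \<longleftrightarrow> y \<epsilon> h \<cdot> l)" using d(4) ext by blast
      have "y \<epsilon> K" using y h mn K_trans unfolding maps_def by blast
      moreover have "Q n h y" unfolding Q_def using d y by auto
      ultimately show ?thesis by blast
    next
      case w
      then have "Q n h (s i)" unfolding Q_def by auto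
      then show ?thesis using sK w by blast
    next
      case s
      have uniq: "fst p = i \<and> snd p = \<phi> \<and> d = c" if "p \<in> exs \<chi>" "d \<epsilon> om" "n = sn (fst p) (snd p) d" for p d
      proof -
        have "idx (fst p, snd p) = idx (i, \<phi>) \<and> d = c" using that s by simp
        then show ?thesis using inj_onD[OF idx, of p "(i, \<phi>)"] that(1) s(1) by auto
      qed
      have "Q n h y" unfolding Q_def
      proof (intro conjI ballI allI impI)
        fix p d assume "p \<in> exs \<chi>" "d \<epsilon> om" "n = sn (fst p) (snd p) d"
        then have e: "fst p = i" "snd p = \<phi>" "d = c" using uniq by blast+
        show "sat E (\<lambda>j. if j = fst p then y else h \<cdot> nthc j d) (snd p)" unfolding e by (rule s(5))
      qed (use s in auto)
      then show ?thesis using s(4) by blast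
    next
      case none
      then show ?thesis using tK zero_om by blast
    qed
  qed
  have "definable (\<lambda>e. e 0 \<epsilon> e 1)" by (intro dfn)
  from wf_choice[OF wf_on_mem[of om] this dQ, of K]
  obtain z where z: "maps z om K" and Qz: "\<And>n. n \<epsilon> om \<Longrightarrow> Q n (z \<restriction> n) (z \<cdot> n)"
    using exQ sep_mem_om by force
  have z_rn: "z \<cdot> rn k = t \<cdot> k" if "k \<epsilon> om" for k using Qz[of "rn k"] that unfolding Q_def by auto
  have z_nA: "z \<cdot> nA = a" using Qz[of nA] unfolding Q_def by auto
  have z_nB: "z \<cdot> nB = b" using Qz[of nB] unfolding Q_def by auto
  have z_wn: "z \<cdot> wn i = s i" if "i < N" for i using Qz[of "wn i"] that unfolding Q_def by auto
  have z_dn: "\<not> (z \<cdot> dn m l \<epsilon> z \<cdot> m \<longleftrightarrow> z \<cdot> dn m l \<epsilon> z \<cdot> l)"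
    if m: "m \<epsilon> om" "l \<epsilon> om" and ne: "z \<cdot> m \<noteq> z \<cdot> l" for m l
  proof -
    have n: "dn m l \<epsilon> om" using m by simp
    have pn: "pr m l \<epsilon> dn m l" using node_gt[of "pr m l" 2] m by (simp add: numeral_3_eq_3 numeral_2_eq_2)
    have mn: "m \<epsilon> dn m l" "l \<epsilon> dn m l"
      using suc_mem_trans[OF pr_ge1[OF m] pn n] suc_mem_trans[OF pr_ge2[OF m] pn n] by blast+
    have "z \<restriction> dn m l \<cdot> m = z \<cdot> m" "z \<restriction> dn m l \<cdot> l = z \<cdot> l" using mn by simp_all
    then show ?thesis using Qz[OF n] m ne unfolding Q_def by metis
  qed
  have z_sn: "sat E ((\<lambda>j. z \<cdot> nthc j c)(i := z \<cdot> sn i \<phi> c)) \<phi>"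
    if i: "(i, \<phi>) \<in> exs \<chi>" and c: "c \<epsilon> om" and y: "y \<epsilon> K" "sat E ((\<lambda>j. z \<cdot> nthc j c)(i := y)) \<phi>" for i \<phi> c y
  proof -
    have n: "sn i \<phi> c \<epsilon> om" using c by simp
    have cn: "c \<epsilon> sn i \<phi> c" using node_gt[OF c, of "4 + idx (i, \<phi>)"] by (simp add: eval_nat_numeral)
    have "z \<restriction> sn i \<phi> c \<cdot> nthc j c = z \<cdot> nthc j c" for j
      by (rule app_res) (rule suc_mem_trans[OF nthc_le[OF c] cn n])
    then have e: "(\<lambda>j. if j = i then y else z \<restriction> sn i \<phi> c \<cdot> nthc j c) = (\<lambda>j. z \<cdot> nthc j c)(i := y)" for y by auto
    show ?thesis using Qz[OF n] i c y e unfolding Q_def by force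
  qed
  define e where "e = sep (om \<otimes> om) (\<lambda>p. z \<cdot> p1 p \<epsilon> z \<cdot> p2 p)"
  have me: "p \<epsilon> e \<longleftrightarrow> p \<epsilon> om \<otimes> om \<and> z \<cdot> p1 p \<epsilon> z \<cdot> p2 p" for p unfolding e_def by (rule mem_sep) (intro dfn)
  have e_iff: "\<langle>m, n\<rangle> \<epsilon> e \<longleftrightarrow> m \<epsilon> om \<and> n \<epsilon> om \<and> z \<cdot> m \<epsilon> z \<cdot> n" for m n unfolding me by auto
  let ?e = "\<lambda>m n. \<langle>m, n\<rangle> \<epsilon> e"
  have eqv: "eqv ?e m n \<longleftrightarrow> z \<cdot> m = z \<cdot> n" if "m \<epsilon> om" "n \<epsilon> om" for m n
    unfolding eqv_def e_iff using that z_dn by auto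
  obtain \<rho> where \<rho>: "\<And>y. y \<epsilon> K \<Longrightarrow> is_ordinal E (\<rho> \<cdot> y)" "\<And>y y'. y \<epsilon> K \<Longrightarrow> y' \<epsilon> y \<Longrightarrow> \<rho> \<cdot> y' \<epsilon> \<rho> \<cdot> y"
    using rank_function[OF K(1)] by blast
  have zK: "z \<cdot> m \<epsilon> K" if "m \<epsilon> om" for m using z that unfolding maps_def by blast
  let ?r = "\<lambda>m. \<rho> \<cdot> (z \<cdot> m)"
  have r_ord: "is_ordinal E (?r m)" if "m \<epsilon> om" for m using \<rho>(1) zK that by blast
  \<comment> \<open>Ordered by rank, with ties broken by the numbers: a linear wellfounded order
    extending the pullback of membership.\<close>
  define l where "l = sep (om \<otimes> om) (\<lambda>p. ?r (p1 p) \<epsilon> ?r (p2 p) \<or> ?r (p1 p) = ?r (p2 p) \<and> p1 p \<epsilon> p2 p)"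
  have ml: "p \<epsilon> l \<longleftrightarrow> p \<epsilon> om \<otimes> om \<and> (?r (p1 p) \<epsilon> ?r (p2 p) \<or> ?r (p1 p) = ?r (p2 p) \<and> p1 p \<epsilon> p2 p)" for p
    unfolding l_def by (rule mem_sep) (intro dfn)
  have l_iff: "\<langle>m, n\<rangle> \<epsilon> l \<longleftrightarrow> m \<epsilon> om \<and> n \<epsilon> om \<and> (?r m \<epsilon> ?r n \<or> ?r m = ?r n \<and> m \<epsilon> n)" for m n unfolding ml by simp
  have "lin_order l om" unfolding lin_order_def l_iff
  proof (intro conjI allI impI)
    fix i j k assume ijk: "i \<epsilon> om" "j \<epsilon> om" "k \<epsilon> om"
      "i \<epsilon> om \<and> j \<epsilon> om \<and> (?r i \<epsilon> ?r j \<or> ?r i = ?r j \<and> i \<epsilon> j)"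
      "j \<epsilon> om \<and> k \<epsilon> om \<and> (?r j \<epsilon> ?r k \<or> ?r j = ?r k \<and> j \<epsilon> k)"
    then show "?r i \<epsilon> ?r k \<or> ?r i = ?r k \<and> i \<epsilon> k"
      using ord_mem_trans[OF r_ord[OF ijk(3)], of "?r i" "?r j"] om_trans[of i j k] by auto
  next
    fix i j assume "i \<epsilon> om" "j \<epsilon> om"
    then show "i \<epsilon> om \<and> j \<epsilon> om \<and> (?r i \<epsilon> ?r j \<or> ?r i = ?r j \<and> i \<epsilon> j) \<or> i = j \<or>
      j \<epsilon> om \<and> i \<epsilon> om \<and> (?r j \<epsilon> ?r i \<or> ?r j = ?r i \<and> j \<epsilon> i)"
      using ord_linear[OF r_ord r_ord, of i j] om_linear[of i j] by auto
  qed auto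
  moreover have "wf_on om (\<lambda>m n. \<langle>m, n\<rangle> \<epsilon> l)" unfolding wf_on_def
  proof (intro allI impI)
    fix S assume S: "S \<sqsubseteq> om" "S \<noteq> \<emptyset>"
    have d: "dterm (\<lambda>e. ?r (e 0))" by (intro dfn)
    obtain m where "m \<epsilon> S" using S(2) eq_emp_iff by blast
    then have "?r m \<epsilon> repl S ?r" unfolding mem_repl[OF d] by blast
    from foundation[OF this] obtain m where m: "m \<epsilon> S" "\<And>n. n \<epsilon> S \<Longrightarrow> \<not> ?r n \<epsilon> ?r m"
      unfolding mem_repl[OF d] by blast
    have mS: "n \<epsilon> sep S (\<lambda>n. ?r n = ?r m) \<longleftrightarrow> n \<epsilon> S \<and> ?r n = ?r m" for n by (rule mem_sep) (intro dfn)
    have "m \<epsilon> sep S (\<lambda>n. ?r n = ?r m)" unfolding mS using m(1) by blast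
    from foundation[OF this] obtain n where "n \<epsilon> S" "?r n = ?r m" "\<And>k. k \<epsilon> n \<Longrightarrow> \<not> (k \<epsilon> S \<and> ?r k = ?r m)"
      unfolding mS by blast
    then show "\<exists>n. n \<epsilon> S \<and> (\<forall>k. k \<epsilon> S \<longrightarrow> \<not> \<langle>k, n\<rangle> \<epsilon> l)"
      unfolding l_iff using m(2) by (intro exI[of _ n]) auto
  qed
  moreover obtain g where g: "maps g om om" "\<And>m k. m \<epsilon> om \<Longrightarrow> k \<epsilon> om \<Longrightarrow> z \<cdot> m = t \<cdot> k \<Longrightarrow> t \<cdot> (g \<cdot> m) = z \<cdot> m"
  proof -
    let ?P = "\<lambda>m j. \<forall>k. k \<epsilon> om \<longrightarrow> z \<cdot> m = t \<cdot> k \<longrightarrow> t \<cdot> j = z \<cdot> m"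
    have d: "definable (\<lambda>e. ?P (e 0) (e 1))" by (intro dfn)
    have ex: "\<exists>j. j \<epsilon> om \<and> ?P m j" for m
    proof (cases "\<exists>k. k \<epsilon> om \<and> z \<cdot> m = t \<cdot> k")
      case True
      then obtain k where "k \<epsilon> om" "z \<cdot> m = t \<cdot> k" by blast
      then show ?thesis by (intro exI[of _ k]) simp
    next
      case False
      then show ?thesis using zero_om by blast
    qed
    show thesis using set_choice[OF d ex, of om] that by blast
  qed
  moreover have "Good ?e (\<lambda>m. g \<cdot> m) (\<lambda>m n. \<langle>m, n\<rangle> \<epsilon> l) a b"
  proof -
    have sat: "Sk ?e \<phi> c \<longleftrightarrow> sat E (\<lambda>i. z \<cdot> nthc i c) \<phi>" if "Delta0 \<phi>" "exs \<phi> \<subseteq> exs \<chi>" "c \<epsilon> om" for \<phi> c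
      using that
    proof (induction arbitrary: c)
      case (1 i j)
      then show ?case by (simp add: e_iff)
    next
      case (2 i j)
      then show ?case by (simp add: eqv)
    next
      case (5 \<phi> i j)
      let ?b = "And (Mem i j) \<phi>"
      have body: "Sk ?e ?b d \<longleftrightarrow> sat E (\<lambda>i. z \<cdot> nthc i d) ?b" if "d \<epsilon> om" for d
        using 5 that by (simp add: e_iff)
      have s_om: "sn i ?b c \<epsilon> om" using 5 by simp
      have "Sk ?e (Ex i ?b) c \<longleftrightarrow> sat E ((\<lambda>k. z \<cdot> nthc k c)(i := z \<cdot> sn i ?b c)) ?b"
        unfolding Sk.simps(5) body[OF updc_om[OF 5(5) s_om]] comp_updc[OF 5(5) s_om] ..
      also have "\<dots> \<longleftrightarrow> (\<exists>y. sat E ((\<lambda>k. z \<cdot> nthc k c)(i := y)) ?b)"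
      proof
        assume "\<exists>y. sat E ((\<lambda>k. z \<cdot> nthc k c)(i := y)) ?b"
        then obtain y where y: "sat E ((\<lambda>k. z \<cdot> nthc k c)(i := y)) ?b" by blast
        then have "y \<epsilon> z \<cdot> nthc j c" using 5(2) by simp
        \<comment> \<open>A bounded witness stays in the transitive set \<open>K\<close>, within
          which \<open>Q\<close> provides Skolem values.\<close>
        then have "y \<epsilon> K" using K_trans zK[OF nthc_om[OF 5(5)]] by blast
        then show "sat E ((\<lambda>k. z \<cdot> nthc k c)(i := z \<cdot> sn i ?b c)) ?b"
          using z_sn[OF _ 5(5) _ y] 5(4) by simp
      qed blast
      finally show ?case unfolding sat.simps(5)[of E _ i ?b] .
    qed auto
    have exs_D: "Sk ?e (Ex i \<phi>) c" if p: "(i, \<phi>) \<in> exs \<chi>" and c: "c \<epsilon> om" "m \<epsilon> om" and b: "Sk ?e \<phi> (updc i m c)" for i \<phi> c m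
    proof -
      \<comment> \<open>Every existential quantifier in a bounded formula is itself bounded, so
        \<open>sat\<close> applies to each entry of \<open>exs \<chi>\<close>.\<close>
      have sub: "exs (Ex i \<phi>) \<subseteq> exs \<chi> \<and> Delta0 (Ex i \<phi>) \<and> Delta0 \<phi>"
      proof -
        have "exs (Ex i \<phi>) \<subseteq> exs \<psi> \<and> Delta0 (Ex i \<phi>) \<and> Delta0 \<phi>" if "Delta0 \<psi>" "(i, \<phi>) \<in> exs \<psi>" for \<psi>
          using that by induction (auto intro: Delta0.intros)
        then show ?thesis using \<chi>(1) p by blast
      qed
      then have "sat E (\<lambda>j. z \<cdot> nthc j (updc i m c)) \<phi>" using sat[of \<phi> "updc i m c"] b c by auto
      then have "sat E (\<lambda>j. z \<cdot> nthc j c) (Ex i \<phi>)" unfolding comp_updc[OF c] by auto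
      then show ?thesis using sat[of "Ex i \<phi>" c] sub c by blast
    qed
    have q0: "Sk ?e \<chi> q0"
    proof -
      have "z \<cdot> nthc i q0 = s i" if "i < N" for i
        using that s(1-3) z_nA z_nB z_rn[OF kx(1)] kx(2) z_wn[OF that] by (simp add: nthc_q0)
      then have "sat E (\<lambda>i. z \<cdot> nthc i q0) \<chi> = sat E s \<chi>"
        by (intro sat_fv_cong) (use \<chi>(2) in auto)
      then show ?thesis using sat[OF \<chi>(1)] s(4) by simp
    qed
    have names: "names ?e (\<lambda>m. g \<cdot> m) c (\<lambda>z. z \<epsilon> y)"
      if c: "c \<epsilon> om" "z \<cdot> c = y" and y: "\<And>z. z \<epsilon> y \<Longrightarrow> \<exists>j. j \<epsilon> om \<and> z = t \<cdot> j" for c y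
      unfolding names_def
    proof (intro conjI allI impI)
      fix m assume "m \<epsilon> om" "\<langle>m, c\<rangle> \<epsilon> e"
      then have m: "m \<epsilon> om" "z \<cdot> m \<epsilon> z \<cdot> c" unfolding e_iff by blast+
      then obtain k where "k \<epsilon> om" "z \<cdot> m = t \<cdot> k" using y c by blast
      then have t: "t \<cdot> (g \<cdot> m) = z \<cdot> m" using g(2) m by blast
      show gm: "g \<cdot> m \<epsilon> om" using g(1) m unfolding maps_def by blast
      show "t \<cdot> (g \<cdot> m) \<epsilon> y" using t m c by simp
      show "eqv ?e m (rn (g \<cdot> m))" using eqv[of m "rn (g \<cdot> m)"] z_rn[OF gm] t m gm by simp
    qed (use c z_rn in \<open>auto simp: e_iff\<close>)
    show ?thesis unfolding Good_def
    proof (intro conjI allI impI ballI)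
      show "\<langle>m, n\<rangle> \<epsilon> l" if "m \<epsilon> om" "n \<epsilon> om" "\<langle>m, n\<rangle> \<epsilon> e" for m n
        using that \<rho>(2) zK unfolding l_iff e_iff by blast
      show "\<langle>k, m\<rangle> \<epsilon> e \<longleftrightarrow> \<langle>k, n\<rangle> \<epsilon> e" "\<langle>m, k\<rangle> \<epsilon> e \<longleftrightarrow> \<langle>n, k\<rangle> \<epsilon> e"
        if "m \<epsilon> om" "n \<epsilon> om" "k \<epsilon> om" "eqv ?e m n" for m n k
        using that(4)[unfolded eqv[OF that(1,2)]] that(1-3) by (simp_all add: e_iff)
      show "names ?e (\<lambda>m. g \<cdot> m) (rn k) (\<lambda>y. y \<epsilon> t \<cdot> k)" if "k \<epsilon> om" for k
        by (rule names) (use that z_rn t_trans in auto)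
      show "names ?e (\<lambda>m. g \<cdot> m) nA (\<lambda>y. y \<epsilon> a)" by (rule names) (use ab t_om z_nA in \<open>auto dest: subD\<close>)
      show "names ?e (\<lambda>m. g \<cdot> m) nB (\<lambda>y. y \<epsilon> b)" by (rule names) (use ab t_om z_nB in \<open>auto dest: subD\<close>)
      show "Sk ?e (Ex (fst p) (snd p)) c"
        if "p \<in> exs \<chi>" "c \<epsilon> om" "m \<epsilon> om" "Sk ?e (snd p) (updc (fst p) m c)" for p c m
        by (rule exs_D[OF _ that(2,3,4)]) (use that(1) in simp)
      show "Sk ?e \<chi> q0" by (rule q0)
    qed
  qed
  moreover have "e \<sqsubseteq> om \<otimes> om" "l \<sqsubseteq> om \<otimes> om" unfolding subset_of_def me ml by blast+
  ultimately show ?thesis by blast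
qed

subsection \<open>Countably many codes at once\<close>

lemma definable_Sk:
  assumes F: "definable (\<lambda>e. F (e 0) (e 1) (e 2))" and "dterm z" "dterm c"
  shows "definable (\<lambda>e. Sk (F (z e)) \<phi> (c e))"
  using assms(2,3)
proof (induction \<phi> arbitrary: c)
  case (Mem i j)
  then show ?case by (auto intro!: dfn definable_comp3[OF F])
next
  case (Eq i j)
  then show ?case by (auto simp: eqv_def intro!: dfn definable_comp3[OF F])
next
  case (Ex i \<phi>)
  have "dterm (\<lambda>e. updc i (sn i \<phi> (c e)) (c e))" by (intro dfn Ex.prems)
  then show ?case unfolding Sk.simps(5) using Ex.IH Ex.prems(1) by blast
qed (auto intro!: dfn)

text \<open>Structures are presented uniformly in one element \<open>e 0\<close>, so that codes for
  all variants can be chosen at once.\<close>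

lemma definable_Good:
  assumes F: "definable (\<lambda>e. F (e 0) (e 1) (e 2))" and H: "dterm (\<lambda>e. H (e 0) (e 1))"
    and L: "definable (\<lambda>e. L (e 0) (e 1) (e 2))"
  shows "definable (\<lambda>e. Good (F (e 0)) (H (e 0)) (L (e 0)) (e 1) (e 2))"
  unfolding Good_def names_def eqv_def
  by (intro dfn definable_finite_ball finite_exs definable_Sk[OF F] definable_comp3[OF F] dterm_comp2[OF H]
      definable_comp3[OF L])

end

locale real_coding = coding +
  fixes \<sigma> :: 'a
  assumes \<sigma>: "maps \<sigma> om str" "\<And>s. s \<epsilon> str \<Longrightarrow> \<exists>i. i \<epsilon> om \<and> s = \<sigma> \<cdot> i"
begin

text \<open>Pairing splits \<open>y\<close>: the first coordinate selects the variant, the second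
  separates the relation from the locating function. The order \<open>L\<close> is sliced by the
  variant alone.\<close>

definition eY :: "'a \<Rightarrow> 'a \<Rightarrow> 'a \<Rightarrow> 'a \<Rightarrow> bool" where "eY y i m n \<longleftrightarrow> y \<cdot> pr i (pr \<emptyset> (pr m n)) \<noteq> \<emptyset>"
definition gY :: "'a \<Rightarrow> 'a \<Rightarrow> 'a \<Rightarrow> 'a" where "gY y i m = y \<cdot> pr i (pr (suc \<emptyset>) m)"
definition lY :: "'a \<Rightarrow> 'a \<Rightarrow> 'a \<Rightarrow> 'a \<Rightarrow> bool" where "lY L i m n \<longleftrightarrow> \<langle>pr i m, pr i n\<rangle> \<epsilon> L"

text \<open>By \<open>related_iff\<close> below, the projection of \<open>C\<close> consists of the reals that precede all
  their finite variants.\<close>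

definition C :: "'a \<Rightarrow> 'a \<Rightarrow> 'a \<Rightarrow> bool" where
  "C a y L \<longleftrightarrow> a \<sqsubseteq> om \<and> maps y om om \<and> L \<sqsubseteq> om \<otimes> om \<and> lin_order L om \<and>
    (\<forall>i. i \<epsilon> om \<longrightarrow> \<not> init a (\<sigma> \<cdot> i) \<longrightarrow> Good (eY y i) (gY y i) (lY L i) a (var a (\<sigma> \<cdot> i)))"

lemma C_definable: "definable (\<lambda>e. C (e 0) (e 1) (e 2))"
proof -
  let ?F = "\<lambda>z. eY (p1 z) (p2 (p2 z))" and ?H = "\<lambda>z. gY (p1 z) (p2 (p2 z))" and ?L = "\<lambda>z. lY (p1 (p2 z)) (p2 (p2 z))"
  have F: "definable (\<lambda>e. ?F (e 0) (e 1) (e 2))" unfolding eY_def by (intro dfn)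
  have H: "dterm (\<lambda>e. ?H (e 0) (e 1))" unfolding gY_def by (intro dfn)
  have L: "definable (\<lambda>e. ?L (e 0) (e 1) (e 2))" unfolding lY_def by (intro dfn)
  have "definable (\<lambda>e. Good (eY (e 2) (e 0)) (gY (e 2) (e 0)) (lY (e 3) (e 0)) (e 1) (var (e 1) (\<sigma> \<cdot> e 0)))"
  proof -
    have "definable (\<lambda>e. Good (?F \<langle>e 2, \<langle>e 3, e 0\<rangle>\<rangle>) (?H \<langle>e 2, \<langle>e 3, e 0\<rangle>\<rangle>) (?L \<langle>e 2, \<langle>e 3, e 0\<rangle>\<rangle>)
      (e 1) (var (e 1) (\<sigma> \<cdot> e 0)))"
      by (rule definable_comp3[where Q = "\<lambda>z a b. Good (?F z) (?H z) (?L z) a b", OF definable_Good[OF F H L]])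
         (intro dfn)+
    then show ?thesis by simp
  qed
  then show ?thesis unfolding C_def
    by (intro dfn) (simp add: numeral_2_eq_2 numeral_3_eq_3)
qed

text \<open>Continuity at a point, for functions of a real \<open>a\<close>, a sequence \<open>y\<close> and a relation \<open>L\<close>
  into a discrete space.\<close>

definition near :: "'a \<Rightarrow> 'a \<Rightarrow> 'a \<Rightarrow> 'a \<Rightarrow> 'a \<Rightarrow> 'a \<Rightarrow> 'a \<Rightarrow> bool" where
  "near a y L k a' y' L' \<longleftrightarrow> a' \<sqsubseteq> om \<and> (\<forall>m. m \<epsilon> k \<longrightarrow> (m \<epsilon> a' \<longleftrightarrow> m \<epsilon> a)) \<and> (\<forall>m. m \<epsilon> k \<longrightarrow> y' \<cdot> m = y \<cdot> m) \<and>
     (\<forall>i j. i \<epsilon> k \<longrightarrow> j \<epsilon> k \<longrightarrow> (\<langle>i, j\<rangle> \<epsilon> L' \<longleftrightarrow> \<langle>i, j\<rangle> \<epsilon> L))"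

definition loc :: "'a \<Rightarrow> 'a \<Rightarrow> 'a \<Rightarrow> ('a \<Rightarrow> 'a \<Rightarrow> 'a \<Rightarrow> 'b) \<Rightarrow> bool" where
  "loc a y L F \<longleftrightarrow> (\<exists>k. k \<epsilon> om \<and> (\<forall>a' y' L'. near a y L k a' y' L' \<longrightarrow> F a' y' L' = F a y L))"

lemma near_mono: "near a y L k a' y' L' \<Longrightarrow> j \<sqsubseteq> k \<Longrightarrow> near a y L j a' y' L'"
  unfolding near_def by (meson subD)

lemma loc_const: "loc a y L (\<lambda>a y L. c)"
  unfolding loc_def using zero_om by blast

text \<open>For values that determine where the code is read next, as in
  \<open>rn (gY y i m)\<close>: first a neighbourhood fixes the value, then another one treats it as
  a constant.\<close>

lemma loc_bind:
  assumes "loc a y L G" "loc a y L (\<lambda>a' y' L'. F a' y' L' (G a y L))"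
  shows "loc a y L (\<lambda>a y L. F a y L (G a y L))"
proof -
  obtain k where k: "k \<epsilon> om" "\<And>a' y' L'. near a y L k a' y' L' \<Longrightarrow> G a' y' L' = G a y L"
    using assms(1) unfolding loc_def by blast
  obtain j where j: "j \<epsilon> om" "\<And>a' y' L'. near a y L j a' y' L' \<Longrightarrow> F a' y' L' (G a y L) = F a y L (G a y L)"
    using assms(2) unfolding loc_def by blast
  have "F a' y' L' (G a' y' L') = F a y L (G a y L)" if n: "near a y L (k \<squnion> j) a' y' L'" for a' y' L'
    using k(2)[OF near_mono[OF n sub_un1]] j(2)[OF near_mono[OF n sub_un2]] by simp
  then show ?thesis unfolding loc_def using om_un[OF k(1) j(1)] by blast
qed

lemma loc_fun: "loc a y L F \<Longrightarrow> loc a y L (\<lambda>a y L. h (F a y L))"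
  unfolding loc_def by metis

lemma loc_fun2: "loc a y L F \<Longrightarrow> loc a y L G \<Longrightarrow> loc a y L (\<lambda>a y L. h (F a y L) (G a y L))"
  by (rule loc_bind[where F = "\<lambda>a y L v. h (F a y L) v"]) (auto intro: loc_fun)

lemmas loc_not = loc_fun[where h = Not]
  and loc_conj = loc_fun2[where h = "(\<and>)"]
  and loc_disj = loc_fun2[where h = "(\<or>)"]
  and loc_imp = loc_fun2[where h = "(\<longrightarrow>)"]
  and loc_iff = loc_fun2[where h = "(=)"]

lemma loc_y: "m \<epsilon> om \<Longrightarrow> loc a y L (\<lambda>a y L. y \<cdot> m)"
  unfolding loc_def near_def by (intro exI[of _ "suc m"]) simp

lemma loc_L: "i \<epsilon> om \<Longrightarrow> j \<epsilon> om \<Longrightarrow> loc a y L (\<lambda>a y L. \<langle>i, j\<rangle> \<epsilon> L)"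
  unfolding loc_def near_def using om_un[of "suc i" "suc j"] by (intro exI[of _ "suc i \<squnion> suc j"]) simp

lemma loc_a: "a \<sqsubseteq> om \<Longrightarrow> loc a y L (\<lambda>a y L. m \<epsilon> a)"
proof (cases "m \<epsilon> om")
  case True
  then show ?thesis unfolding loc_def near_def by (intro exI[of _ "suc m"]) simp
next
  case False
  then show "a \<sqsubseteq> om \<Longrightarrow> ?thesis" unfolding loc_def near_def subset_of_def using zero_om by blast
qed

lemma loc_var: "a \<sqsubseteq> om \<Longrightarrow> loc a y L (\<lambda>a y L. m \<epsilon> var a s)"
  unfolding mem_var by (intro loc_disj loc_conj loc_const loc_a)

lemma loc_init: "s \<epsilon> str \<Longrightarrow> loc a y L (\<lambda>a y L. init a s)"
  unfolding loc_def near_def init_def using str_len[of s] by (intro exI[of _ "p1 s"]) auto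

lemma loc_eY: "i \<epsilon> om \<Longrightarrow> m \<epsilon> om \<Longrightarrow> n \<epsilon> om \<Longrightarrow> loc a y L (\<lambda>a y L. eY y i m n)"
  unfolding eY_def by (intro loc_fun[where h = "\<lambda>z. z \<noteq> \<emptyset>"] loc_y pr_om zero_om)

lemma loc_gY: "i \<epsilon> om \<Longrightarrow> m \<epsilon> om \<Longrightarrow> loc a y L (\<lambda>a y L. gY y i m)"
  unfolding gY_def by (intro loc_y pr_om zero_om suc_om)

lemma loc_lY: "i \<epsilon> om \<Longrightarrow> m \<epsilon> om \<Longrightarrow> n \<epsilon> om \<Longrightarrow> loc a y L (\<lambda>a y L. lY L i m n)"
  unfolding lY_def by (intro loc_L pr_om)

lemma loc_eqv: "i \<epsilon> om \<Longrightarrow> m \<epsilon> om \<Longrightarrow> n \<epsilon> om \<Longrightarrow> loc a y L (\<lambda>a y L. eqv (eY y i) m n)"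
  unfolding eqv_def by (intro loc_iff loc_eY) simp_all

lemma loc_Sk: "i \<epsilon> om \<Longrightarrow> c \<epsilon> om \<Longrightarrow> loc a y L (\<lambda>a y L. Sk (eY y i) \<phi> c)"
proof (induction \<phi> arbitrary: c)
  case (Ex j \<phi>)
  then show ?case by simp
qed (auto intro!: loc_eY loc_eqv loc_not loc_conj)

text \<open>\<open>C\<close> is a conjunction of universal statements with locally constant
  instances. An instance true at all members of \<open>C\<close> is inherited by every limit of
  members.\<close>

lemma C_closed:
  assumes a: "a \<sqsubseteq> om" and y: "maps y om om" and L: "L \<sqsubseteq> om \<otimes> om"
    and approx: "\<And>k. k \<epsilon> om \<Longrightarrow> \<exists>a' y' L'. C a' y' L' \<and> a' \<sqinter> k = a \<sqinter> k \<and> y' \<restriction> k = y \<restriction> k \<and>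
        (\<forall>i j. i \<epsilon> k \<longrightarrow> j \<epsilon> k \<longrightarrow> (\<langle>i, j\<rangle> \<epsilon> L' \<longleftrightarrow> \<langle>i, j\<rangle> \<epsilon> L))"
  shows "C a y L"
proof -
  have limit: "P a y L" if P: "loc a y L P" and C: "\<And>a' y' L'. C a' y' L' \<Longrightarrow> P a' y' L'" for P
  proof -
    obtain k where k: "k \<epsilon> om" "\<And>a' y' L'. near a y L k a' y' L' \<Longrightarrow> P a' y' L' = P a y L"
      using P unfolding loc_def by blast
    obtain a' y' L' where 1: "C a' y' L'" "a' \<sqinter> k = a \<sqinter> k" "y' \<restriction> k = y \<restriction> k"
      "\<forall>i j. i \<epsilon> k \<longrightarrow> j \<epsilon> k \<longrightarrow> (\<langle>i, j\<rangle> \<epsilon> L' \<longleftrightarrow> \<langle>i, j\<rangle> \<epsilon> L)" using approx[OF k(1)] by blast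
    have "m \<epsilon> a' \<longleftrightarrow> m \<epsilon> a" if "m \<epsilon> k" for m using 1(2) that mem_int by metis
    moreover have "y' \<cdot> m = y \<cdot> m" if "m \<epsilon> k" for m using 1(3) that app_res by metis
    ultimately have "near a y L k a' y' L'" unfolding near_def using 1(1,4) C_def by blast
    then show ?thesis using k(2) C[OF 1(1)] by blast
  qed
  have lin: "lin_order L' om" if "C a' y' L'" for a' y' L' using that unfolding C_def by blast
  have "lin_order L om" unfolding lin_order_def
  proof (intro conjI allI impI)
    show "\<not> \<langle>i, i\<rangle> \<epsilon> L" if "i \<epsilon> om" for i
      by (rule limit[of "\<lambda>a y L. \<not> \<langle>i, i\<rangle> \<epsilon> L"]) (intro loc_not loc_L that, use lin that in \<open>auto simp: lin_order_def\<close>)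
    show "\<langle>i, k\<rangle> \<epsilon> L" if "i \<epsilon> om" "j \<epsilon> om" "k \<epsilon> om" "\<langle>i, j\<rangle> \<epsilon> L" "\<langle>j, k\<rangle> \<epsilon> L" for i j k
    proof -
      have "\<langle>i, j\<rangle> \<epsilon> L \<and> \<langle>j, k\<rangle> \<epsilon> L \<longrightarrow> \<langle>i, k\<rangle> \<epsilon> L"
      proof (rule limit[of "\<lambda>a y L. \<langle>i, j\<rangle> \<epsilon> L \<and> \<langle>j, k\<rangle> \<epsilon> L \<longrightarrow> \<langle>i, k\<rangle> \<epsilon> L"])
        show "\<langle>i, j\<rangle> \<epsilon> L' \<and> \<langle>j, k\<rangle> \<epsilon> L' \<longrightarrow> \<langle>i, k\<rangle> \<epsilon> L'" if "C a' y' L'" for a' y' L'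
          using lin[OF that] \<open>i \<epsilon> om\<close> \<open>j \<epsilon> om\<close> \<open>k \<epsilon> om\<close> unfolding lin_order_def by blast
      qed (intro loc_imp loc_conj loc_L that(1-3))
      then show ?thesis using that by blast
    qed
    show "\<langle>i, j\<rangle> \<epsilon> L \<or> i = j \<or> \<langle>j, i\<rangle> \<epsilon> L" if "i \<epsilon> om" "j \<epsilon> om" for i j
    proof (rule limit[of "\<lambda>a y L. \<langle>i, j\<rangle> \<epsilon> L \<or> i = j \<or> \<langle>j, i\<rangle> \<epsilon> L"])
      show "\<langle>i, j\<rangle> \<epsilon> L' \<or> i = j \<or> \<langle>j, i\<rangle> \<epsilon> L'" if "C a' y' L'" for a' y' L'
        using lin[OF that] \<open>i \<epsilon> om\<close> \<open>j \<epsilon> om\<close> unfolding lin_order_def by blast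
    qed (intro loc_disj loc_const loc_L that)
  qed
  moreover have "Good (eY y i) (gY y i) (lY L i) a (var a (\<sigma> \<cdot> i))" if i: "i \<epsilon> om" and ninit: "\<not> init a (\<sigma> \<cdot> i)" for i
  proof -
    let ?s = "\<sigma> \<cdot> i"
    have s: "?s \<epsilon> str" using \<sigma>(1) i unfolding maps_def by blast
    \<comment> \<open>The guard is decided by a finite part of \<open>a\<close>, so near the limit
      the approximations fail to extend \<open>?s\<close> as well and must carry a good
      code.\<close>
    have *: "P a y L" if P: "loc a y L P"
      and C: "\<And>a' y' L'. Good (eY y' i) (gY y' i) (lY L' i) a' (var a' ?s) \<Longrightarrow> P a' y' L'" for P
    proof -
      have "\<not> init a ?s \<longrightarrow> P a y L"
        by (rule limit[of "\<lambda>a y L. \<not> init a ?s \<longrightarrow> P a y L"])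
           (intro loc_imp loc_not loc_init s P, use C i in \<open>auto simp: C_def\<close>)
      then show ?thesis using ninit by blast
    qed
    have g_om: "gY y i m \<epsilon> om" if "m \<epsilon> om" for m using y i that unfolding gY_def maps_def by simp
    have names: "names (eY y i) (gY y i) c (\<lambda>z. A a z)"
      if c: "c \<epsilon> om" and A: "\<And>z. loc a y L (\<lambda>a y L. A a z)"
        and C: "\<And>a' y' L'. Good (eY y' i) (gY y' i) (lY L' i) a' (var a' ?s) \<Longrightarrow> names (eY y' i) (gY y' i) c (\<lambda>z. A a' z)"
      for c A
      unfolding names_def
    proof (intro conjI allI impI)
      fix m assume m: "m \<epsilon> om" "eY y i m c"
      show "gY y i m \<epsilon> om" by (rule g_om[OF m(1)])
      have "eY y i m c \<longrightarrow> A a (t \<cdot> gY y i m) \<and> eqv (eY y i) m (rn (gY y i m))"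
      proof (rule *[of "\<lambda>a y L. eY y i m c \<longrightarrow> A a (t \<cdot> gY y i m) \<and> eqv (eY y i) m (rn (gY y i m))"])
        show "loc a y L (\<lambda>a y L. eY y i m c \<longrightarrow> A a (t \<cdot> gY y i m) \<and> eqv (eY y i) m (rn (gY y i m)))"
          by (rule loc_bind[where G = "\<lambda>a y L. gY y i m" and F = "\<lambda>a y L v. eY y i m c \<longrightarrow> A a (t \<cdot> v) \<and> eqv (eY y i) m (rn v)"])
             (intro loc_gY loc_imp loc_conj loc_eY loc_eqv A node_om i m c g_om)+
      qed (use C m in \<open>auto simp: names_def\<close>)
      then show "A a (t \<cdot> gY y i m)" "eqv (eY y i) m (rn (gY y i m))" using m by blast+
    next
      fix j assume j: "j \<epsilon> om" "A a (t \<cdot> j)"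
      have "A a (t \<cdot> j) \<longrightarrow> eY y i (rn j) c"
        by (rule *[of "\<lambda>a y L. A a (t \<cdot> j) \<longrightarrow> eY y i (rn j) c"])
           (intro loc_imp A loc_eY node_om i j c, use C j in \<open>auto simp: names_def\<close>)
      then show "eY y i (rn j) c" using j by blast
    qed
    show ?thesis unfolding Good_def[of "eY y i"]
    proof (intro conjI)
      show "\<forall>m n. m \<epsilon> om \<longrightarrow> n \<epsilon> om \<longrightarrow> eY y i m n \<longrightarrow> lY L i m n"
      proof (intro allI impI)
        fix m n assume m: "m \<epsilon> om" "n \<epsilon> om" "eY y i m n"
        have "eY y i m n \<longrightarrow> lY L i m n"
          by (rule *[of "\<lambda>a y L. eY y i m n \<longrightarrow> lY L i m n"])
             (intro loc_imp loc_eY loc_lY i m, use m in \<open>auto simp: Good_def\<close>)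
        then show "lY L i m n" using m by blast
      qed
      show "\<forall>m n k. m \<epsilon> om \<longrightarrow> n \<epsilon> om \<longrightarrow> k \<epsilon> om \<longrightarrow> eqv (eY y i) m n \<longrightarrow>
        (eY y i k m \<longleftrightarrow> eY y i k n) \<and> (eY y i m k \<longleftrightarrow> eY y i n k)"
      proof (intro allI impI)
        fix m n k assume m: "m \<epsilon> om" "n \<epsilon> om" "k \<epsilon> om" "eqv (eY y i) m n"
        have "eqv (eY y i) m n \<longrightarrow> (eY y i k m \<longleftrightarrow> eY y i k n) \<and> (eY y i m k \<longleftrightarrow> eY y i n k)"
        proof (rule *[of "\<lambda>a y L. eqv (eY y i) m n \<longrightarrow> (eY y i k m \<longleftrightarrow> eY y i k n) \<and> (eY y i m k \<longleftrightarrow> eY y i n k)"])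
          show "eqv (eY y' i) m n \<longrightarrow> (eY y' i k m \<longleftrightarrow> eY y' i k n) \<and> (eY y' i m k \<longleftrightarrow> eY y' i n k)"
            if "Good (eY y' i) (gY y' i) (lY L' i) a' (var a' ?s)" for a' y' L'
            using that m(1-3) unfolding Good_def by blast
        qed (intro loc_imp loc_conj loc_iff loc_eqv loc_eY i m)
        then show "(eY y i k m \<longleftrightarrow> eY y i k n) \<and> (eY y i m k \<longleftrightarrow> eY y i n k)" using m by blast
      qed
      show "\<forall>k. k \<epsilon> om \<longrightarrow> names (eY y i) (gY y i) (rn k) (\<lambda>y. y \<epsilon> t \<cdot> k)"
        by (intro allI impI, rule names[of _ "\<lambda>a z. z \<epsilon> t \<cdot> _"]) (auto intro: loc_const simp: Good_def)
      show "names (eY y i) (gY y i) nA (\<lambda>y. y \<epsilon> a)"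
        by (rule names[of _ "\<lambda>a z. z \<epsilon> a"]) (auto intro: loc_a a simp: Good_def)
      show "names (eY y i) (gY y i) nB (\<lambda>y. y \<epsilon> var a ?s)"
        by (rule names[of _ "\<lambda>a z. z \<epsilon> var a ?s"]) (simp, rule loc_var[OF a], simp only: Good_def)
      show "\<forall>p\<in>exs \<chi>. \<forall>c m. c \<epsilon> om \<longrightarrow> m \<epsilon> om \<longrightarrow>
        Sk (eY y i) (snd p) (updc (fst p) m c) \<longrightarrow> Sk (eY y i) (Ex (fst p) (snd p)) c"
      proof (intro ballI allI impI)
        fix p c m assume p: "p \<in> exs \<chi>" "c \<epsilon> om" "m \<epsilon> om" "Sk (eY y i) (snd p) (updc (fst p) m c)"
        have "Sk (eY y i) (snd p) (updc (fst p) m c) \<longrightarrow> Sk (eY y i) (Ex (fst p) (snd p)) c"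
        proof (rule *[of "\<lambda>a y L. Sk (eY y i) (snd p) (updc (fst p) m c) \<longrightarrow> Sk (eY y i) (Ex (fst p) (snd p)) c"])
          show "Sk (eY y' i) (snd p) (updc (fst p) m c) \<longrightarrow> Sk (eY y' i) (Ex (fst p) (snd p)) c"
            if "Good (eY y' i) (gY y' i) (lY L' i) a' (var a' ?s)" for a' y' L'
            using that p(1-3) unfolding Good_def by blast
        qed (intro loc_imp loc_Sk updc_om i p)
        then show "Sk (eY y i) (Ex (fst p) (snd p)) c" using p by blast
      qed
      show "Sk (eY y i) \<chi> q0"
        by (rule *[of "\<lambda>a y L. Sk (eY y i) \<chi> q0"]) (intro loc_Sk i q0_om, simp add: Good_def)
    qed
  qed
  ultimately show ?thesis unfolding C_def using a y L by blast
qed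

definition related_code :: "'a \<Rightarrow> 'a \<Rightarrow> bool" where
  "related_code a b \<longleftrightarrow> (\<exists>s. s u = a \<and> s v = b \<and> s w = x \<and> sat E s \<chi>)"

lemma var_sub: "a \<sqsubseteq> om \<Longrightarrow> s \<epsilon> str \<Longrightarrow> var a s \<sqsubseteq> om"
  using str_len[of s] str_sub[of s] om_sub[of "p1 s"] unfolding subset_of_def by auto

text \<open>In one direction the witness is restricted to its slices. In the other, codes for all
  variants are chosen simultaneously and their orders are placed one after another; a sum of
  wellorders along \<open>om\<close> is a wellorder.\<close>

lemma related_iff:
  assumes a: "a \<sqsubseteq> om"
  shows "(\<exists>y L. C a y L \<and> wf_on om (\<lambda>i j. \<langle>i, j\<rangle> \<epsilon> L)) \<longleftrightarrow>
    (\<forall>s. s \<epsilon> str \<longrightarrow> \<not> init a s \<longrightarrow> related_code a (var a s))"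
proof
  assume "\<exists>y L. C a y L \<and> wf_on om (\<lambda>i j. \<langle>i, j\<rangle> \<epsilon> L)"
  then obtain y L where C: "C a y L" and wf: "wf_on om (\<lambda>i j. \<langle>i, j\<rangle> \<epsilon> L)" by blast
  show "\<forall>s. s \<epsilon> str \<longrightarrow> \<not> init a s \<longrightarrow> related_code a (var a s)"
  proof (intro allI impI)
    fix s assume s: "s \<epsilon> str" "\<not> init a s"
    obtain i where i: "i \<epsilon> om" "s = \<sigma> \<cdot> i" using \<sigma>(2)[OF s(1)] by blast
    have good: "Good (eY y i) (gY y i) (lY L i) a (var a s)" using C s(2) i unfolding C_def by blast
    have "definable (\<lambda>e. eY y i (e 0) (e 1))" unfolding eY_def by (intro dfn)
    moreover have "wf_on om (lY L i)" unfolding wf_on_def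
    proof (intro allI impI)
      fix S assume S: "S \<sqsubseteq> om" "S \<noteq> \<emptyset>"
      have d: "dterm (\<lambda>e. pr i (e 0))" by (intro dfn)
      have "repl S (pr i) \<sqsubseteq> om" unfolding subset_of_def mem_repl[OF d] using S(1) i(1) by (auto dest: subD)
      moreover have "repl S (pr i) \<noteq> \<emptyset>" using S(2) unfolding eq_emp_iff mem_repl[OF d] by blast
      ultimately obtain m where "m \<epsilon> repl S (pr i)" "\<forall>n. n \<epsilon> repl S (pr i) \<longrightarrow> \<not> \<langle>n, m\<rangle> \<epsilon> L"
        using wf unfolding wf_on_def by blast
      then show "\<exists>m. m \<epsilon> S \<and> (\<forall>n. n \<epsilon> S \<longrightarrow> \<not> lY L i n m)"
        unfolding lY_def mem_repl[OF d] by blast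
    qed
    ultimately show "related_code a (var a s)"
      unfolding related_code_def using Good_sound[OF good _ _ a var_sub[OF a s(1)]] by blast
  qed
next
  assume rel: "\<forall>s. s \<epsilon> str \<longrightarrow> \<not> init a s \<longrightarrow> related_code a (var a s)"
  let ?F = "\<lambda>z m n. \<langle>m, n\<rangle> \<epsilon> p1 z" and ?H = "\<lambda>z m. p1 (p2 z) \<cdot> m" and ?L = "\<lambda>z m n. \<langle>m, n\<rangle> \<epsilon> p2 (p2 z)"
  define Q where "Q i z \<longleftrightarrow> lin_order (p2 (p2 z)) om \<and> wf_on om (?L z) \<and>
    (\<not> init a (\<sigma> \<cdot> i) \<longrightarrow> Good (?F z) (?H z) (?L z) a (var a (\<sigma> \<cdot> i)))" for i z
  let ?B = "pow (om \<otimes> om) \<otimes> (fspace om om \<otimes> pow (om \<otimes> om))"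
  have dQ: "definable (\<lambda>e. Q (e 0) (e 1))"
  proof -
    have F: "definable (\<lambda>e. ?F (e 0) (e 1) (e 2))" and H: "dterm (\<lambda>e. ?H (e 0) (e 1))"
      and L: "definable (\<lambda>e. ?L (e 0) (e 1) (e 2))" by (intro dfn)+
    have "definable (\<lambda>e. Good (?F (e 1)) (?H (e 1)) (?L (e 1)) a (var a (\<sigma> \<cdot> e 0)))"
      by (rule definable_comp3[where Q = "\<lambda>z a b. Good (?F z) (?H z) (?L z) a b", OF definable_Good[OF F H L]])
         (intro dfn)+
    then show ?thesis unfolding Q_def wf_on_def by (intro dfn)
  qed
  have "\<exists>z. z \<epsilon> ?B \<and> Q i z" if i: "i \<epsilon> om" for i
  proof (cases "init a (\<sigma> \<cdot> i)")
    case True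
    \<comment> \<open>A string on the real asks for no code, but its slice of the sum must still be
      a wellorder; the natural order serves.\<close>
    define l where "l = sep (om \<otimes> om) (\<lambda>p. p1 p \<epsilon> p2 p)"
    have ml: "p \<epsilon> l \<longleftrightarrow> p \<epsilon> om \<otimes> om \<and> p1 p \<epsilon> p2 p" for p unfolding l_def by (rule mem_sep) (intro dfn)
    have l_iff: "\<langle>m, n\<rangle> \<epsilon> l \<longleftrightarrow> m \<epsilon> om \<and> n \<epsilon> om \<and> m \<epsilon> n" for m n unfolding ml by auto
    have "lin_order l om" unfolding lin_order_def l_iff using om_trans om_linear mem_irrefl by blast
    moreover have "wf_on om (\<lambda>m n. \<langle>m, n\<rangle> \<epsilon> l)"
      using wf_on_mem[of om] unfolding wf_on_def l_iff by blast
    moreover have "l \<sqsubseteq> om \<otimes> om" unfolding subset_of_def ml by blast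
    moreover have "maps (lam om (\<lambda>_. \<emptyset>)) om om" by (rule maps_lam) (intro dfn, simp)
    ultimately show ?thesis using True
      by (intro exI[of _ "\<langle>\<emptyset>, \<langle>lam om (\<lambda>_. \<emptyset>), l\<rangle>\<rangle>"]) (auto simp: Q_def subset_of_def)
  next
    case False
    have s: "\<sigma> \<cdot> i \<epsilon> str" using \<sigma>(1) i unfolding maps_def by blast
    then have "related_code a (var a (\<sigma> \<cdot> i))" using rel False by blast
    then obtain s where "s u = a" "s v = var a (\<sigma> \<cdot> i)" "s w = x" "sat E s \<chi>" unfolding related_code_def by blast
    from Good_complete[OF this a var_sub[OF a s]] obtain e g l where
      "e \<sqsubseteq> om \<otimes> om" "maps g om om" "l \<sqsubseteq> om \<otimes> om" "lin_order l om" "wf_on om (\<lambda>m n. \<langle>m, n\<rangle> \<epsilon> l)"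
      "Good (\<lambda>m n. \<langle>m, n\<rangle> \<epsilon> e) (\<lambda>m. g \<cdot> m) (\<lambda>m n. \<langle>m, n\<rangle> \<epsilon> l) a (var a (\<sigma> \<cdot> i))" by blast
    then show ?thesis by (intro exI[of _ "\<langle>e, \<langle>g, l\<rangle>\<rangle>"]) (simp add: Q_def)
  qed
  from set_choice[OF dQ this, of om] obtain h where hB: "maps h om ?B" and hQ: "\<And>i. i \<epsilon> om \<Longrightarrow> Q i (h \<cdot> i)" by blast
  \<comment> \<open>\<open>k\<close> is decoded as variant, kind and argument. Kind
    \<open>\<emptyset>\<close> stores the characteristic function of the relation, every other kind
    the locating function.\<close>
  define G where "G k = (if prl (prr k) = \<emptyset> then
      (if \<langle>prl (prr (prr k)), prr (prr (prr k))\<rangle> \<epsilon> p1 (h \<cdot> prl k) then suc \<emptyset> else \<emptyset>)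
    else p1 (p2 (h \<cdot> prl k)) \<cdot> prr (prr k))" for k
  have dG: "dterm (\<lambda>e. G (e 0))" unfolding G_def by (intro dfn)
  have parts: "p1 (h \<cdot> i) \<sqsubseteq> om \<otimes> om \<and> maps (p1 (p2 (h \<cdot> i))) om om \<and> p2 (p2 (h \<cdot> i)) \<sqsubseteq> om \<otimes> om" if "i \<epsilon> om" for i
  proof -
    have "h \<cdot> i \<epsilon> ?B" using hB that unfolding maps_def by blast
    then show ?thesis unfolding mem_prod by auto
  qed
  define y where "y = lam om G"
  have y: "maps y om om" unfolding y_def
  proof (rule maps_lam[OF dG])
    fix k assume k: "k \<epsilon> om"
    then show "G k \<epsilon> om" using parts[OF prl_om[OF k]] unfolding G_def maps_def by simp
  qed
  define L where "L = sep (om \<otimes> om) (\<lambda>p. prl (p1 p) \<epsilon> prl (p2 p) \<or>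
    prl (p1 p) = prl (p2 p) \<and> \<langle>prr (p1 p), prr (p2 p)\<rangle> \<epsilon> p2 (p2 (h \<cdot> prl (p1 p))))"
  have mL: "p \<epsilon> L \<longleftrightarrow> p \<epsilon> om \<otimes> om \<and> (prl (p1 p) \<epsilon> prl (p2 p) \<or>
    prl (p1 p) = prl (p2 p) \<and> \<langle>prr (p1 p), prr (p2 p)\<rangle> \<epsilon> p2 (p2 (h \<cdot> prl (p1 p))))" for p
    unfolding L_def by (rule mem_sep) (intro dfn)
  have L_iff: "\<langle>m, n\<rangle> \<epsilon> L \<longleftrightarrow> m \<epsilon> om \<and> n \<epsilon> om \<and> (prl m \<epsilon> prl n \<or>
    prl m = prl n \<and> \<langle>prr m, prr n\<rangle> \<epsilon> p2 (p2 (h \<cdot> prl m)))" for m n unfolding mL by simp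
  have lin: "lin_order (p2 (p2 (h \<cdot> i))) om" and wf: "wf_on om (\<lambda>m n. \<langle>m, n\<rangle> \<epsilon> p2 (p2 (h \<cdot> i)))" if "i \<epsilon> om" for i
    using hQ[OF that] unfolding Q_def by blast+
  have "lin_order L om" unfolding lin_order_def
  proof (intro conjI allI impI)
    fix i assume i: "i \<epsilon> om"
    show "\<not> \<langle>i, i\<rangle> \<epsilon> L" unfolding L_iff using lin[OF prl_om[OF i]] prr_om[OF i] unfolding lin_order_def by auto
  next
    fix i j k assume *: "i \<epsilon> om" "j \<epsilon> om" "k \<epsilon> om" "\<langle>i, j\<rangle> \<epsilon> L" "\<langle>j, k\<rangle> \<epsilon> L"
    have tr: "\<langle>prr i, prr j\<rangle> \<epsilon> l \<Longrightarrow> \<langle>prr j, prr k\<rangle> \<epsilon> l \<Longrightarrow> \<langle>prr i, prr k\<rangle> \<epsilon> l" if "lin_order l om" for l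
      using that *(1-3) unfolding lin_order_def by (meson prr_om)
    show "\<langle>i, k\<rangle> \<epsilon> L"
      using * tr[OF lin[OF prl_om[OF *(1)]]] om_trans[of "prl i" "prl j" "prl k"] prl_om[OF *(3)] unfolding L_iff by auto
  next
    fix i j assume *: "i \<epsilon> om" "j \<epsilon> om"
    have "prr i = prr j \<Longrightarrow> prl i = prl j \<Longrightarrow> i = j" using pr_prl_prr[OF *(1)] pr_prl_prr[OF *(2)] by metis
    moreover have "\<langle>prr i, prr j\<rangle> \<epsilon> p2 (p2 (h \<cdot> prl i)) \<or> prr i = prr j \<or> \<langle>prr j, prr i\<rangle> \<epsilon> p2 (p2 (h \<cdot> prl i))"
      using lin[OF prl_om[OF *(1)]] prr_om[OF *(1)] prr_om[OF *(2)] unfolding lin_order_def by blast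
    ultimately show "\<langle>i, j\<rangle> \<epsilon> L \<or> i = j \<or> \<langle>j, i\<rangle> \<epsilon> L"
      using om_linear[OF prl_om[OF *(1)] prl_om[OF *(2)]] * unfolding L_iff by auto
  qed
  moreover have "wf_on om (\<lambda>i j. \<langle>i, j\<rangle> \<epsilon> L)" unfolding wf_on_def
  proof (intro allI impI)
    fix S assume S: "S \<sqsubseteq> om" "S \<noteq> \<emptyset>"
    have So: "m \<epsilon> om" if "m \<epsilon> S" for m using S(1) that subD by blast
    have d: "dterm (\<lambda>e. prl (e 0))" and d2: "dterm (\<lambda>e. prr (e 0))" by (intro dfn)+
    obtain m where "m \<epsilon> S" using S(2) eq_emp_iff by blast
    then have "prl m \<epsilon> repl S prl" unfolding mem_repl[OF d] by blast
    from foundation[OF this] obtain m where m: "m \<epsilon> S" "\<And>n. n \<epsilon> S \<Longrightarrow> \<not> prl n \<epsilon> prl m"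
      unfolding mem_repl[OF d] by blast
    let ?T = "repl (sep S (\<lambda>n. prl n = prl m)) prr"
    have mT: "k \<epsilon> ?T \<longleftrightarrow> (\<exists>n. n \<epsilon> S \<and> prl n = prl m \<and> k = prr n)" for k
      unfolding mem_repl[OF d2] by (subst mem_sep) (intro dfn, blast)
    have "?T \<sqsubseteq> om" unfolding subset_of_def mT using So by auto
    moreover have "?T \<noteq> \<emptyset>" unfolding eq_emp_iff mT using m(1) by blast
    ultimately obtain k where k: "k \<epsilon> ?T" "\<And>j. j \<epsilon> ?T \<Longrightarrow> \<not> \<langle>j, k\<rangle> \<epsilon> p2 (p2 (h \<cdot> prl m))"
      using wf[OF prl_om[OF So[OF m(1)]]] unfolding wf_on_def by blast
    then obtain n where n: "n \<epsilon> S" "prl n = prl m" "k = prr n" unfolding mT by blast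
    have "\<not> \<langle>j, n\<rangle> \<epsilon> L" if "j \<epsilon> S" for j
      unfolding L_iff using m(2)[OF that] k(2)[of "prr j"] n that unfolding mT by auto
    then show "\<exists>n. n \<epsilon> S \<and> (\<forall>j. j \<epsilon> S \<longrightarrow> \<not> \<langle>j, n\<rangle> \<epsilon> L)" using n(1) by blast
  qed
  moreover have "Good (eY y i) (gY y i) (lY L i) a (var a (\<sigma> \<cdot> i))" if i: "i \<epsilon> om" and n: "\<not> init a (\<sigma> \<cdot> i)" for i
  proof -
    have G: "Good (?F (h \<cdot> i)) (?H (h \<cdot> i)) (?L (h \<cdot> i)) a (var a (\<sigma> \<cdot> i))" using hQ[OF i] n unfolding Q_def by blast
    have e: "eY y i m n \<longleftrightarrow> ?F (h \<cdot> i) m n" if "m \<epsilon> om" "n \<epsilon> om" for m n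
    proof -
      have "y \<cdot> pr i (pr \<emptyset> (pr m n)) = G (pr i (pr \<emptyset> (pr m n)))"
        unfolding y_def by (rule app_lam[OF dG]) (use that i in simp)
      also have "\<dots> = (if \<langle>m, n\<rangle> \<epsilon> p1 (h \<cdot> i) then suc \<emptyset> else \<emptyset>)"
        using that i by (simp add: G_def del: pr_zero)
      finally show ?thesis unfolding eY_def by simp
    qed
    have g: "gY y i m = ?H (h \<cdot> i) m" if "m \<epsilon> om" for m
    proof -
      have "y \<cdot> pr i (pr (suc \<emptyset>) m) = G (pr i (pr (suc \<emptyset>) m))"
        unfolding y_def by (rule app_lam[OF dG]) (use that i in simp)
      also have "\<dots> = p1 (p2 (h \<cdot> i)) \<cdot> m" using that i by (simp add: G_def del: pr_suc)
      finally show ?thesis unfolding gY_def .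
    qed
    have l: "lY L i m n \<longleftrightarrow> ?L (h \<cdot> i) m n" if "m \<epsilon> om" "n \<epsilon> om" for m n
      unfolding lY_def L_iff using that i by simp
    have q: "eqv (eY y i) m n \<longleftrightarrow> eqv (?F (h \<cdot> i)) m n" if "m \<epsilon> om" "n \<epsilon> om" for m n
      unfolding eqv_def using e that by simp
    have Sk: "Sk (eY y i) \<phi> c \<longleftrightarrow> Sk (?F (h \<cdot> i)) \<phi> c" if "c \<epsilon> om" for \<phi> c
      using that by (induction \<phi> arbitrary: c) (simp_all add: e q)
    have g_om: "?H (h \<cdot> i) m \<epsilon> om" if "m \<epsilon> om" for m using parts[OF i] that unfolding maps_def by blast
    have nm: "names (eY y i) (gY y i) c P \<longleftrightarrow> names (?F (h \<cdot> i)) (?H (h \<cdot> i)) c P" if "c \<epsilon> om" for c P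
      unfolding names_def using e g q that g_om by (simp cong: conj_cong)
    show ?thesis using G unfolding Good_def by (simp add: e l q Sk nm)
  qed
  moreover have "L \<sqsubseteq> om \<otimes> om" unfolding subset_of_def mL by blast
  ultimately show "\<exists>y L. C a y L \<and> wf_on om (\<lambda>i j. \<langle>i, j\<rangle> \<epsilon> L)" using a y unfolding C_def by blast
qed

end

section \<open>Wellorderings of the reals\<close>

context zfc begin

lemma var_flip: "a \<sqsubseteq> om \<Longrightarrow> n \<epsilon> om \<Longrightarrow>
  \<exists>s. s \<epsilon> str \<and> \<not> init a s \<and> var a s = flip n a"
proof -
  assume n: "n \<epsilon> om"
  let ?s = "\<langle>suc n, flip n a \<sqinter> suc n\<rangle>"
  have "?s \<epsilon> str" using n by (auto simp: subset_of_def)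
  moreover have "\<not> init a ?s" unfolding init_def by auto
  moreover have "var a ?s = flip n a" by (rule ext) auto
  ultimately show ?thesis by blast
qed

text \<open>Both changes take place below the larger of the two lengths, so a single string of that
  length performs them.\<close>

lemma var_var:
  assumes "v \<epsilon> str" "s \<epsilon> str" shows "\<exists>r. r \<epsilon> str \<and> var (var a v) s = var a r"
proof -
  let ?n = "p1 v \<squnion> p1 s"
  let ?r = "\<langle>?n, var (var a v) s \<sqinter> ?n\<rangle>"
  have "?r \<epsilon> str" using om_un[OF str_len str_len] assms by (auto simp: subset_of_def)
  moreover have "var (var a v) s = var a ?r"
    by (rule ext) (use str_sub[OF assms(1)] str_sub[OF assms(2)] in \<open>auto simp: subset_of_def\<close>)
  ultimately show ?thesis by blast
qed

lemma no_Sigma1_wellordering: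
  assumes "\<exists>\<kappa>. measurable_cardinal E \<kappa>" and x: "hereditarily_countable E x"
    and R: "is_wellordering E R (pow om)" "Sigma1_definable E x R"
  shows False
proof -
  obtain K U where "zfc_measure E K U" using assms(1) measurable_measure by blast
  then interpret zfc_measure E K U .
  obtain \<chi> u v w N where \<chi>: "Delta0 \<chi>" "fv \<chi> \<subseteq> {..<N}" "distinct [u, v, w]" "u < N" "v < N" "w < N"
    "\<And>a b. \<langle>a, b\<rangle> \<epsilon> R \<longleftrightarrow> (\<exists>e. e u = a \<and> e v = b \<and> e w = x \<and> sat E e \<chi>)"
    using Sigma1_relation[OF R(2)] by blast
  obtain T where T: "is_transitive_closure E x T" "countable_set E T"
    using x unfolding hereditarily_countable_def by blast
  \<comment> \<open>\<open>x\<close> itself and the elements of reals need names too, hence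
    \<open>x\<close> and all numbers are added to the transitive closure.\<close>
  let ?T = "T \<squnion> upr x x \<squnion> om"
  have "cnt ?T" using T(2) unfolding countable_set_iff by (intro cnt_un cnt_sing cnt_om)
  moreover have "x \<epsilon> ?T" by simp
  ultimately obtain t where t: "maps t om ?T" "\<And>y. y \<epsilon> ?T \<Longrightarrow> \<exists>n. n \<epsilon> om \<and> y = t \<cdot> n"
    using cnt_enum by blast
  obtain kx where kx: "kx \<epsilon> om" "x = t \<cdot> kx" using t(2)[OF \<open>x \<epsilon> ?T\<close>] by blast
  have T_trans: "y \<epsilon> ?T" if "z \<epsilon> ?T" "y \<epsilon> z" for y z
    using that T(1) om_mem unfolding is_transitive_closure_def transitive_set_def subset_of_def mem_un mem_upr by blast
  obtain idx :: "nat \<times> fm \<Rightarrow> nat" where idx: "inj_on idx (exs \<chi>)"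
    using finite_imp_inj_to_nat_seg[OF finite_exs] by blast
  have str0: "\<langle>\<emptyset>, \<emptyset>\<rangle> \<epsilon> str" by simp
  obtain \<sigma> where \<sigma>: "maps \<sigma> om str" "\<And>s. s \<epsilon> str \<Longrightarrow> \<exists>i. i \<epsilon> om \<and> s = \<sigma> \<cdot> i"
    using cnt_enum[OF cnt_str str0] by blast
  interpret rc: real_coding E t x kx \<chi> u v w N idx \<sigma>
  proof unfold_locales
    show "\<exists>j. j \<epsilon> om \<and> y = t \<cdot> j" if "k \<epsilon> om" "y \<epsilon> t \<cdot> k" for k y
      using t T_trans[OF _ that(2)] that(1) unfolding maps_def by blast
    show "\<exists>j. j \<epsilon> om \<and> n = t \<cdot> j" if "n \<epsilon> om" for n using t(2)[of n] that by simp
  qed (use kx \<chi> idx \<sigma> in auto)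
  interpret closed_game E K U rc.C
  proof unfold_locales
    show "a \<sqsubseteq> om \<and> maps y om om \<and> L \<sqsubseteq> om \<otimes> om \<and> lin_order L om" if "rc.C a y L" for a y L
      using that unfolding rc.C_def by blast
  qed (use rc.C_definable rc.C_closed in blast)+
  define r where "r a b \<longleftrightarrow> \<langle>a, b\<rangle> \<epsilon> R" for a b
  have rel: "related E R a b \<longleftrightarrow> r a b" for a b unfolding r_def related_def is_pair_iff by blast
  have "linear_wellfounded E R (pow om)"
    using R(1) unfolding is_wellordering_def strict_wellordering_def reflexive_wellordering_def by blast
  then have r_trans: "\<And>a b c. r a b \<Longrightarrow> r b c \<Longrightarrow> r a c"
    and r_min: "\<And>S. S \<sqsubseteq> pow om \<Longrightarrow> S \<noteq> \<emptyset> \<Longrightarrow> \<exists>m. m \<epsilon> S \<and> (\<forall>y. y \<epsilon> S \<longrightarrow> y \<noteq> m \<longrightarrow> r m y)"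
    unfolding linear_wellfounded_def rel is_empty_def eq_emp_iff by blast+
  \<comment> \<open>In the strict case transitivity would give \<open>r a a\<close>; in the
    reflexive case this is antisymmetry. From here on both conventions are treated alike.\<close>
  have r_asym: "a = b" if "r a b" "r b a" "a \<sqsubseteq> om" for a b
    using R(1) that r_trans[OF that(1,2)]
    unfolding is_wellordering_def strict_wellordering_def reflexive_wellordering_def rel mem_pow by blast
  have proj: "projection a \<longleftrightarrow> a \<sqsubseteq> om \<and> (\<forall>s. s \<epsilon> str \<longrightarrow> \<not> init a s \<longrightarrow> r a (var a s))" for a
    using rc.related_iff[of a] C_dom[of a] unfolding projection_def rc.related_code_def r_def \<chi>(7) by blast
  show False
  proof (rule no_transversal)
    fix a n assume n: "n \<epsilon> om" and a: "projection a"
    show "\<not> projection (flip n a)"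
    proof
      assume b: "projection (flip n a)"
      have sub: "a \<sqsubseteq> om" "flip n a \<sqsubseteq> om" using a b unfolding proj by blast+
      have "flip n (flip n a) = a" by (rule ext) auto
      then have "r a (flip n a)" "r (flip n a) a"
        using a b var_flip[OF sub(1) n] var_flip[OF sub(2) n] unfolding proj by metis+
      then have "a = flip n a" using r_asym sub(1) by blast
      then show False using mem_flip[of n n a] by auto
    qed
  next
    fix a assume a: "a \<sqsubseteq> om"
    have d: "dterm (\<lambda>e. var a (e 0))" by (intro dfn)
    have m: "y \<epsilon> repl str (var a) \<longleftrightarrow> (\<exists>v. v \<epsilon> str \<and> y = var a v)" for y by (rule mem_repl[OF d])
    have "repl str (var a) \<sqsubseteq> pow om" by (rule subI) (use rc.var_sub[OF a] in \<open>auto simp: m\<close>)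
    moreover have "repl str (var a) \<noteq> \<emptyset>" unfolding eq_emp_iff m using str0 by blast
    ultimately obtain b where b: "b \<epsilon> repl str (var a)" "\<And>y. y \<epsilon> repl str (var a) \<Longrightarrow> y \<noteq> b \<Longrightarrow> r b y"
      using r_min by blast
    then obtain v where v: "v \<epsilon> str" "b = var a v" unfolding m by blast
    have "r b (var b s)" if s: "s \<epsilon> str" "\<not> init b s" for s
    proof (rule b(2))
      show "var b s \<epsilon> repl str (var a)" unfolding m v(2) using var_var[OF v(1) s(1)] by blast
      \<comment> \<open>Overwriting by \<open>s\<close> changes nothing only when \<open>s\<close>
        is an initial segment, so the guard exempts just the trivial variants.\<close>
      show "var b s \<noteq> b"
      proof
        assume eq: "var b s = b"
        have "m \<epsilon> p2 s \<longleftrightarrow> m \<epsilon> var b s \<and> m \<epsilon> p1 s" for m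
          using str_sub[OF s(1)] by (auto simp: subset_of_def)
        then show False using s(2) unfolding init_def eq by blast
      qed
    qed
    then have "projection b" unfolding proj using rc.var_sub[OF a v(1)] v(2) by blast
    then show "\<exists>v. v \<epsilon> str \<and> projection (var a v)" using v by blast
  qed
qed

end

theorem lemma1p2:
  fixes E :: "'a \<Rightarrow> 'a \<Rightarrow> bool" and x :: 'a
  assumes "ZFC E"
    and "\<exists>\<kappa>. measurable_cardinal E \<kappa>"
    and "hereditarily_countable E x"
  shows "\<not> (\<exists>w P R. is_omega E w \<and> is_Pow E w P \<and> is_wellordering E R P \<and> Sigma1_definable E x R)"
proof
  interpret zfc E by unfold_locales (rule assms(1))
  assume "\<exists>w P R. is_omega E w \<and> is_Pow E w P \<and> is_wellordering E R P \<and> Sigma1_definable E x R"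
  then obtain R where "is_wellordering E R (pow om)" "Sigma1_definable E x R"
    unfolding is_omega_iff is_Pow_iff by blast
  then show False using no_Sigma1_wellordering assms(2,3) by blast
qed

end
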